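(* \textsc{Self-Deleting $s$-$t$-path} can be solved in linear time if the underlying graph $G$ is a cactus.
   Context: All graphs are finite, simple and undirected. A self-deleting graph is a pair $(G,f)$ where $G=(V,E)$ is a graph and $f\colon V\to 2^{E}$ (the edges in $f(v)$ need not be incident to $v$). A path $(v_1,e_1,v_2,\dots,e_{k-1},v_k)$ in $G$ (with $e_i=\{v_i,v_{i+1}\}$) is $f$-conforming if $e_i\notin f(v_j)$ for all $j\le i$. In \textsc{Self-Deleting $s$-$t$-path}, the input is $(G,f)$ and $s,t\in V(G)$, and the question is whether $G$ contains an $f$-conforming $s$-$t$ path. The input size is $|V|+|E|+|f|$ where $|f|=\sum_{v\in V}|f(v)|$. A cactus is a graph in which every edge lies on at most one cycle. *)

theory Defs
  imports Main
begin

section \<open>Graphs, self-deleting graphs and conforming paths\<close>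

type_synonym 'v graph = "'v set \<times> 'v set set"

definition finite_simple_graph :: "'v graph \<Rightarrow> bool" where
  "finite_simple_graph G \<longleftrightarrow>
     finite (fst G) \<and> snd G \<subseteq> {{u, v} | u v. u \<in> fst G \<and> v \<in> fst G \<and> u \<noteq> v}"

definition self_deleting_graph :: "'v graph \<Rightarrow> ('v \<Rightarrow> 'v set set) \<Rightarrow> bool" where
  "self_deleting_graph G f \<longleftrightarrow> finite_simple_graph G \<and> (\<forall>v\<in>fst G. f v \<subseteq> snd G)"

text \<open>The graphs are simple, so a path is determined by its vertex sequence. The one-vertex
  sequence is a path (the case of equal endpoints).\<close>

definition path_edge :: "'v list \<Rightarrow> nat \<Rightarrow> 'v set" where
  "path_edge vs i = {vs ! i, vs ! Suc i}"

definition is_path :: "'v graph \<Rightarrow> 'v \<Rightarrow> 'v list \<Rightarrow> 'v \<Rightarrow> bool" where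
  "is_path G s vs t \<longleftrightarrow>
     vs \<noteq> [] \<and> hd vs = s \<and> last vs = t \<and> distinct vs \<and> set vs \<subseteq> fst G \<and>
     (\<forall>i. Suc i < length vs \<longrightarrow> path_edge vs i \<in> snd G)"

definition conforming :: "('v \<Rightarrow> 'v set set) \<Rightarrow> 'v list \<Rightarrow> bool" where
  "conforming f vs \<longleftrightarrow>
     (\<forall>i. Suc i < length vs \<longrightarrow> (\<forall>j\<le>i. path_edge vs i \<notin> f (vs ! j)))"

text \<open>A cycle is identified with its edge set, so rotations and reversals of a
  cyclic vertex sequence are the same cycle.\<close>

definition is_cycle :: "'v graph \<Rightarrow> 'v set set \<Rightarrow> bool" where
  "is_cycle G C \<longleftrightarrow>
     (\<exists>vs. 3 \<le> length vs \<and> distinct vs \<and> set vs \<subseteq> fst G \<and>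
        C = {{vs ! i, vs ! (Suc i mod length vs)} | i. i < length vs} \<and> C \<subseteq> snd G)"

definition cactus :: "'v graph \<Rightarrow> bool" where
  "cactus G \<longleftrightarrow> finite_simple_graph G \<and>
     (\<forall>e\<in>snd G. \<forall>C D. is_cycle G C \<and> is_cycle G D \<and> e \<in> C \<and> e \<in> D \<longrightarrow> C = D)"


section \<open>The decision problem\<close>

type_synonym 'v sd_instance = "'v graph \<times> ('v \<Rightarrow> 'v set set) \<times> 'v \<times> 'v"

fun sd_path_instance :: "'v sd_instance \<Rightarrow> bool" where
  "sd_path_instance (G, f, s, t) \<longleftrightarrow> self_deleting_graph G f \<and> s \<in> fst G \<and> t \<in> fst G"

fun sd_path_yes :: "'v sd_instance \<Rightarrow> bool" where
  "sd_path_yes (G, f, s, t) \<longleftrightarrow> (\<exists>vs. is_path G s vs t \<and> conforming f vs)"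

fun sd_path_size :: "'v sd_instance \<Rightarrow> nat" where
  "sd_path_size (G, f, s, t) = card (fst G) + card (snd G) + (\<Sum>v\<in>fst G. card (f v))"

text \<open>The input word lists the numbers of vertices and edges, the indices of the two terminals,
  the edges as pairs of vertex indices, and for every vertex \<open>v\<close> the
  number of elements of \<open>f v\<close> followed by their edge indices. The vertices, the edges, the two
  ends of each edge and the elements of each \<open>f v\<close> may come in any order, so one instance has
  many encodings. The length of the word is linear in the size of the instance.\<close>

fun sd_path_encodes :: "'v sd_instance \<Rightarrow> nat list \<Rightarrow> bool" where
  "sd_path_encodes (G, f, s, t) xs \<longleftrightarrow>
     (\<exists>(vs :: 'v list) (es :: (nat \<times> nat) list) (fs :: nat list list) (a :: nat) (b :: nat).
        let edge = (\<lambda>k. {vs ! fst (es ! k), vs ! snd (es ! k)}) in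
        distinct vs \<and> set vs = fst G \<and>
        (\<forall>k<length es. fst (es ! k) < length vs \<and> snd (es ! k) < length vs) \<and>
        inj_on edge {..<length es} \<and> edge ` {..<length es} = snd G \<and>
        length fs = length vs \<and>
        (\<forall>i<length vs. distinct (fs ! i) \<and> set (fs ! i) \<subseteq> {..<length es} \<and>
                        edge ` set (fs ! i) = f (vs ! i)) \<and>
        a < length vs \<and> vs ! a = s \<and> b < length vs \<and> vs ! b = t \<and>
        xs = [length vs, length es, a, b] @ concat (map (\<lambda>(i, j). [i, j]) es) @
             concat (map (\<lambda>l. length l # l) fs))"


section \<open>Word RAM programs\<close>

text \<open>Random access machine with registers and finitely many (per program) arrays of natural
  numbers, programmed by structured control flow. Every elementary command and every evaluation
  of a test costs one step.\<close>

datatype operand = Const nat | Reg nat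

datatype test = Less operand operand | Equal operand operand | NotEqual operand operand

datatype com =
    Skip
  | Assign nat operand
  | Add nat operand operand
  | Sub nat operand operand
  | Load nat nat operand  \<comment> \<open>\<open>Load x A i\<close>: register \<open>x\<close> := array \<open>A\<close> at index \<open>i\<close>\<close>
  | Store nat operand operand  \<comment> \<open>\<open>Store A i a\<close>: array \<open>A\<close> at index \<open>i\<close> := \<open>a\<close>\<close>
  | Seq com com
  | Cond test com com
  | While test com

type_synonym state = "(nat \<Rightarrow> nat) \<times> (nat \<Rightarrow> nat \<Rightarrow> nat)"

fun val :: "state \<Rightarrow> operand \<Rightarrow> nat" where
  "val \<sigma> (Const n) = n"
| "val \<sigma> (Reg x) = fst \<sigma> x"

fun holds :: "state \<Rightarrow> test \<Rightarrow> bool" where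
  "holds \<sigma> (Less a b) \<longleftrightarrow> val \<sigma> a < val \<sigma> b"
| "holds \<sigma> (Equal a b) \<longleftrightarrow> val \<sigma> a = val \<sigma> b"
| "holds \<sigma> (NotEqual a b) \<longleftrightarrow> val \<sigma> a \<noteq> val \<sigma> b"

definition set_reg :: "state \<Rightarrow> nat \<Rightarrow> nat \<Rightarrow> state" where
  "set_reg \<sigma> x n = ((fst \<sigma>)(x := n), snd \<sigma>)"

definition set_cell :: "state \<Rightarrow> nat \<Rightarrow> nat \<Rightarrow> nat \<Rightarrow> state" where
  "set_cell \<sigma> A i n = (fst \<sigma>, (snd \<sigma>)(A := (snd \<sigma> A)(i := n)))"

text \<open>\<open>exec W c \<sigma> k \<tau>\<close>: started in \<open>\<sigma>\<close>, the program \<open>c\<close> halts in \<open>\<tau>\<close> after \<open>k\<close> steps. A command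
  that would write a number that is not below \<open>W\<close>, i.e. that does not fit into a machine word, is
  stuck: it has no execution. Subtraction is truncated at zero.\<close>

inductive exec :: "nat \<Rightarrow> com \<Rightarrow> state \<Rightarrow> nat \<Rightarrow> state \<Rightarrow> bool" for W :: nat where
  exec_Skip: "exec W Skip \<sigma> 1 \<sigma>"
| exec_Assign: "val \<sigma> a < W \<Longrightarrow> exec W (Assign x a) \<sigma> 1 (set_reg \<sigma> x (val \<sigma> a))"
| exec_Add: "val \<sigma> a + val \<sigma> b < W \<Longrightarrow>
    exec W (Add x a b) \<sigma> 1 (set_reg \<sigma> x (val \<sigma> a + val \<sigma> b))"
| exec_Sub: "val \<sigma> a - val \<sigma> b < W \<Longrightarrow>
    exec W (Sub x a b) \<sigma> 1 (set_reg \<sigma> x (val \<sigma> a - val \<sigma> b))"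
| exec_Load: "snd \<sigma> A (val \<sigma> i) < W \<Longrightarrow>
    exec W (Load x A i) \<sigma> 1 (set_reg \<sigma> x (snd \<sigma> A (val \<sigma> i)))"
| exec_Store: "val \<sigma> a < W \<Longrightarrow>
    exec W (Store A i a) \<sigma> 1 (set_cell \<sigma> A (val \<sigma> i) (val \<sigma> a))"
| exec_Seq: "exec W c \<sigma> k \<sigma>' \<Longrightarrow> exec W d \<sigma>' l \<sigma>'' \<Longrightarrow> exec W (Seq c d) \<sigma> (k + l) \<sigma>''"
| exec_CondTrue: "holds \<sigma> t \<Longrightarrow> exec W c \<sigma> k \<sigma>' \<Longrightarrow> exec W (Cond t c d) \<sigma> (Suc k) \<sigma>'"
| exec_CondFalse: "\<not> holds \<sigma> t \<Longrightarrow> exec W d \<sigma> k \<sigma>' \<Longrightarrow> exec W (Cond t c d) \<sigma> (Suc k) \<sigma>'"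
| exec_WhileFalse: "\<not> holds \<sigma> t \<Longrightarrow> exec W (While t c) \<sigma> 1 \<sigma>"
| exec_WhileTrue: "holds \<sigma> t \<Longrightarrow> exec W c \<sigma> k \<sigma>' \<Longrightarrow> exec W (While t c) \<sigma>' l \<sigma>'' \<Longrightarrow>
    exec W (While t c) \<sigma> (Suc (k + l)) \<sigma>''"

inductive_cases exec_SkipE: "exec W Skip \<sigma> k \<tau>"
inductive_cases exec_AssignE: "exec W (Assign x a) \<sigma> k \<tau>"
inductive_cases exec_AddE: "exec W (Add x a b) \<sigma> k \<tau>"
inductive_cases exec_SubE: "exec W (Sub x a b) \<sigma> k \<tau>"
inductive_cases exec_LoadE: "exec W (Load x A i) \<sigma> k \<tau>"
inductive_cases exec_StoreE: "exec W (Store A i a) \<sigma> k \<tau>"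
inductive_cases exec_SeqE: "exec W (Seq c d) \<sigma> k \<tau>"
inductive_cases exec_CondE: "exec W (Cond t c d) \<sigma> k \<tau>"
inductive_cases exec_WhileE: "exec W (While t c) \<sigma> k \<tau>"

lemma exec_deterministic:
  assumes "exec W c \<sigma> k \<tau>" and "exec W c \<sigma> k' \<tau>'"
  shows "k = k' \<and> \<tau> = \<tau>'"
  using assms
proof (induction arbitrary: k' \<tau>' rule: exec.induct)
  case (exec_Seq c \<sigma> k \<sigma>' d l \<sigma>'')
  from exec_Seq.prems show ?case
    by (rule exec_SeqE) (metis exec_Seq.IH)
next
  case (exec_CondTrue \<sigma> t c k \<sigma>' d)
  from exec_CondTrue.prems show ?case
    by (rule exec_CondE) (use exec_CondTrue.IH exec_CondTrue.hyps(1) in auto)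
next
  case (exec_CondFalse \<sigma> t d k \<sigma>' c)
  from exec_CondFalse.prems show ?case
    by (rule exec_CondE) (use exec_CondFalse.IH exec_CondFalse.hyps(1) in auto)
next
  case (exec_WhileFalse \<sigma> t c)
  from exec_WhileFalse.prems show ?case
    by (rule exec_WhileE) (use exec_WhileFalse.hyps in auto)
next
  case (exec_WhileTrue \<sigma> t c k \<sigma>' l \<sigma>'')
  from exec_WhileTrue.prems show ?case
  proof (rule exec_WhileE)
    fix k1 \<rho> l1
    assume "k' = Suc (k1 + l1)" "exec W c \<sigma> k1 \<rho>" "exec W (While t c) \<rho> l1 \<tau>'"
    then show ?case using exec_WhileTrue.IH by metis
  qed (use exec_WhileTrue.hyps(1) in simp)
qed (auto elim: exec_SkipE exec_AssignE exec_AddE exec_SubE exec_LoadE exec_StoreE)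

text \<open>Initially, array 0 holds the input word and everything else is zero.\<close>

definition input_state :: "nat list \<Rightarrow> state" where
  "input_state xs =
     (\<lambda>x. 0, \<lambda>A i. if A = 0 \<and> i < length xs then xs ! i else 0)"

text \<open>One program must work for all instances of the promise set \<open>P\<close> and all their encodings;
  register 0 holds the answer on halting. The bound \<open>(sz I + 1) ^ c\<close> on the numbers amounts to
  words of logarithmically many bits, which excludes computing with long integers at unit cost.\<close>

definition decidable_in_linear_time ::
  "('i \<Rightarrow> bool) \<Rightarrow> ('i \<Rightarrow> nat list \<Rightarrow> bool) \<Rightarrow> ('i \<Rightarrow> nat) \<Rightarrow> ('i \<Rightarrow> bool) \<Rightarrow> bool" where
  "decidable_in_linear_time P encodes sz yes \<longleftrightarrow>
     (\<exists>(p :: com) (c :: nat). \<forall>I xs. P I \<and> encodes I xs \<longrightarrow>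
        (\<exists>k \<tau>. exec ((sz I + 1) ^ c) p (input_state xs) k \<tau> \<and>
               k \<le> c * sz I \<and> fst \<tau> 0 = (if yes I then 1 else 0)))"

end

theory Submission
  imports Defs
begin

text \<open>Fix a spanning tree of the component of \<open>s\<close>. In a cactus, the cut below a vertex \<open>v\<close> consists of the
  tree edge at \<open>v\<close> and at most one non-tree edge, and a simple path from \<open>s\<close> to \<open>t\<close> crosses it an odd
  number of times iff \<open>t\<close> lies below \<open>v\<close>. So the path is determined by the set of non-tree edges that it
  uses, every vertex or edge is on it iff some literal over these edges is true, and the order along the
  path does not depend on the choices. Conformity thus becomes a set of 2-clauses, one for each pair
  of a vertex \<open>v\<close> and an edge in \<open>f v\<close> that comes after \<open>v\<close>.

  The non-tree edge crossing a cut is found by subtree sums: the non-tree edge number \<open>k\<close> contributes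
  \<open>k + 1\<close> to one sum at its tail and to another one at its head, so that the difference of the two sums
  below \<open>v\<close> is the number of the only edge that crosses the cut, up to sign.\<close>

section \<open>Simple paths\<close>

text \<open>The literals are never shown to describe a path exactly. Every assignment is turned into
  a path on which all vertices and edges have true literals and positions increase. Conversely, the
  parity of cut crossings shows that, under the assignment read off a given simple path, every true
  literal belongs to that path. The constructed path then has its edges among those of the given
  one, so the two coincide, and nothing has to be proved about false literals.

  The cycle condition of a cactus enters only through the uniqueness of the non-tree edge across a
  cut, which makes each literal depend on a single variable.

  The machine offers neither recursion nor numbers beyond a polynomial in the size. Hence the tree
  comes with a queue in which parents precede children, bottom-up computations are backward sweeps
  over it, and all sums and positions stay quadratic. The 2-clauses are decided by propagation with
  an amortised bound instead of strongly connected components, so that every search is a flat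
  loop.\<close>

fun edges_of :: "'a list \<Rightarrow> 'a set set" where
  "edges_of (x # y # r) = insert {x, y} (edges_of (y # r))"
| "edges_of _ = {}"

lemma edges_of_conv: "edges_of Q = {path_edge Q i | i. Suc i < length Q}"
proof (induction Q rule: edges_of.induct)
  case (1 x y r)
  show ?case
  proof (intro set_eqI iffI)
    fix e assume "e \<in> edges_of (x # y # r)"
    then consider "e = {x, y}" | i where "e = path_edge (y # r) i" "Suc i < length (y # r)"
      using 1 by auto
    then show "e \<in> {path_edge (x # y # r) i | i. Suc i < length (x # y # r)}"
    proof cases
      case 1
      then have "e = path_edge (x # y # r) 0" by (simp add: path_edge_def)
      then show ?thesis by auto
    next
      case 2
      then have "e = path_edge (x # y # r) (Suc i)" by (simp add: path_edge_def)
      with 2 show ?thesis by auto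
    qed
  next
    fix e assume "e \<in> {path_edge (x # y # r) i | i. Suc i < length (x # y # r)}"
    then obtain i where i: "e = path_edge (x # y # r) i" "Suc i < length (x # y # r)" by blast
    show "e \<in> edges_of (x # y # r)"
    proof (cases i)
      case 0
      then show ?thesis using i by (simp add: path_edge_def)
    next
      case (Suc i')
      then have "e = path_edge (y # r) i'" "Suc i' < length (y # r)"
        using i by (auto simp: path_edge_def)
      then show ?thesis using 1 by auto
    qed
  qed
qed auto

lemma edges_of_subset: "e \<in> edges_of Q \<Longrightarrow> e \<subseteq> set Q"
  by (induction Q rule: edges_of.induct) auto

lemma finite_edges_of [simp]: "finite (edges_of Q)"
  by (induction Q rule: edges_of.induct) auto

definition crossing :: "'a set \<Rightarrow> 'a set \<Rightarrow> bool" where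
  "crossing S e \<longleftrightarrow> e \<inter> S \<noteq> {} \<and> \<not> e \<subseteq> S"

lemma crossing_pair: "crossing S {x, y} \<longleftrightarrow> (x \<in> S) \<noteq> (y \<in> S)"
  by (auto simp: crossing_def)

text \<open>Each edge of the path flips membership in \<open>S\<close> exactly when it crosses.
  Distinctness keeps the first edge out of the rest of the path, so counting edges as a set counts
  steps.\<close>

lemma odd_card_crossing:
  assumes "distinct Q" "Q \<noteq> []"
  shows "odd (card {e \<in> edges_of Q. crossing S e}) \<longleftrightarrow> (hd Q \<in> S) \<noteq> (last Q \<in> S)"
  using assms
proof (induction Q rule: edges_of.induct)
  case (1 x y r)
  have notin: "{x, y} \<notin> edges_of (y # r)"
    using edges_of_subset[of "{x, y}" "y # r"] 1(2) by auto
  let ?A = "{e \<in> edges_of (y # r). crossing S e}"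
  have fin: "finite ?A" by simp
  have IH: "odd (card ?A) \<longleftrightarrow> (y \<in> S) \<noteq> (last (y # r) \<in> S)"
    using 1 by simp
  show ?case
  proof (cases "crossing S {x, y}")
    case True
    then have "{e \<in> edges_of (x # y # r). crossing S e} = insert {x, y} ?A" by auto
    then have "card {e \<in> edges_of (x # y # r). crossing S e} = Suc (card ?A)"
      using notin fin by simp
    then show ?thesis using IH True by (auto simp: crossing_pair)
  next
    case False
    then have "{e \<in> edges_of (x # y # r). crossing S e} = ?A" by auto
    then show ?thesis using IH False by (auto simp: crossing_pair)
  qed
qed auto

text \<open>A simple path whose edges all lie on another simple path cannot turn back on it.\<close>

lemma simple_path_edges_subset_eq:
  assumes P: "distinct P" "P \<noteq> []" and Q: "distinct Q" "Q \<noteq> []"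
    and hd: "hd P = hd Q" and last: "last P = last Q"
    and sub: "edges_of P \<subseteq> edges_of Q"
  shows "P = Q"
proof -
  have step: "i < length P \<Longrightarrow> i < length Q \<and> P ! i = Q ! i" for i
  proof (induction i rule: less_induct)
    case (less i)
    show ?case
    proof (cases i)
      case 0
      then show ?thesis using P Q hd by (simp add: hd_conv_nth)
    next
      case (Suc j)
      have j: "j < length Q" "P ! j = Q ! j" using less Suc by auto
      have "path_edge P j \<in> edges_of Q"
        using sub less.prems Suc unfolding edges_of_conv[of P] by auto
      then obtain l where l: "path_edge P j = path_edge Q l" "Suc l < length Q"
        unfolding edges_of_conv by auto
      then have "{Q ! j, P ! i} = {Q ! l, Q ! Suc l}"
        using j Suc by (simp add: path_edge_def)
      then consider "Q ! j = Q ! l" "P ! i = Q ! Suc l" | "Q ! j = Q ! Suc l" "P ! i = Q ! l"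
        by (auto simp: doubleton_eq_iff)
      then show ?thesis
      proof cases
        case 1
        then have "j = l" using nth_eq_iff_index_eq[OF Q(1)] j l by auto
        then show ?thesis using 1 l Suc by simp
      next
        case 2
        \<comment> \<open>Taking the edge of \<open>Q\<close> backwards leads to
          \<open>Q ! l\<close>, which \<open>P\<close> has already visited as
          \<open>P ! l\<close>.\<close>
        then have jl: "j = Suc l" using nth_eq_iff_index_eq[OF Q(1)] j l by auto
        then have "P ! l = Q ! l" using less Suc by auto
        then have "P ! i = P ! l" using 2 by simp
        then have "i = l" using nth_eq_iff_index_eq[OF P(1)] less.prems jl Suc by auto
        then show ?thesis using jl Suc by simp
      qed
    qed
  qed
  have len: "length P \<le> length Q" using step[of "length P - 1"] P by (cases P) auto
  have "Q ! (length P - 1) = Q ! (length Q - 1)"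
    using step[of "length P - 1"] P Q last by (simp add: last_conv_nth)
  then have "length P - 1 = length Q - 1"
    using nth_eq_iff_index_eq[OF Q(1), of "length P - 1" "length Q - 1"] P Q len
      length_greater_0_conv[of P] length_greater_0_conv[of Q] by (auto simp del: length_greater_0_conv)
  then have "length P = length Q" using P Q by (cases P; cases Q) auto
  then show ?thesis using step by (simp add: nth_equalityI)
qed

text \<open>A step to a vertex that was already visited cuts the walk back to that visit; any other
  step is appended.\<close>

lemma simple_walk:
  assumes "(u, w) \<in> r\<^sup>*"
  shows "\<exists>p. p \<noteq> [] \<and> hd p = u \<and> last p = w \<and> distinct p \<and> successively (\<lambda>x y. (x, y) \<in> r) p"
  using assms
proof (induction rule: rtrancl_induct)
  case base
  show ?case by (rule exI[of _ "[u]"]) auto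
next
  case (step y z)
  then obtain p where p: "p \<noteq> []" "hd p = u" "last p = y" "distinct p"
    "successively (\<lambda>x y. (x, y) \<in> r) p" by blast
  show ?case
  proof (cases "z \<in> set p")
    case True
    then obtain p1 p2 where "p = p1 @ z # p2" by (meson split_list)
    then have "successively (\<lambda>x y. (x, y) \<in> r) (p1 @ [z])" "distinct (p1 @ [z])"
       "hd (p1 @ [z]) = u"
      using p by (auto simp: successively_append_iff hd_append)
    then show ?thesis by (intro exI[of _ "p1 @ [z]"]) auto
  next
    case False
    then show ?thesis using p step(2)
      by (intro exI[of _ "p @ [z]"]) (auto simp: successively_append_iff)
  qed
qed

section \<open>Rooted spanning trees of a cactus\<close>

text \<open>The instance with vertices and edges replaced by their indices in the input, which is
  all that a program sees. The two ends of an edge come in the arbitrary order of the input.\<close>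

locale indexed_cactus =
  fixes n m :: nat and eu ew :: "nat \<Rightarrow> nat"
  assumes ends_less: "k < m \<Longrightarrow> eu k < n \<and> ew k < n"
    and edge_inj: "inj_on (\<lambda>k. {eu k, ew k}) {..<m}"
    and is_cactus: "cactus ({..<n}, (\<lambda>k. {eu k, ew k}) ` {..<m})"
begin

abbreviation G :: "nat graph" where
  "G \<equiv> ({..<n}, (\<lambda>k. {eu k, ew k}) ` {..<m})"

lemma ends_neq: "k < m \<Longrightarrow> eu k \<noteq> ew k"
proof -
  assume "k < m"
  then have "{eu k, ew k} \<in> {{u, v} | u v. u \<in> {..<n} \<and> v \<in> {..<n} \<and> u \<noteq> v}"
    using is_cactus by (auto simp: cactus_def finite_simple_graph_def)
  then show ?thesis by (auto simp: doubleton_eq_iff)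
qed

lemma edge_eqD:
  assumes "k < m" "l < m" "{eu k, ew k} = {eu l, ew l}"
  shows "k = l"
  using edge_inj assms unfolding inj_on_def by blast

end

section \<open>Subtrees of a rooted spanning tree and the cuts below them\<close>

locale rooted_cactus = indexed_cactus +
  fixes s :: nat and R :: "nat set" and par dep :: "nat \<Rightarrow> nat"
  assumes s_R: "s \<in> R" and R_sub: "R \<subseteq> {..<n}"
    and R_closed: "k < m \<Longrightarrow> eu k \<in> R \<longleftrightarrow> ew k \<in> R"
    and par_s: "par s = s" and dep_s: "dep s = 0"
    and par_R: "v \<in> R \<Longrightarrow> v \<noteq> s \<Longrightarrow> par v \<in> R"
    and par_edge: "v \<in> R \<Longrightarrow> v \<noteq> s \<Longrightarrow> \<exists>k<m. {eu k, ew k} = {v, par v}"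
    and dep_par: "v \<in> R \<Longrightarrow> v \<noteq> s \<Longrightarrow> dep v = Suc (dep (par v))"
    and dep_less: "v \<in> R \<Longrightarrow> dep v < n"
begin

text \<open>Cut off at the root, where \<open>par s = s\<close>, and outside \<open>R\<close>, where
  \<open>par\<close> holds arbitrary values; hence \<open>sub v\<close> is \<open>{v}\<close> for
  unreached \<open>v\<close>.\<close>

definition T :: "(nat \<times> nat) set" where
  "T = {(v, par v) | v. v \<in> R \<and> v \<noteq> s}"

definition sub :: "nat \<Rightarrow> nat set" where
  "sub v = {u. (u, v) \<in> T\<^sup>*}"

lemma T_iff: "(u, v) \<in> T \<longleftrightarrow> u \<in> R \<and> u \<noteq> s \<and> v = par u"
  by (auto simp: T_def)

lemma single_valued_T: "single_valued T"
  by (auto simp: single_valued_def T_iff)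

lemma sub_refl [simp]: "v \<in> sub v" by (simp add: sub_def)

lemma sub_trans: "u \<in> sub v \<Longrightarrow> v \<in> sub w \<Longrightarrow> u \<in> sub w"
  by (auto simp: sub_def)

lemma sub_par: "v \<in> R \<Longrightarrow> v \<noteq> s \<Longrightarrow> v \<in> sub (par v)"
  by (auto simp: sub_def T_iff)

lemma in_sub_step: "u \<in> R \<Longrightarrow> u \<noteq> s \<Longrightarrow> par u \<in> sub v \<Longrightarrow> u \<in> sub v"
  using sub_par sub_trans by blast

lemma in_sub_par:
  assumes "u \<in> sub v" "u \<noteq> v"
  shows "par u \<in> sub v \<and> u \<in> R \<and> u \<noteq> s"
proof -
  from assms(1) have "(u, v) \<in> T\<^sup>*" by (simp add: sub_def)
  then obtain z where z: "(u, z) \<in> T" "(z, v) \<in> T\<^sup>*"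
    by (cases rule: converse_rtranclE) (use assms(2) in auto)
  have "z = par u" "u \<in> R" "u \<noteq> s" using z(1) by (auto simp only: T_iff)
  then show ?thesis using z(2) by (auto simp only: sub_def)
qed

lemma sub_child:
  assumes "u \<in> sub v" "u \<noteq> v"
  obtains c where "c \<in> R" "c \<noteq> s" "par c = v" "u \<in> sub c"
proof -
  from assms(1) have "(u, v) \<in> T\<^sup>*" by (simp add: sub_def)
  then show thesis
    by (rule rtranclE) (use assms(2) that in \<open>auto simp: T_iff sub_def\<close>)
qed

lemma sub_R: "u \<in> sub v \<Longrightarrow> v \<in> R \<Longrightarrow> u \<in> R"
  using in_sub_par by (cases "u = v") auto

lemma sub_unreached: "v \<notin> R \<Longrightarrow> sub v = {v}"
proof -
  assume v: "v \<notin> R"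
  have "u = v" if "u \<in> sub v" for u
  proof (rule ccontr)
    assume "u \<noteq> v"
    show False
      by (rule sub_child[OF that \<open>u \<noteq> v\<close>]) (use par_R v in blast)
  qed
  then show ?thesis by auto
qed

lemma sub_R': "u \<in> R \<Longrightarrow> u \<in> sub v \<Longrightarrow> v \<in> R"
  by (cases "v \<in> R") (auto simp: sub_unreached)

lemma sub_dep: "u \<in> sub v \<Longrightarrow> u = v \<or> dep v < dep u"
proof -
  assume "u \<in> sub v"
  then have "(u, v) \<in> T\<^sup>*" by (simp add: sub_def)
  then show ?thesis
  proof (induction rule: converse_rtrancl_induct)
    case (step y z)
    then show ?case using dep_par[of y] by (auto simp: T_iff)
  qed auto
qed

text \<open>\<open>T\<close> is functional, so the ancestors of a vertex form a chain.\<close>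

lemma sub_comparable:
  assumes "u \<in> sub v" "u \<in> sub w"
  shows "v \<in> sub w \<or> w \<in> sub v"
proof -
  have "(u, v) \<in> T\<^sup>*" "(u, w) \<in> T\<^sup>*" using assms by (simp_all add: sub_def)
  then have "(v, w) \<in> T\<^sup>* \<or> (w, v) \<in> T\<^sup>*"
    by (rule single_valued_confluent[OF single_valued_T])
  then show ?thesis by (simp add: sub_def)
qed

lemma par_neq: "v \<in> R \<Longrightarrow> v \<noteq> s \<Longrightarrow> par v \<noteq> v"
  using dep_par[of v] by auto

lemma par_notin_sub: "v \<in> R \<Longrightarrow> v \<noteq> s \<Longrightarrow> par v \<notin> sub v"
  using sub_dep[of "par v" v] dep_par[of v] par_neq[of v] by auto

lemma sub_s: "v \<in> R \<Longrightarrow> v \<in> sub s"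
proof (induction "dep v" arbitrary: v rule: less_induct)
  case less
  show ?case
  proof (cases "v = s")
    case False
    then have "par v \<in> sub s" using less dep_par par_R by force
    then show ?thesis using False less in_sub_step by blast
  qed auto
qed

lemma s_notin_sub: "v \<noteq> s \<Longrightarrow> s \<notin> sub v"
  using in_sub_par by blast

lemma siblings_disjoint:
  assumes "c \<in> R" "c \<noteq> s" "d \<in> R" "d \<noteq> s" "par c = par d" "u \<in> sub c" "u \<in> sub d"
  shows "c = d"
proof -
  have "dep c = dep d" using assms dep_par by simp
  then show ?thesis using sub_comparable[OF assms(6,7)] sub_dep by force
qed

text \<open>Tested on parents alone, since the search stores no edge numbers; in a simple graph the
  ends determine the edge. Outside \<open>R\<close> the test can succeed by accident.\<close>

definition tree_edge :: "nat \<Rightarrow> bool" where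
  "tree_edge k \<longleftrightarrow> par (eu k) = ew k \<or> par (ew k) = eu k"

text \<open>If the child end lies in \<open>sub v\<close> and the parent end does not, the child end
  must be \<open>v\<close>. The opposite crossing is impossible because \<open>sub v\<close> is
  closed under children.\<close>

lemma crossing_tree_edge:
  assumes v: "v \<in> R" "v \<noteq> s" and k: "k < m" "tree_edge k" and c: "crossing (sub v) {eu k, ew k}"
  shows "{eu k, ew k} = {v, par v}"
proof -
  have aux: "{x, y} = {v, par v}" if "par x = y" "x \<in> R" "x \<noteq> y" "crossing (sub v) {x, y}" for x y
  proof -
    have "x \<noteq> s" using that par_s by auto
    then have "x \<in> sub v" using that in_sub_step by (auto simp: crossing_pair)
    moreover have "y \<notin> sub v" using that calculation by (auto simp: crossing_pair)
    ultimately have "x = v" using in_sub_par that by blast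
    then show ?thesis using that by simp
  qed
  have "eu k \<in> sub v \<or> ew k \<in> sub v" using c by (auto simp: crossing_pair)
  then have "eu k \<in> R" "ew k \<in> R" using R_closed[OF k(1)] sub_R v by auto
  then show ?thesis
    using aux[of "eu k" "ew k"] aux[of "ew k" "eu k"] k ends_neq[OF k(1)] c
    by (auto simp: tree_edge_def insert_commute)
qed

section \<open>Fundamental cycles\<close>

definition tree_rel :: "(nat \<times> nat) set" where
  "tree_rel = T \<union> T\<inverse>"

lemma tree_rel_connected: "u \<in> R \<Longrightarrow> w \<in> R \<Longrightarrow> (u, w) \<in> tree_rel\<^sup>*"
proof -
  have *: "(u, s) \<in> tree_rel\<^sup>*" if "u \<in> R" for u
    using sub_s[OF that] rtrancl_mono[of T tree_rel] by (auto simp: sub_def tree_rel_def)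
  have "sym tree_rel" by (auto simp: sym_def tree_rel_def)
  then have "sym (tree_rel\<^sup>*)" by (rule sym_rtrancl)
  moreover assume "u \<in> R" "w \<in> R"
  ultimately show ?thesis using * by (meson rtrancl_trans symD)
qed

text \<open>The cycle is the simple tree path between the ends of edge \<open>k\<close>, closed by
  \<open>k\<close> itself. The tree path starts on one side of the cut and ends on the other, so it
  runs over the tree edge at \<open>v\<close>, the only tree edge across.\<close>

lemma fundamental_cycle:
  assumes v: "v \<in> R" "v \<noteq> s" and k: "k < m" "\<not> tree_edge k" and c: "crossing (sub v) {eu k, ew k}"
  shows "\<exists>C. is_cycle G C \<and> {v, par v} \<in> C \<and> {eu k, ew k} \<in> C \<and>
    (\<forall>l<m. {eu l, ew l} \<in> C \<longrightarrow> l = k \<or> tree_edge l)"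
proof -
  define u w where "u = eu k" and "w = ew k"
  have uwR: "u \<in> R" "w \<in> R" using c R_closed[OF k(1)] sub_R v by (auto simp: crossing_pair u_def w_def)
  obtain p where p: "p \<noteq> []" "hd p = u" "last p = w" "distinct p"
    "successively (\<lambda>x y. (x, y) \<in> tree_rel) p"
    using simple_walk[OF tree_rel_connected[OF uwR]] by blast
  have step: "(p ! i, p ! Suc i) \<in> tree_rel" if "Suc i < length p" for i
    using p(5) that by (auto simp: successively_conv_nth)
  have ends: "p ! 0 = u" "p ! (length p - 1) = w"
    using p by (auto simp: hd_conv_nth last_conv_nth)
  have uw: "u \<noteq> w" using ends_neq[OF k(1)] by (simp add: u_def w_def)
  have notT: "(u, w) \<notin> tree_rel"
    using k by (auto simp: tree_rel_def T_iff tree_edge_def u_def w_def)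
  \<comment> \<open>One vertex would make \<open>k\<close> a loop, two would make it a tree
    edge.\<close>
  have len: "3 \<le> length p"
  proof (rule ccontr)
    assume "\<not> 3 \<le> length p"
    then consider "length p = 1" | "length p = 2" using p(1) length_greater_0_conv[of p] by linarith
    then show False using ends uw step[of 0] notT by cases auto
  qed
  define C where "C = {{p ! i, p ! (Suc i mod length p)} | i. i < length p}"
  have closing: "{p ! i, p ! (Suc i mod length p)} = {eu k, ew k}" if "i < length p" "Suc i = length p" for i
  proof -
    have "i = length p - 1" using that by simp
    then show ?thesis using that ends unfolding u_def w_def by (simp add: insert_commute)
  qed
  have Cdest: "e = {eu k, ew k} \<or> (\<exists>x y. (x, y) \<in> tree_rel \<and> e = {x, y})" if "e \<in> C" for e
  proof -
    obtain i where i: "i < length p" "e = {p ! i, p ! (Suc i mod length p)}"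
      using \<open>e \<in> C\<close> by (auto simp: C_def)
    show ?thesis
    proof (cases "Suc i < length p")
      case True
      then show ?thesis using i step[OF True] by auto
    next
      case False
      then show ?thesis using i closing[of i] by auto
    qed
  qed
  have inC: "{p ! i, p ! Suc i} \<in> C" if "Suc i < length p" for i
    unfolding C_def using that by (auto intro!: exI[of _ i])
  have tree_relR: "x \<in> R \<and> y \<in> R" if "(x, y) \<in> tree_rel" for x y
    using that par_R by (auto simp: tree_rel_def T_iff)
  have setp: "set p \<subseteq> R"
  proof
    fix x assume "x \<in> set p"
    then obtain i where i: "i < length p" "x = p ! i" by (auto simp: in_set_conv_nth)
    show "x \<in> R"
    proof (cases "Suc i < length p")
      case True
      then show ?thesis using step tree_relR i by blast
    next
      case False
      then have "i = length p - 1" using i by auto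
      then show ?thesis using i ends uwR by simp
    qed
  qed
  have tree_rel_edge: "{x, y} \<in> snd G" if "(x, y) \<in> tree_rel" for x y
  proof -
    have "{z, par z} \<in> (\<lambda>k. {eu k, ew k}) ` {..<m}" if z: "z \<in> R" "z \<noteq> s" for z
      using par_edge[OF z] by (metis (no_types, lifting) image_eqI lessThan_iff)
    then show ?thesis using that by (auto simp: tree_rel_def T_iff insert_commute)
  qed
  have "C \<subseteq> snd G"
  proof
    fix e assume "e \<in> C"
    from Cdest[OF this] show "e \<in> snd G" using tree_rel_edge k(1) by auto
  qed
  then have "is_cycle G C"
    unfolding is_cycle_def using len p(4) setp R_sub C_def by (intro exI[of _ p]) auto
  moreover have "{eu k, ew k} \<in> C"
  proof -
    have "length p - 1 < length p" "Suc (length p - 1) = length p" using len by auto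
    from closing[OF this] this show ?thesis unfolding C_def by blast
  qed
  moreover have "{v, par v} \<in> C"
  proof -
    have "(u \<in> sub v) \<noteq> (w \<in> sub v)" using c by (simp add: crossing_pair u_def w_def)
    moreover have "\<exists>i. Suc i < length p \<and> (p ! i \<in> sub v) \<noteq> (p ! Suc i \<in> sub v)"
    proof (rule ccontr)
      assume "\<not> ?thesis"
      then have same: "Suc i < length p \<Longrightarrow> (p ! i \<in> sub v) = (p ! Suc i \<in> sub v)" for i by blast
      have "i < length p \<Longrightarrow> (p ! i \<in> sub v) = (p ! 0 \<in> sub v)" for i
        by (induction i) (use same in auto)
      from this[of "length p - 1"] p(1) show False
        using ends len \<open>(u \<in> sub v) \<noteq> (w \<in> sub v)\<close> by auto
    qed
    then obtain i where i: "Suc i < length p" "(p ! i \<in> sub v) \<noteq> (p ! Suc i \<in> sub v)" by blast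
    have *: "{x, y} = {v, par v}" if "(x, y) \<in> T" "(x \<in> sub v) \<noteq> (y \<in> sub v)" for x y
      using that in_sub_step[of x v] in_sub_par[of x v] by (cases "x = v") (auto simp: T_iff)
    have "{p ! i, p ! Suc i} = {v, par v}"
      using step[OF i(1)] i(2) *[of "p ! i" "p ! Suc i"] *[of "p ! Suc i" "p ! i"]
      unfolding tree_rel_def by (auto simp: insert_commute)
    then show ?thesis using inC[OF i(1)] by simp
  qed
  moreover have "l = k \<or> tree_edge l" if l: "l < m" "{eu l, ew l} \<in> C" for l
    using Cdest[OF l(2)]
  proof
    assume "{eu l, ew l} = {eu k, ew k}"
    then show ?thesis using edge_eqD[OF l(1) k(1)] by simp
  next
    assume "\<exists>x y. (x, y) \<in> tree_rel \<and> {eu l, ew l} = {x, y}"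
    then show ?thesis by (auto simp: tree_rel_def T_iff tree_edge_def doubleton_eq_iff)
  qed
  ultimately show ?thesis by blast
qed

text \<open>The fundamental cycles of both edges contain the tree edge at \<open>v\<close>. In a
  cactus they are then equal, and a fundamental cycle contains a single non-tree edge.\<close>

lemma crossing_nontree_unique:
  assumes v: "v \<in> R" "v \<noteq> s"
    and k: "k < m" "\<not> tree_edge k" "crossing (sub v) {eu k, ew k}"
    and l: "l < m" "\<not> tree_edge l" "crossing (sub v) {eu l, ew l}"
  shows "k = l"
proof -
  obtain C where C: "is_cycle G C" "{v, par v} \<in> C" "\<forall>l<m. {eu l, ew l} \<in> C \<longrightarrow> l = k \<or> tree_edge l"
    using fundamental_cycle[OF v k] by blast
  obtain D where D: "is_cycle G D" "{v, par v} \<in> D" "{eu l, ew l} \<in> D"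
    using fundamental_cycle[OF v l] by blast
  have "{v, par v} \<in> snd G" using C(1,2) by (auto simp: is_cycle_def)
  then have "C = D" using is_cactus C D unfolding cactus_def by blast
  then show ?thesis using C(3) D(3) l by blast
qed

end

section \<open>Paths of a cactus as solutions of 2-clauses\<close>

text \<open>The variable \<open>m\<close> is true under every assignment and supplies the two
  constant literals, so vertices and edges whose status is fixed need no clauses of a special form.
  Literals are plain numbers because the program stores them in arrays.\<close>

definition lval :: "nat \<Rightarrow> (nat \<Rightarrow> bool) \<Rightarrow> nat \<Rightarrow> bool" where
  "lval m x l \<longleftrightarrow> (if l \<le> m then l = m \<or> x l else \<not> (l - Suc m = m \<or> x (l - Suc m)))"

lemma lval_simps [simp]:
  "lval m x m" "\<not> lval m x (Suc (m + m))" "k < m \<Longrightarrow> lval m x k \<longleftrightarrow> x k"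
  "k < m \<Longrightarrow> lval m x (Suc (m + k)) \<longleftrightarrow> \<not> x k"
  by (auto simp: lval_def)

text \<open>\<open>t \<in> sub v\<close> says that \<open>v\<close> is on the tree path from
  \<open>s\<close> to \<open>t\<close>. Thus \<open>base\<close> steps up by \<open>2 * n\<close> at
  each vertex of that path after \<open>s\<close> and is inherited unchanged by the branches hanging
  from it.\<close>

locale target_cactus = rooted_cactus +
  fixes t :: nat and base :: "nat \<Rightarrow> nat"
  assumes t_R: "t \<in> R" and base_s: "base s = 0"
    and base_par: "v \<in> R \<Longrightarrow> v \<noteq> s \<Longrightarrow> base v = base (par v) + (if t \<in> sub v then 2 * n else 0)"
    and base_unreached: "v \<notin> R \<Longrightarrow> base v = 0"
begin

section \<open>Bases along the tree\<close>

lemma marked_R: "t \<in> sub v \<Longrightarrow> v \<in> R"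
  using sub_R'[OF t_R] .

lemma n_pos: "0 < n" using s_R R_sub by auto

lemma base_sub_mono: "u \<in> sub v \<Longrightarrow> base v \<le> base u"
proof -
  assume "u \<in> sub v"
  then have "(u, v) \<in> T\<^sup>*" by (simp add: sub_def)
  then show ?thesis
  proof (induction rule: converse_rtrancl_induct)
    case (step y z)
    then show ?case using base_par[of y] by (auto simp: T_iff)
  qed auto
qed

lemma base_sub_unmarked: "u \<in> sub v \<Longrightarrow> t \<notin> sub v \<Longrightarrow> base u = base v"
proof -
  assume "u \<in> sub v" and unm: "t \<notin> sub v"
  then have "(u, v) \<in> T\<^sup>*" by (simp add: sub_def)
  then show ?thesis
  proof (induction rule: converse_rtrancl_induct)
    case (step y z)
    have "y \<in> sub v" using step.hyps by (auto simp: sub_def)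
    then have "t \<notin> sub y" using unm sub_trans by blast
    then show ?case using step base_par[of y] by (auto simp: T_iff)
  qed auto
qed

lemma base_dvd: "2 * n dvd base v"
proof (cases "v \<in> R")
  case True
  then show ?thesis
  proof (induction "dep v" arbitrary: v rule: less_induct)
    case less
    show ?case
    proof (cases "v = s")
      case False
      then have "2 * n dvd base (par v)" using less dep_par[of v] par_R by simp
      then show ?thesis using base_par[of v] less False by simp
    qed (simp add: base_s)
  qed
qed (simp add: base_unreached)

text \<open>Bases are multiples of \<open>2 * n\<close>, so distinct ones leave room for two depths
  below \<open>n\<close>: one added to the lower base, one subtracted from the higher.\<close>

lemma base_gap: "base u < base v \<Longrightarrow> base u + 2 * n \<le> base v"
proof -
  assume "base u < base v"
  moreover obtain a b where "base u = 2 * n * a" "base v = 2 * n * b"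
    using base_dvd by (meson dvdE)
  ultimately have "a < b" using n_pos by (metis mult_less_mono2 not_less_iff_gr_or_eq order_less_imp_le order.asym linorder_neqE_nat mult_le_mono2 not_le)
  then have "2 * n * Suc a \<le> 2 * n * b" by (intro mult_le_mono2) simp
  then show ?thesis using \<open>base u = 2 * n * a\<close> \<open>base v = 2 * n * b\<close> by simp
qed

text \<open>Climb from \<open>u\<close> to the root. A vertex off the tree path has the base of its
  parent, which is also outside \<open>sub v\<close>; a vertex on the tree path lies strictly above
  \<open>v\<close>, so its base is at most that of \<open>par v\<close>.\<close>

lemma base_outside_marked:
  assumes v: "v \<noteq> s" "t \<in> sub v" and u: "u \<in> R" "u \<notin> sub v"
  shows "base u < base v"
  using u
proof (induction "dep u" arbitrary: u rule: less_induct)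
  case less
  have vR: "v \<in> R" using v marked_R by simp
  have pos: "base (par v) < base v" using base_par[OF vR v(1)] v n_pos by simp
  show ?case
  proof (cases "u = s")
    case True
    then show ?thesis using pos by (simp add: base_s)
  next
    case False
    show ?thesis
    proof (cases "t \<in> sub u")
      case True
      then have "v \<in> sub u" using sub_comparable[of t v u] v less.prems by blast
      then have "par v \<in> sub u" using in_sub_par[of v u] less.prems by auto
      then show ?thesis using base_sub_mono pos by fastforce
    next
      case False': False
      have "par u \<notin> sub v" using in_sub_step[of u v] less.prems False by blast
      moreover have "par u \<in> R" "dep (par u) < dep u" using less.prems False par_R dep_par by auto
      ultimately have "base (par u) < base v" using less by blast
      then show ?thesis using base_par[of u] less.prems False False' by simp
    qed
  qed
qed

text \<open>Within \<open>R\<close>, unequal bases mean that the fundamental cycle of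
  \<open>k\<close> shares an edge with the tree path from \<open>s\<close> to \<open>t\<close>.
  Non-tree edges on other cycles lie on no simple path from \<open>s\<close> to \<open>t\<close>.
  Unreached edges drop out since both bases are 0.\<close>

definition rel :: "nat \<Rightarrow> bool" where
  "rel k \<longleftrightarrow> k < m \<and> \<not> tree_edge k \<and> base (eu k) \<noteq> base (ew k)"

text \<open>The bases orient a relevant edge in the only direction in which a simple path from
  \<open>s\<close> to \<open>t\<close> can use it.\<close>

definition tail :: "nat \<Rightarrow> nat" where
  "tail k = (if base (eu k) < base (ew k) then eu k else ew k)"

definition head :: "nat \<Rightarrow> nat" where
  "head k = (if base (eu k) < base (ew k) then ew k else eu k)"

lemma edge_tail_head: "{eu k, ew k} = {tail k, head k}"
  by (auto simp: tail_def head_def)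

lemma base_tail_head: "rel k \<Longrightarrow> base (tail k) < base (head k)"
  by (auto simp: rel_def tail_def head_def)

lemma tail_head_R: "rel k \<Longrightarrow> tail k \<in> R \<and> head k \<in> R"
  using base_unreached R_closed[of k] by (auto simp: rel_def tail_def head_def)

text \<open>Two sums over naturals stand in for one signed sum. The shift \<open>Suc k\<close> keeps
  edge 0 apart from the absence of an edge.\<close>

definition PW :: "nat \<Rightarrow> nat" where
  "PW v = (\<Sum>k | rel k \<and> tail k \<in> sub v. Suc k)"

definition MW :: "nat \<Rightarrow> nat" where
  "MW v = (\<Sum>k | rel k \<and> head k \<in> sub v. Suc k)"

lemma finite_rel: "finite {k. rel k \<and> P k}"
  by (rule finite_subset[of _ "{..<m}"]) (auto simp: rel_def)

text \<open>The root needs no premise: no relevant edge crosses at \<open>v = s\<close>, as both its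
  ends are reached and so lie in \<open>sub s\<close>.\<close>

lemma rel_crossing_unique:
  assumes v: "v \<in> R" and k: "rel k" "(tail k \<in> sub v) \<noteq> (head k \<in> sub v)"
    and l: "rel l" "(tail l \<in> sub v) \<noteq> (head l \<in> sub v)"
  shows "k = l"
proof -
  have "v \<noteq> s" using k sub_s tail_head_R by auto
  then show ?thesis
    using crossing_nontree_unique[OF v, of k l] k l
    by (simp add: rel_def edge_tail_head crossing_pair)
qed

lemma PW_out:
  assumes v: "v \<in> R" and k: "rel k" "tail k \<in> sub v" "head k \<notin> sub v"
  shows "PW v = MW v + Suc k"
proof -
  have "{k. rel k \<and> tail k \<in> sub v} = insert k {k. rel k \<and> head k \<in> sub v}"
  proof -
    have "l = k" if "rel l" "(tail l \<in> sub v) \<noteq> (head l \<in> sub v)" for l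
      using rel_crossing_unique[OF v that k(1)] k(2,3) by simp
    then show ?thesis using k by blast
  qed
  then show ?thesis using k finite_rel by (simp add: PW_def MW_def)
qed

lemma MW_in:
  assumes v: "v \<in> R" and k: "rel k" "tail k \<notin> sub v" "head k \<in> sub v"
  shows "MW v = PW v + Suc k"
proof -
  have "{k. rel k \<and> head k \<in> sub v} = insert k {k. rel k \<and> tail k \<in> sub v}"
  proof -
    have "l = k" if "rel l" "(tail l \<in> sub v) \<noteq> (head l \<in> sub v)" for l
      using rel_crossing_unique[OF v that k(1)] k(2,3) by simp
    then show ?thesis using k by blast
  qed
  then show ?thesis using k finite_rel by (simp add: PW_def MW_def)
qed

lemma PW_eq_MW:
  assumes "\<And>k. rel k \<Longrightarrow> tail k \<in> sub v \<longleftrightarrow> head k \<in> sub v"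
  shows "PW v = MW v"
  unfolding PW_def MW_def by (rule sum.cong) (use assms in blast)+

text \<open>The sign of the difference gives the direction of the crossing edge. The three cases are
  told apart by the sums alone, so the program can branch on them.\<close>

lemma weight_cases:
  assumes "v \<in> R"
  obtains (none) "PW v = MW v" "\<And>k. rel k \<Longrightarrow> tail k \<in> sub v \<longleftrightarrow> head k \<in> sub v"
  | (out) k where "rel k" "tail k \<in> sub v" "head k \<notin> sub v" "PW v = MW v + Suc k"
  | (into) k where "rel k" "tail k \<notin> sub v" "head k \<in> sub v" "MW v = PW v + Suc k"
proof (cases "\<exists>k. rel k \<and> (tail k \<in> sub v) \<noteq> (head k \<in> sub v)")
  case True
  then show thesis using PW_out[OF assms] MW_in[OF assms] out into by blast
next
  case False
  then have "rel k \<Longrightarrow> tail k \<in> sub v \<longleftrightarrow> head k \<in> sub v" for k by blast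
  then show thesis using PW_eq_MW none by blast
qed

lemma PW_unreached: "v \<notin> R \<Longrightarrow> PW v = MW v"
  by (rule PW_eq_MW) (use sub_unreached tail_head_R in auto)

text \<open>Variable \<open>k < m\<close> says that the path uses the non-tree edge \<open>k\<close>; variable \<open>m\<close> is true,
  and \<open>Suc m + l\<close> is the negation of \<open>l\<close>.\<close>

definition vlit :: "nat \<Rightarrow> nat" where
  "vlit v =
    (if t \<in> sub v then
       (if MW v = PW v \<or> base (head (MW v - PW v - 1)) = base v then m
        else Suc m + (MW v - PW v - 1))
     else if MW v = PW v then Suc m + m
     else if PW v < MW v then MW v - PW v - 1 else PW v - MW v - 1)"

text \<open>The base of \<open>v\<close> is \<open>2 * n\<close> times the index of the tree path vertex from which \<open>v\<close> hangs; the gaps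
  leave room for depths. A path runs down the tree to the tail of a non-tree edge and climbs up from
  its head, so positions decrease with the depth below a head.\<close>

definition vpos :: "nat \<Rightarrow> nat" where
  "vpos v = (if t \<notin> sub v \<and> PW v < MW v then base v - dep v else base v + dep v)"

text \<open>The literal of the tree edge from \<open>v\<close> to its parent. On the tree path it
  can differ from \<open>vlit v\<close>, because a non-tree edge may replace this edge and still
  lead back to \<open>v\<close>. Off the tree path the edge is used exactly when \<open>v\<close> is
  visited.\<close>

definition tlit :: "nat \<Rightarrow> nat" where
  "tlit v = (if t \<in> sub v then (if MW v = PW v then m else Suc m + (MW v - PW v - 1)) else vlit v)"

text \<open>Written with the tests that the program performs, in the same order. A non-tree edge
  whose ends have equal bases gets the false constant.\<close>

definition elit :: "nat \<Rightarrow> nat" where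
  "elit k =
    (if par (eu k) = ew k then tlit (eu k) else if par (ew k) = eu k then tlit (ew k)
     else if base (eu k) \<noteq> base (ew k) then k else Suc m + m)"

text \<open>Positions increase along the path, so the smaller one belongs to the end from which the
  edge is entered; \<open>vpos v \<le> epos k\<close> then says that \<open>v\<close> is visited no
  later than that end.\<close>

definition epos :: "nat \<Rightarrow> nat" where
  "epos k = min (vpos (eu k)) (vpos (ew k))"

section \<open>Values of the literals\<close>

lemma rel_less: "rel k \<Longrightarrow> k < m" by (simp add: rel_def)

text \<open>Every reached vertex outside \<open>sub v\<close> has a smaller base than all of
  \<open>sub v\<close>, whereas bases rise from tail to head.\<close>

lemma marked_not_out:
  assumes "rel k" "tail k \<in> sub v" "head k \<notin> sub v"
  shows "t \<notin> sub v"
proof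
  assume t: "t \<in> sub v"
  have "v \<noteq> s" using assms sub_s tail_head_R by auto
  then have "base (head k) < base v" using base_outside_marked t assms tail_head_R by blast
  also have "base v \<le> base (tail k)" using base_sub_mono assms by blast
  finally show False using base_tail_head[OF assms(1)] by simp
qed

lemma vlit_out:
  assumes "rel k" "tail k \<in> sub v" "head k \<notin> sub v"
  shows "vlit v = k" "tlit v = k" "vpos v = base v + dep v"
  using PW_out[OF _ assms] marked_not_out[OF assms] sub_R'[of "tail k" v] tail_head_R[OF assms(1)] assms
  by (auto simp: vlit_def tlit_def vpos_def)

text \<open>Here \<open>v\<close> lies on the branch that is climbed from the head, so it is visited
  exactly when \<open>k\<close> is used.\<close>

lemma vlit_in_unmarked:
  assumes "rel k" "tail k \<notin> sub v" "head k \<in> sub v" "t \<notin> sub v"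
  shows "vlit v = k" "tlit v = k" "vpos v = base v - dep v"
  using MW_in[OF _ assms(1-3)] sub_R'[of "head k" v] tail_head_R[OF assms(1)] assms
  by (auto simp: vlit_def tlit_def vpos_def)

text \<open>A used edge \<open>k\<close> bypasses the tree edge at \<open>v\<close>. The vertex
  \<open>v\<close> itself is kept if the head hangs from it, since the climb from the head then ends
  at \<open>v\<close>; otherwise \<open>v\<close> is bypassed too.\<close>

lemma vlit_in_marked:
  assumes "rel k" "tail k \<notin> sub v" "head k \<in> sub v" "t \<in> sub v"
  shows "vlit v = (if base (head k) = base v then m else Suc m + k)" "tlit v = Suc m + k"
  using MW_in[OF _ assms(1-3)] sub_R'[of "head k" v] tail_head_R[OF assms(1)] assms
  by (auto simp: vlit_def tlit_def)

lemma vpos_marked: "t \<in> sub v \<Longrightarrow> vpos v = base v + dep v"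
  by (simp add: vpos_def)

lemma elit_tree:
  assumes k: "k < m" and v: "v \<in> R" "v \<noteq> s" and e: "{eu k, ew k} = {v, par v}"
  shows "elit k = tlit v"
proof -
  consider "eu k = v" "ew k = par v" | "eu k = par v" "ew k = v"
    using e by (auto simp: doubleton_eq_iff)
  then show ?thesis
  proof cases
    case 2
    \<comment> \<open>Depths exclude that the two ends are parents of each other, so the first test
      of \<open>elit\<close> cannot fire in the wrong direction.\<close>
    have "par (par v) \<noteq> v"
      using par_notin_sub[OF v] in_sub_par[of "par v" v] dep_par[OF v] dep_par[of "par v"] par_R[OF v] par_s
      by (cases "par v = s") auto
    then show ?thesis using 2 by (simp add: elit_def)
  qed (simp add: elit_def)
qed

lemma elit_rel: "rel k \<Longrightarrow> elit k = k"
  by (auto simp: rel_def elit_def tree_edge_def)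

section \<open>A path from an arbitrary assignment\<close>

lemma tail_notin_sub_head: "rel k \<Longrightarrow> tail k \<notin> sub v" if "base v = base (head k)"
  using base_tail_head[of k] base_sub_mono[of "tail k" v] that by auto

text \<open>The climb from the head of a used edge runs up to the tree path vertex of the same base;
  all vertices on it, including the last one, are true.\<close>

lemma active_above_head:
  assumes "rel k" "x k" "head k \<in> sub p" "base p = base (head k)"
  shows "lval m x (vlit p)"
proof (cases "t \<in> sub p")
  case True
  then show ?thesis using vlit_in_marked(1)[OF assms(1) tail_notin_sub_head[OF assms(4,1)] assms(3)] assms
    by simp
next
  case False
  then show ?thesis using vlit_in_unmarked(1)[OF assms(1) tail_notin_sub_head[OF assms(4,1)] assms(3)] assms
    rel_less[OF assms(1)] by simp
qed

text \<open>One step of the constructed path. The strict increase of \<open>vpos\<close> gives both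
  the termination of the construction and the simplicity of the result.\<close>

definition fwd :: "(nat \<Rightarrow> bool) \<Rightarrow> nat \<Rightarrow> nat \<Rightarrow> bool" where
  "fwd x v w \<longleftrightarrow> w \<in> R \<and> (\<exists>k<m. {eu k, ew k} = {v, w} \<and> lval m x (elit k)) \<and>
     lval m x (vlit w) \<and> vpos v < vpos w"

lemma fwd_rel:
  assumes k: "rel k" "x k" and tp: "vpos (tail k) = base (tail k) + dep (tail k)"
  shows "fwd x (tail k) (head k)"
proof -
  have R: "tail k \<in> R" "head k \<in> R" using tail_head_R[OF k(1)] by auto
  \<comment> \<open>This bound covers both forms of \<open>vpos\<close>, with the depth added or
    subtracted; the gap of \<open>2 * n\<close> between the bases absorbs the two depths.\<close>
  have "vpos (head k) \<ge> base (head k) - dep (head k)" unfolding vpos_def by (auto split: if_splits)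
  then have "vpos (tail k) < vpos (head k)"
    using tp dep_less[OF R(1)] dep_less[OF R(2)] base_gap[OF base_tail_head[OF k(1)]] by simp
  then show ?thesis
    unfolding fwd_def using R k elit_rel[OF k(1)] rel_less[OF k(1)] edge_tail_head[of k]
      active_above_head[of k x "head k"] by (auto intro!: exI[of _ k])
qed

text \<open>The descent towards the tail of a used edge stays within one base, so the growing depth
  is what raises the position.\<close>

lemma fwd_child:
  assumes c: "c \<in> R" "c \<noteq> s" "tail k \<in> sub c" "head k \<notin> sub c" and k: "rel k" "x k"
    and pos: "vpos (par c) = base (par c) + dep (par c)"
  shows "fwd x (par c) c"
proof -
  obtain l where l: "l < m" "{eu l, ew l} = {c, par c}" using par_edge[OF c(1,2)] by blast
  have "t \<notin> sub c" using marked_not_out[OF k(1)] c by blast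
  then have "base c = base (par c)" using base_par[OF c(1,2)] by simp
  then have "vpos (par c) < vpos c" using pos vlit_out(3)[OF k(1) c(3,4)] dep_par[OF c(1,2)] by simp
  then show ?thesis
    unfolding fwd_def using l elit_tree[OF l(1) c(1,2) l(2)] vlit_out[OF k(1) c(3,4)] k c
      rel_less[OF k(1)] by (auto simp: insert_commute intro!: exI[of _ l])
qed

lemma fwd_marked:
  assumes c: "c \<in> R" "c \<noteq> s" "t \<in> sub c" and act: "lval m x (tlit c)"
  shows "fwd x (par c) c"
proof -
  obtain l where l: "l < m" "{eu l, ew l} = {c, par c}" using par_edge[OF c(1,2)] by blast
  have "t \<in> sub (par c)" using c sub_par sub_trans by blast
  then have "vpos (par c) < vpos c"
    using c n_pos base_par[OF c(1,2)] dep_par[OF c(1,2)] by (simp add: vpos_marked)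
  moreover have "lval m x (vlit c)" using act c(3) by (auto simp: vlit_def tlit_def)
  ultimately show ?thesis
    unfolding fwd_def using l elit_tree[OF l(1) c(1,2) l(2)] c act
      by (auto simp: insert_commute intro!: exI[of _ l])
qed

lemma fwd_up:
  assumes k: "rel k" "x k" and v: "tail k \<notin> sub v" "head k \<in> sub v" "t \<notin> sub v"
  shows "fwd x v (par v)"
proof -
  have vR: "v \<in> R" "v \<noteq> s" using v sub_R' tail_head_R[OF k(1)] sub_s by auto
  obtain l where l: "l < m" "{eu l, ew l} = {v, par v}" using par_edge[OF vR] by blast
  have bv: "base (head k) = base v" using base_sub_unmarked v by blast
  have bp: "base (par v) = base v" using base_par[OF vR] v by simp
  have hp: "head k \<in> sub (par v)" using v vR sub_par sub_trans by blast
  \<comment> \<open>The base of the head exceeds that of the tail, hence is at least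
    \<open>2 * n\<close>. So subtracting a depth is not truncated, and positions really increase on
    the way up.\<close>
  have "2 * n \<le> base v" using base_gap[OF base_tail_head[OF k(1)]] bv by simp
  then have "dep v \<le> base v" "0 < base v" using dep_less[OF vR(1)] n_pos by auto
  moreover have "base v - dep (par v) \<le> vpos (par v)"
    unfolding vpos_def bp by (auto split: if_splits)
  ultimately have "vpos v < vpos (par v)"
    using vlit_in_unmarked(3)[OF k(1) v] dep_par[OF vR] by linarith
  then show ?thesis
    unfolding fwd_def using l elit_tree[OF l(1) vR l(2)] vlit_in_unmarked(2)[OF k(1) v] k
      rel_less[OF k(1)] active_above_head[of k x "par v"] hp bv bp par_R[OF vR]
    by (auto intro!: exI[of _ l])
qed

text \<open>On the tree path, the next tree edge is taken unless it is bypassed by a used edge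
  \<open>k\<close>; then the tail of \<open>k\<close> lies below \<open>v\<close> and the path
  descends towards it. Off the tree path, the direction of the edge across the cut below
  \<open>v\<close> tells whether \<open>v\<close> is on the way down to a tail or up from a
  head.\<close>

lemma fwd_exists:
  assumes v: "v \<in> R" "v \<noteq> t" and act: "lval m x (vlit v)"
  shows "\<exists>w. fwd x v w"
proof -
  \<comment> \<open>Descends towards the tail of a used edge or, at the tail itself, crosses that
    edge. The last premise ensures that the branch taken does not contain the head as well.\<close>
  have via_tail: "\<exists>w. fwd x v w"
    if k: "rel k" "x k" "tail k \<in> sub v" "vpos v = base v + dep v"
      and c: "\<And>c. c \<in> R \<Longrightarrow> c \<noteq> s \<Longrightarrow> par c = v \<Longrightarrow> tail k \<in> sub c \<Longrightarrow> head k \<notin> sub c" for k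
  proof (cases "tail k = v")
    case True
    then show ?thesis using fwd_rel[of k x] k by auto
  next
    case False
    obtain c where "c \<in> R" "c \<noteq> s" "par c = v" "tail k \<in> sub c"
      using sub_child[OF k(3) False] by blast
    then show ?thesis using fwd_child[of c k x] k c by auto
  qed
  show ?thesis
  proof (cases "t \<in> sub v")
    case True
    obtain c where c: "c \<in> R" "c \<noteq> s" "par c = v" "t \<in> sub c"
      using sub_child[OF True] v by blast
    show ?thesis
    proof (cases "lval m x (tlit c)")
      case True
      then show ?thesis using fwd_marked[OF c(1,2,4)] c(3) by auto
    next
      case False
      have "MW c \<noteq> PW c" using False c by (auto simp: tlit_def)
      then obtain k where k: "rel k" "tail k \<notin> sub c" "head k \<in> sub c"
        using weight_cases[OF c(1)] marked_not_out c(4) by metis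
      have xk: "x k" using False vlit_in_marked(2)[OF k c(4)] rel_less[OF k(1)] by simp
      have hv: "head k \<in> sub v" using k c sub_par sub_trans by blast
      \<comment> \<open>Otherwise \<open>k\<close> would also cross the cut below \<open>v\<close>,
        with its head hanging from a later tree path vertex, and \<open>v\<close> would be bypassed,
        contrary to its true literal.\<close>
      have "tail k \<in> sub v"
      proof (rule ccontr)
        assume *: "tail k \<notin> sub v"
        have "base v < base c" using base_par[OF c(1,2)] c n_pos by simp
        also have "base c \<le> base (head k)" using base_sub_mono k by blast
        finally have "vlit v = Suc m + k" using vlit_in_marked(1)[OF k(1) * hv True] by simp
        then show False using act xk rel_less[OF k(1)] by simp
      qed
      moreover have "head k \<notin> sub d" if "d \<in> R" "d \<noteq> s" "par d = v" "tail k \<in> sub d" for d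
        using siblings_disjoint[of c d "head k"] c k that by auto
      ultimately show ?thesis using via_tail[OF k(1) xk] vpos_marked[OF True] by blast
    qed
  next
    case False
    have "MW v \<noteq> PW v" using act False by (auto simp: vlit_def)
    with v(1) show ?thesis
    proof (cases rule: weight_cases)
      case (out k)
      have xk: "x k" using act vlit_out(1)[OF out(1-3)] rel_less[OF out(1)] by simp
      have "head k \<notin> sub d" if "d \<in> R" "d \<noteq> s" "par d = v" for d
        using out(3) sub_par that sub_trans by blast
      then show ?thesis using via_tail[OF out(1) xk out(2)] vlit_out(3)[OF out(1-3)] by blast
    next
      case (into k)
      have xk: "x k" using act vlit_in_unmarked(1)[OF into(1-3) False] rel_less[OF into(1)] by simp
      then show ?thesis using fwd_up[OF into(1) _ into(2,3) False] by blast
    qed simp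
  qed
qed

lemma vlit_s: "vlit s = m"
proof -
  have "PW s = MW s" by (rule PW_eq_MW) (use tail_head_R sub_s in auto)
  then show ?thesis using sub_s[OF t_R] by (simp add: vlit_def)
qed

lemma vpos_bound: "v \<in> R \<Longrightarrow> vpos v \<le> Max (vpos ` R)"
  using R_sub finite_subset[of R "{..<n}"] by (auto intro!: Max_ge)

text \<open>The distance of \<open>vpos v\<close> to the largest position decreases with every step,
  and the walk can get stuck only at \<open>t\<close>.\<close>

lemma fwd_path_from:
  assumes "v \<in> R" "lval m x (vlit v)"
  shows "\<exists>Q. Q \<noteq> [] \<and> hd Q = v \<and> last Q = t \<and> successively (fwd x) Q"
  using assms
proof (induction "Max (vpos ` R) - vpos v" arbitrary: v rule: less_induct)
  case less
  show ?case
  proof (cases "v = t")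
    case True
    then show ?thesis by (intro exI[of _ "[t]"]) simp
  next
    case False
    then obtain w where w: "fwd x v w" using fwd_exists less.prems by blast
    then have "w \<in> R" "lval m x (vlit w)" "vpos v < vpos w" by (auto simp: fwd_def)
    moreover have "Max (vpos ` R) - vpos w < Max (vpos ` R) - vpos v"
      using calculation vpos_bound[of w] by linarith
    ultimately obtain Q where "Q \<noteq> []" "hd Q = w" "last Q = t" "successively (fwd x) Q"
      using less.hyps by blast
    then show ?thesis using w by (intro exI[of _ "v # Q"]) (auto simp: successively_Cons)
  qed
qed

lemma fwd_path:
  obtains Q where "Q \<noteq> []" "hd Q = s" "last Q = t" "successively (fwd x) Q"
  using fwd_path_from[OF s_R, of x] vlit_s by auto

lemma fwd_path_sorted: "successively (fwd x) Q \<Longrightarrow> sorted_wrt (<) (map vpos Q)"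
proof -
  assume "successively (fwd x) Q"
  then have "successively (<) (map vpos Q)"
    unfolding successively_map by (rule successively_mono) (auto simp: fwd_def)
  then show ?thesis by (simp add: successively_conv_sorted_wrt transp_on_def)
qed

lemma fwd_path_edge:
  assumes "successively (fwd x) Q" "Suc i < length Q"
  shows "\<exists>k<m. {eu k, ew k} = path_edge Q i \<and> lval m x (elit k)"
  using assms by (auto simp: successively_conv_nth fwd_def path_edge_def)

lemma fwd_path_vertices:
  assumes "successively (fwd x) Q" "hd Q = s" "v \<in> set Q"
  shows "v \<in> R \<and> lval m x (vlit v)"
proof -
  obtain i where i: "i < length Q" "v = Q ! i" using assms(3) by (auto simp: in_set_conv_nth)
  show ?thesis
  proof (cases i)
    case 0
    then have "v = s" using i assms(2) by (simp add: hd_conv_nth)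
    then show ?thesis using vlit_s s_R by simp
  next
    case (Suc j)
    then show ?thesis using i assms(1) by (auto simp: successively_conv_nth fwd_def)
  qed
qed

lemma fwd_path_is_path:
  assumes "successively (fwd x) Q" "hd Q = s" "last Q = t" "Q \<noteq> []"
  shows "is_path G s Q t"
proof -
  have "distinct (map vpos Q)"
    using fwd_path_sorted[OF assms(1)] strict_sorted_iff by blast
  then have "distinct Q" by (simp add: distinct_map)
  moreover have "set Q \<subseteq> {..<n}" using fwd_path_vertices[OF assms(1,2)] R_sub by blast
  moreover have "path_edge Q i \<in> snd G" if "Suc i < length Q" for i
    using fwd_path_edge[OF assms(1) that] by force
  ultimately show ?thesis
    unfolding is_path_def using assms(2-4) by simp
qed

section \<open>Parity: true literals belong to a given path\<close>

lemma path_edges: "is_path G s Q t \<Longrightarrow> e \<in> edges_of Q \<Longrightarrow> \<exists>k<m. e = {eu k, ew k}"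
  unfolding is_path_def edges_of_conv by force

text \<open>By \<open>base_outside_marked\<close>, the ends of an edge across the cut below a tree
  path vertex have different bases.\<close>

lemma nontree_crossing_marked:
  assumes "v \<noteq> s" "t \<in> sub v" "k < m" "\<not> tree_edge k" "crossing (sub v) {eu k, ew k}"
  shows "rel k"
proof -
  have aux: "base x \<noteq> base y" if "x \<in> sub v" "y \<notin> sub v" "y \<in> R" for x y
    using base_sub_mono[OF that(1)] base_outside_marked[OF assms(1,2) that(3,2)] by simp
  have "v \<in> R" using assms marked_R by blast
  then have "eu k \<in> R \<and> ew k \<in> R"
    using assms(5) R_closed[OF assms(3)] sub_R by (auto simp: crossing_pair)
  then have "base (eu k) \<noteq> base (ew k)"
    using assms(5) aux[of "eu k" "ew k"] aux[of "ew k" "eu k"] by (auto simp: crossing_pair)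
  then show ?thesis using assms by (simp add: rel_def)
qed

text \<open>A simple path from \<open>s\<close> crosses the cut below \<open>v\<close> an odd number of times iff \<open>t\<close> lies below
  \<open>v\<close>; besides the tree edge at \<open>v\<close>, at most one edge crosses this cut.\<close>

lemma tlit_edge:
  assumes Q: "is_path G s Q t" and v: "v \<in> R" "v \<noteq> s"
    and act: "lval m (\<lambda>k. {eu k, ew k} \<in> edges_of Q) (tlit v)"
  shows "{v, par v} \<in> edges_of Q"
proof (rule ccontr)
  assume no: "{v, par v} \<notin> edges_of Q"
  define D where "D = {e \<in> edges_of Q. crossing (sub v) e}"
  have odd: "odd (card D) \<longleftrightarrow> t \<in> sub v"
    using odd_card_crossing[of Q "sub v"] Q s_notin_sub[OF v(2)] by (auto simp: D_def is_path_def)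
  have D: "\<exists>k<m. e = {eu k, ew k} \<and> \<not> tree_edge k" if "e \<in> D" for e
  proof -
    have e: "e \<in> edges_of Q" "crossing (sub v) e" using that by (auto simp: D_def)
    obtain k where k: "k < m" "e = {eu k, ew k}" using path_edges[OF Q e(1)] by blast
    then have "\<not> tree_edge k" using crossing_tree_edge[OF v k(1)] e no by auto
    then show ?thesis using k by blast
  qed
  have only: "D \<subseteq> {{eu k, ew k}}" if k: "rel k" "(tail k \<in> sub v) \<noteq> (head k \<in> sub v)" for k
  proof
    fix e assume "e \<in> D"
    with D obtain l where l: "l < m" "e = {eu l, ew l}" "\<not> tree_edge l" by blast
    have "crossing (sub v) {eu k, ew k}" using k(2) by (simp add: edge_tail_head crossing_pair)
    moreover have "crossing (sub v) {eu l, ew l}" using \<open>e \<in> D\<close> l by (simp add: D_def)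
    ultimately have "l = k" using crossing_nontree_unique[OF v l(1,3) _ rel_less[OF k(1)]] k(1)
      by (simp add: rel_def)
    then show "e \<in> {{eu k, ew k}}" using l by simp
  qed
  have mem: "{eu k, ew k} \<in> D" if "rel k" "(tail k \<in> sub v) \<noteq> (head k \<in> sub v)"
    "{eu k, ew k} \<in> edges_of Q" for k
    using that by (simp add: D_def edge_tail_head crossing_pair)
  from v(1) show False
  proof (cases rule: weight_cases)
    case none
    then have t: "t \<in> sub v" using act by (auto simp: tlit_def vlit_def split: if_splits)
    have "D = {}"
    proof (rule ccontr)
      assume "D \<noteq> {}"
      then obtain e where e: "e \<in> D" by blast
      with D obtain k where k: "k < m" "e = {eu k, ew k}" "\<not> tree_edge k" by blast
      have c: "crossing (sub v) {eu k, ew k}" using e k by (simp add: D_def)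
      then have "rel k" using nontree_crossing_marked[OF v(2) t] k by blast
      then show False using none(2) c by (simp add: edge_tail_head crossing_pair)
    qed
    then show False using odd t by simp
  next
    case (out k)
    then have "{eu k, ew k} \<in> edges_of Q" using act vlit_out(2)[OF out(1-3)] rel_less by simp
    then have "D = {{eu k, ew k}}" using only[of k] mem[of k] out by blast
    then show False using odd marked_not_out[OF out(1-3)] by simp
  next
    case (into k)
    show False
    proof (cases "t \<in> sub v")
      case True
      then have "{eu k, ew k} \<notin> edges_of Q"
        using act vlit_in_marked(2)[OF into(1-3)] rel_less[OF into(1)] by simp
      then have "D = {}" using only[of k] into by (auto simp: D_def)
      then show False using odd True by simp
    next
      case False
      then have "{eu k, ew k} \<in> edges_of Q"
        using act vlit_in_unmarked(2)[OF into(1-3)] rel_less[OF into(1)] by simp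
      then have "D = {{eu k, ew k}}" using only[of k] mem[of k] into by blast
      then show False using odd False by simp
    qed
  qed
qed

text \<open>Parents of unreached vertices are arbitrary, so \<open>elit\<close> may mistake an
  unreached edge for a tree edge; the false constant makes this harmless.\<close>

lemma lits_unreached: "v \<notin> R \<Longrightarrow> vlit v = Suc m + m \<and> tlit v = Suc m + m"
  using marked_R PW_unreached by (auto simp: vlit_def tlit_def)

lemma elit_edge:
  assumes Q: "is_path G s Q t" and k: "k < m"
    and act: "lval m (\<lambda>k. {eu k, ew k} \<in> edges_of Q) (elit k)"
  shows "{eu k, ew k} \<in> edges_of Q"
proof -
  have aux: "{v, par v} \<in> edges_of Q"
    if "lval m (\<lambda>k. {eu k, ew k} \<in> edges_of Q) (tlit v)" "par v \<noteq> v" for v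
  proof -
    have "v \<in> R" using that(1) lits_unreached[of v] by (cases "v \<in> R") auto
    moreover have "v \<noteq> s" using that(2) par_s by auto
    ultimately show ?thesis using tlit_edge[OF Q] that(1) by blast
  qed
  consider "par (eu k) = ew k" "elit k = tlit (eu k)" | "par (ew k) = eu k" "elit k = tlit (ew k)"
    | "elit k = k" | "elit k = Suc m + m"
    unfolding elit_def by (metis (full_types))
  then show ?thesis
  proof cases
    case 1
    then show ?thesis using aux[of "eu k"] act ends_neq[OF k] by simp
  next
    case 2
    then show ?thesis using aux[of "ew k"] act ends_neq[OF k] by (simp add: insert_commute)
  qed (use act k in simp_all)
qed

text \<open>A true tree edge at \<open>v\<close> settles the claim. Otherwise \<open>v\<close> is on
  the tree path and a used edge bypasses only the tree edge above it. Its head hangs from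
  \<open>v\<close>: either the head is \<open>v\<close>, or the tree edge of the child of
  \<open>v\<close> towards the head is on the path.\<close>

lemma vlit_vertex:
  assumes Q: "is_path G s Q t" and act: "lval m (\<lambda>k. {eu k, ew k} \<in> edges_of Q) (vlit v)"
  shows "v \<in> set Q"
proof (cases "v = s")
  case True
  then show ?thesis using Q by (auto simp: is_path_def)
next
  case False
  have vR: "v \<in> R" using lits_unreached[of v] act by (cases "v \<in> R") auto
  have edge: "u \<in> set Q" if "{u, w} \<in> edges_of Q" for u w
    using edges_of_subset[OF that] by simp
  show ?thesis
  proof (cases "lval m (\<lambda>k. {eu k, ew k} \<in> edges_of Q) (tlit v)")
    case True
    then show ?thesis using tlit_edge[OF Q vR False] edge by blast
  next
    case F: False
    then have t: "t \<in> sub v" "MW v \<noteq> PW v" using act by (auto simp: tlit_def split: if_splits)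
    obtain k where k: "rel k" "tail k \<notin> sub v" "head k \<in> sub v"
      using weight_cases[OF vR] marked_not_out t by metis
    have km: "k < m" using rel_less[OF k(1)] .
    have b: "base (head k) = base v"
      using act F vlit_in_marked[OF k t(1)] by (auto split: if_splits)
    have used: "{eu k, ew k} \<in> edges_of Q" using F vlit_in_marked(2)[OF k t(1)] km by simp
    show ?thesis
    proof (cases "head k = v")
      case True
      then show ?thesis using used edge[of v "tail k"] by (simp add: edge_tail_head insert_commute)
    next
      case False
      obtain c where c: "c \<in> R" "c \<noteq> s" "par c = v" "head k \<in> sub c"
        using sub_child[OF k(3) False] by blast
      have "tail k \<notin> sub c" using k c sub_par sub_trans by blast
      moreover have "t \<notin> sub c"
      proof
        assume "t \<in> sub c"
        then have "base v < base c" using base_par[OF c(1,2)] c n_pos by simp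
        then show False using base_sub_mono[OF c(4)] b by simp
      qed
      ultimately have "tlit c = k" using vlit_in_unmarked(2)[OF k(1)] c(4) by blast
      then have "{c, par c} \<in> edges_of Q" using tlit_edge[OF Q c(1,2)] used km by simp
      then show ?thesis using edge[of v c] c by (simp add: insert_commute)
    qed
  qed
qed

text \<open>A clause is imposed only on a vertex and an edge that does not come before it, and
  \<open>vpos\<close> makes this comparison without knowing the path. The assignment on the right is
  unrestricted because each one yields a path.\<close>

theorem conforming_path_iff:
  assumes F: "\<And>v. v < n \<Longrightarrow> F v \<subseteq> {..<m}"
  shows "(\<exists>Q. is_path G s Q t \<and> conforming (\<lambda>v. (\<lambda>k. {eu k, ew k}) ` F v) Q) \<longleftrightarrow>
    (\<exists>x. \<forall>v<n. \<forall>k\<in>F v. vpos v \<le> epos k \<longrightarrow> \<not> (lval m x (vlit v) \<and> lval m x (elit k)))"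
proof
  assume "\<exists>Q. is_path G s Q t \<and> conforming (\<lambda>v. (\<lambda>k. {eu k, ew k}) ` F v) Q"
  then obtain Q where Q: "is_path G s Q t" and conf: "conforming (\<lambda>v. (\<lambda>k. {eu k, ew k}) ` F v) Q"
    by blast
  define x where "x k \<longleftrightarrow> {eu k, ew k} \<in> edges_of Q" for k
  have x: "x = (\<lambda>k. {eu k, ew k} \<in> edges_of Q)" by (simp add: x_def fun_eq_iff)
  obtain P where P: "P \<noteq> []" "hd P = s" "last P = t" "successively (fwd x) P" by (rule fwd_path)
  have "edges_of P \<subseteq> edges_of Q"
  proof
    fix e assume "e \<in> edges_of P"
    then obtain i where "e = path_edge P i" "Suc i < length P" by (auto simp: edges_of_conv)
    then obtain k where "k < m" "{eu k, ew k} = e" "lval m x (elit k)"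
      using fwd_path_edge[OF P(4)] by blast
    then show "e \<in> edges_of Q" using elit_edge[OF Q] x by auto
  qed
  \<comment> \<open>Positions increase along \<open>P\<close> by construction; the equality
    transfers this order to the given path \<open>Q\<close>.\<close>
  then have "P = Q"
    using fwd_path_is_path[OF P(4,2,3,1)] Q by (intro simple_path_edges_subset_eq) (auto simp: is_path_def)
  then have sorted: "sorted_wrt (<) (map vpos Q)" using fwd_path_sorted[OF P(4)] by simp
  have mono: "vpos (Q ! i) < vpos (Q ! j)" if "i < j" "j < length Q" for i j
    using sorted_wrt_nth_less[OF sorted] that by simp
  have "\<not> (lval m x (vlit v) \<and> lval m x (elit k))"
    if v: "v < n" and k: "k \<in> F v" and pos: "vpos v \<le> epos k" for v k
  proof
    assume act: "lval m x (vlit v) \<and> lval m x (elit k)"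
    have km: "k < m" using F v k by blast
    obtain j where j: "j < length Q" "Q ! j = v"
      using vlit_vertex[OF Q] act x by (auto simp: in_set_conv_nth)
    have "{eu k, ew k} \<in> edges_of Q" using elit_edge[OF Q km] act x by auto
    then obtain i where i: "{eu k, ew k} = path_edge Q i" "Suc i < length Q"
      by (auto simp: edges_of_conv)
    then have "epos k \<le> vpos (Q ! i)"
      by (auto simp: epos_def path_edge_def doubleton_eq_iff)
    then have "vpos (Q ! j) \<le> vpos (Q ! i)" using pos j by simp
    then have "j \<le> i" using mono[of i j] j by (meson leD leI)
    then show False using conf i k j unfolding conforming_def by blast
  qed
  then show "\<exists>x. \<forall>v<n. \<forall>k\<in>F v. vpos v \<le> epos k \<longrightarrow> \<not> (lval m x (vlit v) \<and> lval m x (elit k))"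
    by blast
next
  assume "\<exists>x. \<forall>v<n. \<forall>k\<in>F v. vpos v \<le> epos k \<longrightarrow> \<not> (lval m x (vlit v) \<and> lval m x (elit k))"
  then obtain x where x: "\<And>v k. v < n \<Longrightarrow> k \<in> F v \<Longrightarrow> vpos v \<le> epos k \<Longrightarrow>
    \<not> (lval m x (vlit v) \<and> lval m x (elit k))" by blast
  obtain Q where Q: "Q \<noteq> []" "hd Q = s" "last Q = t" "successively (fwd x) Q" by (rule fwd_path)
  have sorted: "sorted_wrt (<) (map vpos Q)" using fwd_path_sorted[OF Q(4)] .
  have mono: "vpos (Q ! i) < vpos (Q ! j)" if "i < j" "j < length Q" for i j
    using sorted_wrt_nth_less[OF sorted] that by simp
  have "conforming (\<lambda>v. (\<lambda>k. {eu k, ew k}) ` F v) Q"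
    unfolding conforming_def
  proof (intro allI impI notI)
    fix i j assume i: "Suc i < length Q" and j: "j \<le> i"
      and bad: "path_edge Q i \<in> (\<lambda>k. {eu k, ew k}) ` F (Q ! j)"
    have qj: "Q ! j \<in> R" "lval m x (vlit (Q ! j))"
      using fwd_path_vertices[OF Q(4,2), of "Q ! j"] i j by auto
    then have jn: "Q ! j < n" using R_sub by auto
    obtain k where k: "k < m" "{eu k, ew k} = path_edge Q i" "lval m x (elit k)"
      using fwd_path_edge[OF Q(4) i] by blast
    obtain l where l: "l \<in> F (Q ! j)" "path_edge Q i = {eu l, ew l}" using bad by blast
    have "l = k" by (rule edge_eqD) (use k l F jn in auto)
    then have kF: "k \<in> F (Q ! j)" using l by simp
    have "vpos (Q ! j) \<le> vpos (Q ! i)" using mono[of j i] i j by (cases "i = j") auto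
    moreover have "vpos (Q ! i) < vpos (Q ! Suc i)" using mono[of i "Suc i"] i by simp
    ultimately have "vpos (Q ! j) \<le> epos k"
      using k(2) by (auto simp: epos_def path_edge_def doubleton_eq_iff)
    then show False using x[OF jn kF] qj k by blast
  qed
  then show "\<exists>Q. is_path G s Q t \<and> conforming (\<lambda>v. (\<lambda>k. {eu k, ew k}) ` F v) Q"
    using fwd_path_is_path[OF Q(4,2,3,1)] by blast
qed

end

section \<open>Reasoning about RAM programs\<close>

fun seqs :: "com list \<Rightarrow> com" where
  "seqs [] = Skip"
| "seqs [c] = c"
| "seqs (c # d # cs) = Seq c (seqs (d # cs))"

definition bounded :: "nat \<Rightarrow> state \<Rightarrow> bool" where
  "bounded W \<sigma> \<longleftrightarrow> (\<forall>x. fst \<sigma> x < W) \<and> (\<forall>A i. snd \<sigma> A i < W)"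

fun wregs :: "com \<Rightarrow> nat set" where
  "wregs (Assign x _) = {x}"
| "wregs (Add x _ _) = {x}"
| "wregs (Sub x _ _) = {x}"
| "wregs (Load x _ _) = {x}"
| "wregs (Seq c d) = wregs c \<union> wregs d"
| "wregs (Cond _ c d) = wregs c \<union> wregs d"
| "wregs (While _ c) = wregs c"
| "wregs _ = {}"

fun warrs :: "com \<Rightarrow> nat set" where
  "warrs (Store A _ _) = {A}"
| "warrs (Seq c d) = warrs c \<union> warrs d"
| "warrs (Cond _ c d) = warrs c \<union> warrs d"
| "warrs (While _ c) = warrs c"
| "warrs _ = {}"

text \<open>The footprint is read off the program text, so that facts about untouched registers and
  arrays survive whole phases by simplification.\<close>

definition frame :: "com \<Rightarrow> state \<Rightarrow> state \<Rightarrow> bool" where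
  "frame c \<sigma> \<tau> \<longleftrightarrow> (\<forall>x. x \<notin> wregs c \<longrightarrow> fst \<tau> x = fst \<sigma> x) \<and> (\<forall>A. A \<notin> warrs c \<longrightarrow> snd \<tau> A = snd \<sigma> A)"

lemma exec_frame: "exec W c \<sigma> k \<tau> \<Longrightarrow> frame c \<sigma> \<tau>"
proof (induction rule: exec.induct)
  case (exec_Seq c \<sigma> k \<sigma>' d l \<sigma>'')
  then show ?case unfolding frame_def wregs.simps warrs.simps by (metis UnCI)
next
  case (exec_CondTrue \<sigma> t c k \<sigma>' d)
  then show ?case unfolding frame_def wregs.simps warrs.simps by (metis UnCI)
next
  case (exec_CondFalse \<sigma> t d k \<sigma>' c)
  then show ?case unfolding frame_def wregs.simps warrs.simps by (metis UnCI)
next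
  case (exec_WhileTrue \<sigma> t c k \<sigma>' l \<sigma>'')
  then show ?case unfolding frame_def wregs.simps warrs.simps by metis
qed (simp_all add: frame_def set_reg_def set_cell_def)

lemma exec_bounded: "exec W c \<sigma> k \<tau> \<Longrightarrow> bounded W \<sigma> \<Longrightarrow> bounded W \<tau>"
proof (induction rule: exec.induct)
  case (exec_Seq c \<sigma> k \<sigma>' d l \<sigma>'')
  then show ?case by blast
next
  case (exec_WhileTrue \<sigma> t c k \<sigma>' l \<sigma>'')
  then show ?case by blast
qed (simp_all add: set_reg_def set_cell_def bounded_def)

text \<open>The catch-all equation also covers loops; bounds derived from it stay sound because
  \<open>wp\<close> is false on loops.\<close>

fun cost :: "com \<Rightarrow> nat" where
  "cost (Seq c d) = cost c + cost d"
| "cost (Cond _ c d) = Suc (max (cost c) (cost d))"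
| "cost _ = 1"

text \<open>On a bounded state, only additions and constants can overflow; loops are excluded.\<close>

fun wp :: "nat \<Rightarrow> com \<Rightarrow> (state \<Rightarrow> bool) \<Rightarrow> state \<Rightarrow> bool" where
  "wp W Skip Q \<sigma> = Q \<sigma>"
| "wp W (Assign x a) Q \<sigma> = ((case a of Const k \<Rightarrow> k < W | _ \<Rightarrow> True) \<and> Q (set_reg \<sigma> x (val \<sigma> a)))"
| "wp W (Add x a b) Q \<sigma> = (val \<sigma> a + val \<sigma> b < W \<and> Q (set_reg \<sigma> x (val \<sigma> a + val \<sigma> b)))"
| "wp W (Sub x a b) Q \<sigma> =
    ((case a of Const k \<Rightarrow> k < W | _ \<Rightarrow> True) \<and> Q (set_reg \<sigma> x (val \<sigma> a - val \<sigma> b)))"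
| "wp W (Load x A i) Q \<sigma> = Q (set_reg \<sigma> x (snd \<sigma> A (val \<sigma> i)))"
| "wp W (Store A i a) Q \<sigma> =
    ((case a of Const k \<Rightarrow> k < W | _ \<Rightarrow> True) \<and> Q (set_cell \<sigma> A (val \<sigma> i) (val \<sigma> a)))"
| "wp W (Seq c d) Q \<sigma> = wp W c (wp W d Q) \<sigma>"
| "wp W (Cond t c d) Q \<sigma> = (if holds \<sigma> t then wp W c Q \<sigma> else wp W d Q \<sigma>)"
| "wp W (While t c) Q \<sigma> = False"

lemma val_bounded: "bounded W \<sigma> \<Longrightarrow> (case a of Const k \<Rightarrow> k < W | _ \<Rightarrow> True) \<Longrightarrow> val \<sigma> a < W"
  by (cases a) (auto simp: bounded_def)

lemma wp_exec: "wp W c Q \<sigma> \<Longrightarrow> bounded W \<sigma> \<Longrightarrow> \<exists>k \<tau>. exec W c \<sigma> k \<tau> \<and> k \<le> cost c \<and> Q \<tau>"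
proof (induction c arbitrary: Q \<sigma>)
  case Skip
  then show ?case using exec_Skip by (intro exI[of _ 1] exI[of _ \<sigma>]) auto
next
  case (Assign x a)
  then show ?case using exec_Assign[of \<sigma> a W x] val_bounded[of W \<sigma> a] by fastforce
next
  case (Add x a b)
  then show ?case using exec_Add[of \<sigma> a b W x] by fastforce
next
  case (Sub x a b)
  then have "val \<sigma> a < W" using val_bounded[of W \<sigma> a] by simp
  then have "val \<sigma> a - val \<sigma> b < W" by simp
  then show ?case using exec_Sub[of \<sigma> a b W x] Sub by fastforce
next
  case (Load x A i)
  then show ?case using exec_Load[of \<sigma> A i W x] by (fastforce simp: bounded_def)
next
  case (Store A i a)
  then show ?case using exec_Store[of \<sigma> a W A i] val_bounded[of W \<sigma> a] by fastforce
next
  case (Seq c d)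
  obtain k \<sigma>' where k: "exec W c \<sigma> k \<sigma>'" "k \<le> cost c" "wp W d Q \<sigma>'"
    using Seq.IH(1)[of "wp W d Q" \<sigma>] Seq.prems by auto
  then obtain l \<tau> where "exec W d \<sigma>' l \<tau>" "l \<le> cost d" "Q \<tau>"
    using Seq.IH(2)[of Q \<sigma>'] exec_bounded[OF k(1) Seq.prems(2)] by auto
  then show ?case using exec_Seq[OF k(1)] k(2) by (fastforce intro: add_mono)
next
  case (Cond t c d)
  show ?case
  proof (cases "holds \<sigma> t")
    case True
    then obtain k \<tau> where "exec W c \<sigma> k \<tau>" "k \<le> cost c" "Q \<tau>"
      using Cond.IH(1)[of Q \<sigma>] Cond.prems by auto
    then show ?thesis using exec_CondTrue[OF True, of W c k \<tau> d]
      by (intro exI[of _ "Suc k"] exI[of _ \<tau>]) auto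
  next
    case False
    then obtain k \<tau> where "exec W d \<sigma> k \<tau>" "k \<le> cost d" "Q \<tau>"
      using Cond.IH(2)[of Q \<sigma>] Cond.prems by auto
    then show ?thesis using exec_CondFalse[OF False, of W d k \<tau> c]
      by (intro exI[of _ "Suc k"] exI[of _ \<tau>]) auto
  qed
qed simp

definition runs :: "nat \<Rightarrow> com \<Rightarrow> nat \<Rightarrow> (state \<Rightarrow> bool) \<Rightarrow> state \<Rightarrow> bool" where
  "runs W c T Q \<sigma> \<longleftrightarrow> (\<exists>k \<tau>. exec W c \<sigma> k \<tau> \<and> k \<le> T \<and> bounded W \<tau> \<and> frame c \<sigma> \<tau> \<and> Q \<tau>)"

lemma runs_wp:
  assumes "bounded W \<sigma>" "wp W c Q \<sigma>" "cost c \<le> T"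
  shows "runs W c T Q \<sigma>"
proof -
  obtain k \<tau> where k: "exec W c \<sigma> k \<tau>" "k \<le> cost c" "Q \<tau>"
    using wp_exec[OF assms(2,1)] by blast
  then show ?thesis
    unfolding runs_def using exec_bounded[OF k(1) assms(1)] exec_frame[OF k(1)] assms(3)
    by (intro exI[of _ k] exI[of _ \<tau>]) auto
qed

lemma runs_mono:
  assumes "runs W c T Q \<sigma>" "T \<le> T'" "\<And>\<tau>. bounded W \<tau> \<Longrightarrow> frame c \<sigma> \<tau> \<Longrightarrow> Q \<tau> \<Longrightarrow> Q' \<tau>"
  shows "runs W c T' Q' \<sigma>"
proof -
  obtain k \<tau> where k: "exec W c \<sigma> k \<tau>" "k \<le> T" "bounded W \<tau>" "frame c \<sigma> \<tau>" "Q \<tau>"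
    using assms(1) unfolding runs_def by blast
  then show ?thesis
    unfolding runs_def using assms(2,3) by (intro exI[of _ k] exI[of _ \<tau>]) auto
qed

lemma runs_Seq:
  assumes "runs W c T Q \<sigma>" "bounded W \<sigma>"
    and "\<And>\<tau>. bounded W \<tau> \<Longrightarrow> frame c \<sigma> \<tau> \<Longrightarrow> Q \<tau> \<Longrightarrow> runs W d T' Q' \<tau>"
  shows "runs W (Seq c d) (T + T') Q' \<sigma>"
proof -
  obtain k \<sigma>' where k: "exec W c \<sigma> k \<sigma>'" "k \<le> T" "bounded W \<sigma>'" "frame c \<sigma> \<sigma>'" "Q \<sigma>'"
    using assms(1) by (auto simp: runs_def)
  then obtain l \<tau> where l: "exec W d \<sigma>' l \<tau>" "l \<le> T'" "bounded W \<tau>" "Q' \<tau>"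
    using assms(3)[OF k(3-5)] unfolding runs_def by blast
  have "exec W (Seq c d) \<sigma> (k + l) \<tau>" using exec_Seq k l by blast
  then show ?thesis
    unfolding runs_def using k l exec_frame add_mono by (intro exI[of _ "k + l"] exI[of _ \<tau>]) auto
qed

text \<open>Every iteration is charged at most \<open>Suc (cost c)\<close> steps, a constant,
  against a decrease of \<open>\<mu>\<close> by at least one. All amortisation in the time bounds is
  thus moved into the choice of \<open>\<mu>\<close>.\<close>

lemma runs_While:
  assumes "bounded W (r, a)" "I r a"
    and body: "\<And>r a. bounded W (r, a) \<Longrightarrow> I r a \<Longrightarrow> holds (r, a) t \<Longrightarrow>
      wp W c (\<lambda>(r', a'). I r' a' \<and> \<mu> r' a' < \<mu> r a) (r, a)"
    and T: "Suc (Suc (cost c) * \<mu> r a) \<le> T"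
    and post: "\<And>r a. I r a \<Longrightarrow> \<not> holds (r, a) t \<Longrightarrow> Q r a"
  shows "runs W (While t c) T (\<lambda>(r, a). Q r a) (r, a)"
proof -
  have "\<exists>k \<tau>. exec W (While t c) \<sigma> k \<tau> \<and> k \<le> Suc (Suc (cost c) * \<mu> (fst \<sigma>) (snd \<sigma>)) \<and>
      Q (fst \<tau>) (snd \<tau>)"
    if "bounded W \<sigma>" "I (fst \<sigma>) (snd \<sigma>)" for \<sigma>
    using that
  proof (induction "\<mu> (fst \<sigma>) (snd \<sigma>)" arbitrary: \<sigma> rule: less_induct)
    case less
    show ?case
    proof (cases "holds \<sigma> t")
      case True
      have "wp W c (\<lambda>(r', a'). I r' a' \<and> \<mu> r' a' < \<mu> (fst \<sigma>) (snd \<sigma>)) \<sigma>"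
        using body[of "fst \<sigma>" "snd \<sigma>"] less.prems True by simp
      then obtain k \<sigma>' where k: "exec W c \<sigma> k \<sigma>'" "k \<le> cost c"
        "I (fst \<sigma>') (snd \<sigma>')" "\<mu> (fst \<sigma>') (snd \<sigma>') < \<mu> (fst \<sigma>) (snd \<sigma>)"
        using wp_exec[OF _ less.prems(1)] unfolding case_prod_beta by blast
      then obtain l \<tau> where l: "exec W (While t c) \<sigma>' l \<tau>"
        "l \<le> Suc (Suc (cost c) * \<mu> (fst \<sigma>') (snd \<sigma>'))" "Q (fst \<tau>) (snd \<tau>)"
        using less.hyps exec_bounded[OF k(1) less.prems(1)] by blast
      have "Suc (cost c) * Suc (\<mu> (fst \<sigma>') (snd \<sigma>')) \<le> Suc (cost c) * \<mu> (fst \<sigma>) (snd \<sigma>)"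
        using k(4) by (intro mult_le_mono2) simp
      then have "Suc (k + l) \<le> Suc (Suc (cost c) * \<mu> (fst \<sigma>) (snd \<sigma>))"
        using k(2) l(2) by simp
      then show ?thesis using exec_WhileTrue[OF True k(1) l(1)] l(3) by blast
    next
      case False
      then show ?thesis using exec_WhileFalse[OF False] post[of "fst \<sigma>" "snd \<sigma>"] less.prems
        by (intro exI[of _ 1] exI[of _ \<sigma>]) auto
    qed
  qed
  from this[of "(r, a)"] obtain k \<tau> where k: "exec W (While t c) (r, a) k \<tau>" "k \<le> T" "Q (fst \<tau>) (snd \<tau>)"
    using assms(1,2) T by auto
  show ?thesis
    unfolding runs_def using k exec_bounded[OF k(1) assms(1)] exec_frame[OF k(1)]
    by (intro exI[of _ k] exI[of _ \<tau>]) (auto simp: case_prod_beta)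
qed

lemma runs_loop:
  assumes b: "bounded W (r, a)"
    and init: "wp W init (\<lambda>(r', a'). I r' a' \<and> \<mu> r' a' \<le> K) (r, a)"
    and body: "\<And>r a. bounded W (r, a) \<Longrightarrow> I r a \<Longrightarrow> holds (r, a) t \<Longrightarrow>
      wp W c (\<lambda>(r', a'). I r' a' \<and> \<mu> r' a' < \<mu> r a) (r, a)"
    and post: "\<And>r a. I r a \<Longrightarrow> \<not> holds (r, a) t \<Longrightarrow> Q r a"
    and T: "cost init + Suc (Suc (cost c) * K) \<le> T"
  shows "runs W (Seq init (While t c)) T (\<lambda>(r, a). Q r a) (r, a)"
proof (rule runs_mono)
  show "runs W (Seq init (While t c)) (cost init + Suc (Suc (cost c) * K)) (\<lambda>(r, a). Q r a) (r, a)"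
  proof (rule runs_Seq[OF runs_wp[OF b init order.refl] b])
    fix \<tau> assume \<tau>: "bounded W \<tau>" "case \<tau> of (r', a') \<Rightarrow> I r' a' \<and> \<mu> r' a' \<le> K"
    obtain r' a' where ra: "\<tau> = (r', a')" by (cases \<tau>)
    have "Suc (cost c) * \<mu> r' a' \<le> Suc (cost c) * K" using \<tau> ra by (intro mult_le_mono2) simp
    then show "runs W (While t c) (Suc (Suc (cost c) * K)) (\<lambda>(r, a). Q r a) \<tau>"
      unfolding ra using \<tau> ra by (intro runs_While[where I = I and \<mu> = \<mu>] body post) auto
  qed
qed (use T in auto)

lemma set_reg_pair [simp]: "set_reg (r, a) x k = (r(x := k), a)"
  by (simp add: set_reg_def)

lemma set_cell_pair [simp]: "set_cell (r, a) A i k = (r, a(A := (a A)(i := k)))"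
  by (simp add: set_cell_def)

section \<open>Arc lists as linked lists in arrays\<close>

text \<open>Arc number \<open>j\<close> of the list has the identifier \<open>Suc j\<close>; the identifier 0 ends a chain.\<close>

fun prev_arc :: "(nat \<times> nat) list \<Rightarrow> nat \<Rightarrow> nat \<Rightarrow> nat" where
  "prev_arc as x 0 = 0"
| "prev_arc as x (Suc p) = (if fst (as ! p) = x then Suc p else prev_arc as x p)"

text \<open>The remaining length of the chain of \<open>x\<close> from identifier \<open>p\<close>
  downwards, used as potential for scans.\<close>

fun count_arcs :: "(nat \<times> nat) list \<Rightarrow> nat \<Rightarrow> nat \<Rightarrow> nat" where
  "count_arcs as x 0 = 0"
| "count_arcs as x (Suc p) = (if fst (as ! p) = x then Suc (count_arcs as x p) else count_arcs as x p)"

definition linked :: "(nat \<times> nat) list \<Rightarrow> (nat \<Rightarrow> nat) \<Rightarrow> (nat \<Rightarrow> nat) \<Rightarrow> (nat \<Rightarrow> nat) \<Rightarrow> bool" where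
  "linked as hp nx tg \<longleftrightarrow> (\<forall>x. hp x = prev_arc as x (length as)) \<and>
     (\<forall>j<length as. nx (Suc j) = prev_arc as (fst (as ! j)) j \<and> tg (Suc j) = snd (as ! j))"

lemma prev_arc_append: "p \<le> length as \<Longrightarrow> prev_arc (as @ bs) x p = prev_arc as x p"
  by (induction p) (auto simp: nth_append)

lemma linked_Nil: "linked [] (\<lambda>_. 0) nx tg"
  by (simp add: linked_def)

lemma linked_snoc:
  assumes "linked as hp nx tg" "c = Suc (length as)" "h = hp x"
  shows "linked (as @ [(x, y)]) (hp(x := c)) (nx(c := h)) (tg(c := y))"
  using assms by (auto simp: linked_def nth_append prev_arc_append less_Suc_eq)

lemma prev_arc_le: "prev_arc as x p \<le> p"
  by (induction p) auto

lemma prev_arc_src: "prev_arc as x p \<noteq> 0 \<Longrightarrow> fst (as ! (prev_arc as x p - 1)) = x"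
  by (induction p) auto

lemma prev_arc_greatest: "prev_arc as x p \<le> j \<Longrightarrow> j < p \<Longrightarrow> fst (as ! j) \<noteq> x"
  by (induction p) (auto simp: less_Suc_eq split: if_splits)

lemma count_arcs_prev: "count_arcs as x (prev_arc as x p) = count_arcs as x p"
  by (induction p) auto

abbreviation out_arcs :: "(nat \<times> nat) list \<Rightarrow> nat \<Rightarrow> nat" where
  "out_arcs as x \<equiv> count_arcs as x (length as)"

text \<open>Every arc has one source, so all chains together are no longer than the list; this makes
  the scans linear in total.\<close>

lemma sum_count_arcs: "finite S \<Longrightarrow> (\<Sum>x\<in>S. count_arcs as x p) \<le> p"
proof (induction p)
  case (Suc p)
  have "(\<Sum>x\<in>S. count_arcs as x (Suc p)) = (\<Sum>x\<in>S. count_arcs as x p + (if fst (as ! p) = x then 1 else 0))"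
    by (intro sum.cong) auto
  also have "\<dots> = (\<Sum>x\<in>S. count_arcs as x p) + (\<Sum>x\<in>S. if fst (as ! p) = x then 1 else 0)"
    by (simp only: sum.distrib)
  also have "(\<Sum>x\<in>S. if fst (as ! p) = x then 1 else 0) \<le> (1 :: nat)"
    using Suc.prems by (simp add: sum.delta)
  finally show ?case using Suc by linarith
qed simp

text \<open>\<open>pointer as x p\<close>: the arcs of \<open>x\<close> with identifiers up to \<open>p\<close> are still to be scanned.\<close>

definition pointer :: "(nat \<times> nat) list \<Rightarrow> nat \<Rightarrow> nat \<Rightarrow> bool" where
  "pointer as x p \<longleftrightarrow> p \<le> length as \<and> (p \<noteq> 0 \<longrightarrow> fst (as ! (p - 1)) = x)"

lemma linked_hd:
  assumes "linked as hp nx tg"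
  shows "pointer as x (hp x)" "count_arcs as x (hp x) = out_arcs as x"
    "hp x \<le> j \<Longrightarrow> j < length as \<Longrightarrow> fst (as ! j) \<noteq> x"
  using assms prev_arc_le[of as x "length as"] prev_arc_src[of as x "length as"]
    prev_arc_greatest[of as x "length as" j] count_arcs_prev[of as x "length as"]
  by (auto simp: linked_def pointer_def)

text \<open>Chains run from newer to older arcs. The last claim records that no arc of
  \<open>x\<close> is skipped between two entries, so that following the chain sees all of
  them.\<close>

lemma linked_next:
  assumes "linked as hp nx tg" "pointer as x p" "p \<noteq> 0"
  shows "(x, tg p) \<in> set as" "tg p = snd (as ! (p - 1))" "pointer as x (nx p)"
    "count_arcs as x p = Suc (count_arcs as x (nx p))"
    "nx p \<le> j \<Longrightarrow> j < p \<Longrightarrow> fst (as ! j) = x \<Longrightarrow> j = p - 1"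
proof -
  obtain i where i: "p = Suc i" using assms(3) by (cases p) auto
  have il: "i < length as" "fst (as ! i) = x" using assms(2) i by (auto simp: pointer_def)
  have nx: "nx p = prev_arc as x i" "tg p = snd (as ! i)" using assms(1) il i by (auto simp: linked_def)
  show "(x, tg p) \<in> set as" using nth_mem[OF il(1)] il(2) nx(2) by (metis prod.collapse)
  show "tg p = snd (as ! (p - 1))" using nx i by simp
  show "pointer as x (nx p)"
    using nx prev_arc_le[of as x i] prev_arc_src[of as x i] il by (auto simp: pointer_def)
  show "count_arcs as x p = Suc (count_arcs as x (nx p))"
    using i il nx by (simp add: count_arcs_prev)
  show "nx p \<le> j \<Longrightarrow> j < p \<Longrightarrow> fst (as ! j) = x \<Longrightarrow> j = p - 1"
    using prev_arc_greatest[of as x i j] nx i by (auto simp: less_Suc_eq)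
qed

section \<open>Breadth-first search\<close>

definition addarc :: "nat \<Rightarrow> nat \<Rightarrow> nat \<Rightarrow> nat \<Rightarrow> nat \<Rightarrow> nat \<Rightarrow> nat \<Rightarrow> com" where
  "addarc H N T c x y z = seqs [Add c (Reg c) (Const 1), Store T (Reg c) (Reg y), Load z H (Reg x),
     Store N (Reg c) (Reg z), Store H (Reg x) (Reg c)]"

text \<open>Vertices at queue indices below \<open>qh\<close> are fully scanned; \<open>cur\<close>
  is being scanned, and its arcs with identifiers above \<open>ptr\<close> are done. Bounding the
  depth by the queue index keeps the depths of queued vertices below \<open>n\<close>.\<close>

definition bfs_inv :: "(nat \<times> nat) list \<Rightarrow> nat \<Rightarrow> nat \<Rightarrow> (nat \<Rightarrow> nat) \<Rightarrow> nat \<Rightarrow> nat \<Rightarrow> nat \<Rightarrow> nat \<Rightarrow>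
    (nat \<Rightarrow> nat) \<Rightarrow> (nat \<Rightarrow> nat) \<Rightarrow> (nat \<Rightarrow> nat) \<Rightarrow> bool" where
  "bfs_inv as n s q qh qt cur ptr vis par dep \<longleftrightarrow>
     1 \<le> qt \<and> qh \<le> qt \<and> inj_on q {..<qt} \<and> q ` {..<qt} \<subseteq> {..<n} \<and> q 0 = s \<and> par s = s \<and> dep s = 0 \<and>
     (\<forall>w. vis w \<noteq> 0 \<longleftrightarrow> w \<in> q ` {..<qt}) \<and>
     (\<forall>i. 0 < i \<and> i < qt \<longrightarrow> (\<exists>j<i. par (q i) = q j \<and> dep (q i) = Suc (dep (q j)) \<and> (q j, q i) \<in> set as)) \<and>
     (\<forall>i<qt. dep (q i) \<le> i) \<and> (\<forall>w. dep w \<le> n) \<and>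
     (\<forall>i<qh. \<forall>y. (q i, y) \<in> set as \<longrightarrow> vis y \<noteq> 0) \<and>
     (qh < qt \<longrightarrow> cur = q qh \<and> pointer as cur ptr \<and>
        (\<forall>j<length as. fst (as ! j) = cur \<and> ptr \<le> j \<longrightarrow> vis (snd (as ! j)) \<noteq> 0))"

text \<open>Vertices that are not yet popped count with all their arcs, whether they are queued or
  not, so that enqueueing a vertex does not raise the measure.\<close>

definition bfs_measure :: "(nat \<times> nat) list \<Rightarrow> nat \<Rightarrow> (nat \<Rightarrow> nat) \<Rightarrow> nat \<Rightarrow> nat \<Rightarrow> nat \<Rightarrow> nat \<Rightarrow> nat" where
  "bfs_measure as n q qh qt cur ptr =
     (if qh < qt then Suc (count_arcs as cur ptr + (\<Sum>v\<in>{..<n} - q ` {..qh}. Suc (out_arcs as v)))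
      else 0)"

lemma bfs_qt_le: "bfs_inv as n s q qh qt cur ptr vis par dep \<Longrightarrow> qt \<le> n"
proof -
  assume inv: "bfs_inv as n s q qh qt cur ptr vis par dep"
  have inj: "inj_on q {..<qt}" using inv by (simp add: bfs_inv_def)
  have range: "q ` {..<qt} \<subseteq> {..<n}" using inv by (simp add: bfs_inv_def)
  show "qt \<le> n" using card_inj_on_le[OF inj range] by simp
qed

lemma bfs_pop:
  assumes inv: "bfs_inv as n s q qh qt cur 0 vis par dep" and "qh < qt"
    and l: "linked as hp nx tg"
  shows "bfs_inv as n s q (Suc qh) qt (q (Suc qh)) (hp (q (Suc qh))) vis par dep"
    and "bfs_measure as n q (Suc qh) qt (q (Suc qh)) (hp (q (Suc qh))) < bfs_measure as n q qh qt cur 0"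
proof -
  have cur: "cur = q qh" and scanned: "\<And>j. j < length as \<Longrightarrow> fst (as ! j) = cur \<Longrightarrow> vis (snd (as ! j)) \<noteq> 0"
    using inv \<open>qh < qt\<close> by (auto simp: bfs_inv_def)
  have "vis y \<noteq> 0" if "(q i, y) \<in> set as" "i < Suc qh" for i y
  proof (cases "i = qh")
    case True
    obtain j where "j < length as" "as ! j = (q i, y)" using \<open>(q i, y) \<in> set as\<close> by (auto simp: in_set_conv_nth)
    then show ?thesis using scanned[of j] cur True by simp
  next
    case False
    have "\<forall>i<qh. \<forall>y. (q i, y) \<in> set as \<longrightarrow> vis y \<noteq> 0"
      using inv unfolding bfs_inv_def by blast
    moreover have "i < qh" using False that by simp
    ultimately show ?thesis using that by blast
  qed
  then show "bfs_inv as n s q (Suc qh) qt (q (Suc qh)) (hp (q (Suc qh))) vis par dep"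
    using inv \<open>qh < qt\<close> linked_hd(1)[OF l] linked_hd(3)[OF l] unfolding bfs_inv_def by auto
  show "bfs_measure as n q (Suc qh) qt (q (Suc qh)) (hp (q (Suc qh))) < bfs_measure as n q qh qt cur 0"
  proof (cases "Suc qh < qt")
    case True
    have inj: "inj_on q {..<qt}" and range: "q ` {..<qt} \<subseteq> {..<n}" using inv by (auto simp: bfs_inv_def)
    let ?x = "q (Suc qh)"
    have "?x \<notin> q ` {..qh}"
    proof
      assume "?x \<in> q ` {..qh}"
      then obtain i where "i \<le> qh" "q (Suc qh) = q i" by auto
      then have "Suc qh = i" using inj True by (auto dest: inj_onD)
      then show False using \<open>i \<le> qh\<close> by simp
    qed
    moreover have "?x < n" using range True by auto
    moreover have "{..<n} - q ` {..Suc qh} = ({..<n} - q ` {..qh}) - {?x}" by (auto simp: atMost_Suc)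
    ultimately have "(\<Sum>v\<in>{..<n} - q ` {..qh}. Suc (out_arcs as v)) =
        Suc (out_arcs as ?x) + (\<Sum>v\<in>{..<n} - q ` {..Suc qh}. Suc (out_arcs as v))"
      by (simp add: sum.remove[of "{..<n} - q ` {..qh}" ?x])
    then show ?thesis using True \<open>qh < qt\<close> linked_hd(2)[OF l] by (simp add: bfs_measure_def)
  qed (use \<open>qh < qt\<close> in \<open>simp add: bfs_measure_def\<close>)
qed

lemma bfs_scan:
  assumes inv: "bfs_inv as n s q qh qt cur ptr vis par dep" and "qh < qt" "ptr \<noteq> 0"
    and l: "linked as hp nx tg"
  shows "vis (tg ptr) \<noteq> 0 \<Longrightarrow> bfs_inv as n s q qh qt cur (nx ptr) vis par dep"
    and "vis (tg ptr) = 0 \<Longrightarrow> set as \<subseteq> {..<n} \<times> {..<n} \<Longrightarrow>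
      bfs_inv as n s (q(qt := tg ptr)) qh (Suc qt) cur (nx ptr) (vis(tg ptr := 1)) (par(tg ptr := cur))
        (dep(tg ptr := Suc (dep cur)))"
    and "bfs_measure as n q qh qt cur (nx ptr) < bfs_measure as n q qh qt cur ptr"
    and "bfs_measure as n (q(qt := w)) qh (Suc qt) cur (nx ptr) < bfs_measure as n q qh qt cur ptr"
proof -
  have cur: "cur = q qh" and ptr: "pointer as cur ptr"
    and scanned: "\<And>j. j < length as \<Longrightarrow> fst (as ! j) = cur \<Longrightarrow> ptr \<le> j \<Longrightarrow> vis (snd (as ! j)) \<noteq> 0"
    using inv \<open>qh < qt\<close> by (auto simp: bfs_inv_def)
  note nxt = linked_next[OF l ptr \<open>ptr \<noteq> 0\<close>]
  have scanned': "vis (snd (as ! j)) \<noteq> 0 \<or> snd (as ! j) = tg ptr"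
    if "j < length as" "fst (as ! j) = cur" "nx ptr \<le> j" for j
    using scanned[OF that(1,2)] nxt(2) nxt(5)[OF that(3) _ that(2)] by (cases "ptr \<le> j") auto
  show "bfs_inv as n s q qh qt cur (nx ptr) vis par dep" if v: "vis (tg ptr) \<noteq> 0"
  proof -
    have "vis (snd (as ! j)) \<noteq> 0" if "j < length as" "fst (as ! j) = cur" "nx ptr \<le> j" for j
      using scanned'[OF that] v by auto
    then show ?thesis using inv nxt(3) unfolding bfs_inv_def by auto
  qed
  show "bfs_measure as n q qh qt cur (nx ptr) < bfs_measure as n q qh qt cur ptr"
    using \<open>qh < qt\<close> nxt(4) by (simp add: bfs_measure_def)
  have "(q(qt := w)) ` {..qh} = q ` {..qh}" using \<open>qh < qt\<close> by (intro image_cong) auto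
  then show "bfs_measure as n (q(qt := w)) qh (Suc qt) cur (nx ptr) < bfs_measure as n q qh qt cur ptr"
    using \<open>qh < qt\<close> nxt(4) by (simp add: bfs_measure_def)
  show "bfs_inv as n s (q(qt := tg ptr)) qh (Suc qt) cur (nx ptr) (vis(tg ptr := 1)) (par(tg ptr := cur))
        (dep(tg ptr := Suc (dep cur)))"
    if new: "vis (tg ptr) = 0" and range: "set as \<subseteq> {..<n} \<times> {..<n}"
  proof -
    let ?w = "tg ptr"
    have w: "?w < n" "(cur, ?w) \<in> set as" using nxt(1) range by auto
    have vis: "\<And>w. vis w \<noteq> 0 \<longleftrightarrow> w \<in> q ` {..<qt}" using inv by (simp add: bfs_inv_def)
    have fresh: "?w \<notin> q ` {..<qt}" using new vis by blast
    have ne: "q i \<noteq> ?w" if "i < qt" for i using fresh that by (metis imageI lessThan_iff)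
    have s: "s \<noteq> ?w" using ne[of 0] inv by (auto simp: bfs_inv_def)
    have img: "(q(qt := ?w)) ` {..<Suc qt} = insert ?w (q ` {..<qt})"
      by (auto simp: lessThan_Suc image_iff)
    have inj: "inj_on (q(qt := ?w)) {..<Suc qt}"
      using inv fresh by (auto simp: bfs_inv_def lessThan_Suc inj_on_def) (metis imageI lessThan_iff)+
    have tree: "\<exists>j<i. (par(?w := cur)) ((q(qt := ?w)) i) = (q(qt := ?w)) j \<and>
        (dep(?w := Suc (dep cur))) ((q(qt := ?w)) i) = Suc ((dep(?w := Suc (dep cur))) ((q(qt := ?w)) j)) \<and>
        ((q(qt := ?w)) j, (q(qt := ?w)) i) \<in> set as" if i: "0 < i" "i < Suc qt" for i
    proof (cases "i = qt")
      case True
      then show ?thesis using \<open>qh < qt\<close> cur w ne by (intro exI[of _ qh]) auto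
    next
      case False
      then have iq: "i < qt" using i by simp
      then obtain j where j: "j < i" "par (q i) = q j" "dep (q i) = Suc (dep (q j))" "(q j, q i) \<in> set as"
        using inv i unfolding bfs_inv_def by blast
      then show ?thesis using ne[of i] ne[of j] iq by (intro exI[of _ j]) auto
    qed
    have depq: "(dep(?w := Suc (dep cur))) ((q(qt := ?w)) i) \<le> i" if "i < Suc qt" for i
    proof (cases "i = qt")
      case True
      have "dep cur \<le> qh" using inv \<open>qh < qt\<close> cur unfolding bfs_inv_def by blast
      then show ?thesis using True \<open>qh < qt\<close> by simp
    next
      case False
      then show ?thesis using that ne[of i] inv unfolding bfs_inv_def by auto
    qed
    have depn: "\<forall>v. (dep(?w := Suc (dep cur))) v \<le> n"
    proof -
      have "dep cur \<le> qh" using inv \<open>qh < qt\<close> cur unfolding bfs_inv_def by blast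
      then have "Suc (dep cur) \<le> n" using bfs_qt_le[OF inv] \<open>qh < qt\<close> by simp
      then show ?thesis using inv by (auto simp: bfs_inv_def)
    qed
    have "q qh \<noteq> ?w" using ne \<open>qh < qt\<close> by blast
    show ?thesis
      unfolding bfs_inv_def
    proof (intro conjI)
      show "(q(qt := ?w)) ` {..<Suc qt} \<subseteq> {..<n}" using img w inv by (auto simp: bfs_inv_def)
      show "\<forall>v. (vis(?w := 1)) v \<noteq> 0 \<longleftrightarrow> v \<in> (q(qt := ?w)) ` {..<Suc qt}" using img vis by auto
      show "\<forall>i<qh. \<forall>y. ((q(qt := ?w)) i, y) \<in> set as \<longrightarrow> (vis(?w := 1)) y \<noteq> 0"
        using inv \<open>qh < qt\<close> by (auto simp: bfs_inv_def)
      show "qh < Suc qt \<longrightarrow> cur = (q(qt := ?w)) qh \<and> pointer as cur (nx ptr) \<and>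
        (\<forall>j<length as. fst (as ! j) = cur \<and> nx ptr \<le> j \<longrightarrow> (vis(?w := 1)) (snd (as ! j)) \<noteq> 0)"
        using cur nxt(3) scanned' \<open>qh < qt\<close> by auto
    qed (use inv inj tree depq depn s in \<open>auto simp: bfs_inv_def\<close>)
  qed
qed

text \<open>Registers 1 to 4 hold \<open>n\<close>, \<open>m\<close>, \<open>s\<close>, \<open>t\<close>. Arrays 1 to 3 hold the linked adjacency lists,
  4 the queue, 5 parents, 6 depths and 7 the visited flags.\<close>

definition load_edge :: com where
  "load_edge = seqs [Add 6 (Reg 5) (Reg 5), Add 6 (Reg 6) (Const 4), Load 7 0 (Reg 6),
     Add 6 (Reg 6) (Const 1), Load 8 0 (Reg 6)]"

text \<open>The four header words shift edge \<open>k\<close> to the addresses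
  \<open>2 * k + 4\<close> and \<open>2 * k + 5\<close>, which are formed by additions since the
  machine cannot multiply.\<close>

lemma wp_load_edge:
  assumes "a 0 = inp" "eu = (\<lambda>k. inp (k + k + 4))" "ew = (\<lambda>k. inp (k + k + 5))" "2 * r 5 + 5 < W"
  shows "wp W load_edge Q (r, a) = Q (r(7 := eu (r 5), 6 := 2 * r 5 + 5, 8 := ew (r 5)), a)"
proof -
  have "r 5 + r 5 + 4 + 1 < W" "r 5 + r 5 + 4 + 1 = r 5 + r 5 + 5" using assms(4) by simp_all
  then show ?thesis using assms(1) unfolding assms(2,3) load_edge_def by (simp add: add.commute)
qed

definition build_adjacency :: com where
  "build_adjacency = Seq (seqs [Assign 5 (Const 0), Assign 10 (Const 0)])
     (While (Less (Reg 5) (Reg 2)) (seqs [load_edge, addarc 1 2 3 10 7 8 9, addarc 1 2 3 10 8 7 9,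
       Add 5 (Reg 5) (Const 1)]))"

definition bfs_init :: com where
  "bfs_init = seqs [Store 7 (Reg 3) (Const 1), Store 5 (Reg 3) (Reg 3), Store 4 (Const 0) (Reg 3),
     Assign 11 (Const 0), Assign 12 (Const 1), Assign 13 (Reg 3), Load 14 1 (Reg 3)]"

definition bfs_body :: com where
  "bfs_body = Cond (Equal (Reg 14) (Const 0))
     (seqs [Add 11 (Reg 11) (Const 1), Load 13 4 (Reg 11), Load 14 1 (Reg 13)])
     (seqs [Load 7 3 (Reg 14), Load 14 2 (Reg 14), Load 8 7 (Reg 7),
        Cond (Equal (Reg 8) (Const 0))
          (seqs [Store 7 (Reg 7) (Const 1), Store 5 (Reg 7) (Reg 13), Load 9 6 (Reg 13),
             Add 9 (Reg 9) (Const 1), Store 6 (Reg 7) (Reg 9), Store 4 (Reg 12) (Reg 7),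
             Add 12 (Reg 12) (Const 1)])
          Skip])"

definition arc_list :: "(nat \<Rightarrow> nat) \<Rightarrow> (nat \<Rightarrow> nat) \<Rightarrow> nat \<Rightarrow> (nat \<times> nat) list" where
  "arc_list eu ew k = concat (map (\<lambda>j. [(eu j, ew j), (ew j, eu j)]) [0..<k])"

lemma arc_list_Suc: "arc_list eu ew (Suc k) = (arc_list eu ew k @ [(eu k, ew k)]) @ [(ew k, eu k)]"
  by (simp add: arc_list_def)

lemma length_arc_list: "length (arc_list eu ew k) = 2 * k"
  by (induction k) (auto simp: arc_list_Suc, simp add: arc_list_def)

lemma set_arc_list: "set (arc_list eu ew k) = (\<Union>j<k. {(eu j, ew j), (ew j, eu j)})"
  by (auto simp: arc_list_def)

lemma build_adjacency_runs:
  fixes inp :: "nat \<Rightarrow> nat"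
  assumes b: "bounded W (r, a)" and W: "2 * m + 16 < W"
    and pre: "r 2 = m" "a 0 = inp" "a 1 = (\<lambda>_. 0)"
    and eu: "eu = (\<lambda>k. inp (k + k + 4))" and ew: "ew = (\<lambda>k. inp (k + k + 5))"
  shows "runs W build_adjacency (20 * m + 3) (\<lambda>(r, a). linked (arc_list eu ew m) (a 1) (a 2) (a 3)) (r, a)"
  unfolding build_adjacency_def
proof (rule runs_loop[OF b, where I = "\<lambda>r a. r 2 = m \<and> a 0 = inp \<and> r 5 \<le> m \<and> r 10 = 2 * r 5 \<and>
      linked (arc_list eu ew (r 5)) (a 1) (a 2) (a 3)"
    and \<mu> = "\<lambda>r a. m - r 5" and K = m], goal_cases)
  case (2 r a)
  have lt: "r 5 < m" using 2 by simp
  have "linked (arc_list eu ew (Suc (r 5)))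
      ((a 1)(eu (r 5) := Suc (2 * r 5), ew (r 5) := Suc (Suc (2 * r 5))))
      ((a 2)(Suc (2 * r 5) := a 1 (eu (r 5)), Suc (Suc (2 * r 5)) := ((a 1)(eu (r 5) := Suc (2 * r 5))) (ew (r 5))))
      ((a 3)(Suc (2 * r 5) := ew (r 5), Suc (Suc (2 * r 5)) := eu (r 5)))"
    unfolding arc_list_Suc using 2 by (intro linked_snoc) (auto simp: length_arc_list)
  then show ?case using 2 lt W by (simp add: load_edge_def addarc_def eu ew add_ac)
qed (use pre W in \<open>auto simp: arc_list_def linked_Nil load_edge_def addarc_def\<close>)

definition search_tree :: "(nat \<times> nat) list \<Rightarrow> nat \<Rightarrow> nat \<Rightarrow> (nat \<Rightarrow> nat) \<Rightarrow> nat \<Rightarrow> (nat \<Rightarrow> nat) \<Rightarrow>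
    (nat \<Rightarrow> nat) \<Rightarrow> bool" where
  "search_tree as n s q N par dep \<longleftrightarrow>
     1 \<le> N \<and> N \<le> n \<and> inj_on q {..<N} \<and> q ` {..<N} \<subseteq> {..<n} \<and> q 0 = s \<and> par s = s \<and> dep s = 0 \<and>
     (\<forall>i. 0 < i \<and> i < N \<longrightarrow> (\<exists>j<i. par (q i) = q j \<and> dep (q i) = Suc (dep (q j)) \<and> (q j, q i) \<in> set as)) \<and>
     (\<forall>i<N. dep (q i) \<le> i) \<and> (\<forall>w. dep w \<le> n) \<and>
     (\<forall>i<N. \<forall>y. (q i, y) \<in> set as \<longrightarrow> y \<in> q ` {..<N})"

text \<open>The root counts as popped from the start, so its arcs appear in the chain term instead
  of the sum; altogether every vertex and every arc counts at most once.\<close>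

lemma bfs_init_measure:
  assumes "q 0 = s" "s < n" "linked as hp nx tg"
  shows "bfs_measure as n q 0 1 s (hp s) \<le> n + length as"
proof -
  have "Suc (out_arcs as s) + (\<Sum>v\<in>{..<n} - {s}. Suc (out_arcs as v)) = (\<Sum>v<n. Suc (out_arcs as v))"
    using assms(2) by (simp add: sum.remove[of "{..<n}" s])
  also have "\<dots> = n + (\<Sum>v<n. out_arcs as v)" by (simp add: sum_Suc)
  also have "\<dots> \<le> n + length as" using sum_count_arcs[of "{..<n}" as "length as"] by simp
  finally show ?thesis using assms linked_hd(2)[OF assms(3), of s] by (simp add: bfs_measure_def)
qed

lemma bfs_runs:
  assumes b: "bounded W (r, a)" and W: "n + 16 < W" and s: "s < n" "r 3 = s"
    and as: "linked as (a 1) (a 2) (a 3)" "set as \<subseteq> {..<n} \<times> {..<n}"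
    and zero: "a 6 = (\<lambda>_. 0)" "a 7 = (\<lambda>_. 0)"
  shows "runs W (Seq bfs_init (While (Less (Reg 11) (Reg 12)) bfs_body)) (20 * (n + length as) + 20)
    (\<lambda>(r, a). search_tree as n s (a 4) (r 12) (a 5) (a 6)) (r, a)"
proof (rule runs_loop[OF b, where I = "\<lambda>r a. linked as (a 1) (a 2) (a 3) \<and>
      bfs_inv as n s (a 4) (r 11) (r 12) (r 13) (r 14) (a 7) (a 5) (a 6)"
    and \<mu> = "\<lambda>r a. bfs_measure as n (a 4) (r 11) (r 12) (r 13) (r 14)" and K = "n + length as"], goal_cases)
  case 1
  have "bfs_inv as n s ((a 4)(0 := s)) 0 1 s (a 1 s) ((a 7)(s := 1)) ((a 5)(s := s)) (a 6)"
    using s linked_hd(1,3)[OF as(1), of s] zero by (auto simp: bfs_inv_def lessThan_Suc)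
  then show ?case
    using s as bfs_init_measure[of "(a 4)(0 := s)" s n as "a 1" "a 2" "a 3"] W
    by (simp add: bfs_init_def)
next
  case (2 r a)
  then have lt: "r 11 < r 12" and l: "linked as (a 1) (a 2) (a 3)"
    and inv: "bfs_inv as n s (a 4) (r 11) (r 12) (r 13) (r 14) (a 7) (a 5) (a 6)" by auto
  have qt: "r 12 \<le> n" using bfs_qt_le[OF inv] .
  have dep: "a 6 (r 13) \<le> n" using inv by (simp add: bfs_inv_def)
  show ?case
  proof (cases "r 14 = 0")
    case True
    then show ?thesis using bfs_pop[of as n s "a 4" "r 11" "r 12" "r 13" "a 7" "a 5" "a 6", OF _ lt l] inv l lt qt W
      by (simp add: bfs_body_def)
  next
    case False
    show ?thesis
      using False bfs_scan[OF inv lt False l] as(2) l lt qt dep W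
      by (cases "a 7 (a 3 (r 14)) = 0") (simp_all add: bfs_body_def)
  qed
next
  case (3 r a)
  then have "r 11 = r 12" by (simp add: bfs_inv_def)
  then have inv: "bfs_inv as n s (a 4) (r 12) (r 12) (r 13) (r 14) (a 7) (a 5) (a 6)" using 3 by simp
  have "a 7 w \<noteq> 0 \<longleftrightarrow> w \<in> a 4 ` {..<r 12}" for w using inv unfolding bfs_inv_def by blast
  moreover have "a 7 y \<noteq> 0" if "i < r 12" "(a 4 i, y) \<in> set as" for i y
    using inv that unfolding bfs_inv_def by blast
  ultimately have closed: "\<forall>i<r 12. \<forall>y. (a 4 i, y) \<in> set as \<longrightarrow> y \<in> a 4 ` {..<r 12}" by blast
  show ?case
    unfolding search_tree_def using closed bfs_qt_le[OF inv] inv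
    unfolding bfs_inv_def by (elim conjE, intro conjI) assumption+
qed (simp add: bfs_init_def bfs_body_def)

section \<open>Subtree sums\<close>

text \<open>The backward sweep over the queue meets children before parents, so an entry is a
  complete subtree sum when it is added to the parent. The loop stops after index 1 because the root
  has no parent to add to.\<close>

definition accumulate :: "nat \<Rightarrow> com" where
  "accumulate A = Seq (Assign 5 (Reg 12)) (While (Less (Const 1) (Reg 5))
     (seqs [Sub 5 (Reg 5) (Const 1), Load 6 4 (Reg 5), Load 7 5 (Reg 6), Load 8 A (Reg 6),
        Load 9 A (Reg 7), Add 9 (Reg 9) (Reg 8), Store A (Reg 7) (Reg 9)]))"

locale queued_cactus = rooted_cactus +
  fixes q :: "nat \<Rightarrow> nat" and N :: nat
  assumes N_pos: "1 \<le> N" and R_queue: "R = q ` {..<N}" and inj_q: "inj_on q {..<N}" and q_0: "q 0 = s"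
    and par_queue: "0 < i \<Longrightarrow> i < N \<Longrightarrow> par (q i) \<in> q ` {..<i}"
begin

definition subtree_sum :: "(nat \<Rightarrow> nat) \<Rightarrow> nat \<Rightarrow> nat" where
  "subtree_sum g v = sum g (sub v)"

lemma q_eq_iff: "i < N \<Longrightarrow> j < N \<Longrightarrow> q i = q j \<longleftrightarrow> i = j"
  using inj_on_eq_iff[OF inj_q, of i j] by simp

lemma q_R: "i < N \<Longrightarrow> q i \<in> R" by (simp add: R_queue)

lemma q_s: "i < N \<Longrightarrow> q i = s \<longleftrightarrow> i = 0"
  using q_eq_iff[of i 0] N_pos q_0 by simp

lemma finite_sub: "v \<in> R \<Longrightarrow> finite (sub v)"
proof -
  assume "v \<in> R"
  then have "sub v \<subseteq> {..<n}" using sub_R R_sub by blast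
  then show ?thesis by (rule finite_subset) simp
qed

text \<open>Subtrees of distinct children are disjoint. Children are indexed by their queue
  positions, from 1 on, because that is how the sweep meets them.\<close>

lemma subtree_sum_rec:
  "subtree_sum g v = g v + (\<Sum>j | 1 \<le> j \<and> j < N \<and> par (q j) = v. subtree_sum g (q j))"
proof -
  let ?J = "{j. 1 \<le> j \<and> j < N \<and> par (q j) = v}"
  have child: "q j \<in> R" "q j \<noteq> s" "par (q j) = v" if "j \<in> ?J" for j
    using that q_R q_s by auto
  have "sub v = insert v (\<Union>j\<in>?J. sub (q j))"
  proof (intro set_eqI iffI)
    fix u assume u: "u \<in> sub v"
    show "u \<in> insert v (\<Union>j\<in>?J. sub (q j))"
    proof (cases "u = v")
      case False
      obtain c where c: "c \<in> R" "c \<noteq> s" "par c = v" "u \<in> sub c" using sub_child[OF u False] by blast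
      then obtain j where "j < N" "c = q j" by (auto simp: R_queue)
      then have "j \<in> ?J" using c q_0 by (cases j) auto
      then show ?thesis using c \<open>c = q j\<close> by blast
    qed simp
  next
    fix u assume "u \<in> insert v (\<Union>j\<in>?J. sub (q j))"
    then consider "u = v" | j where "j \<in> ?J" "u \<in> sub (q j)" by blast
    then show "u \<in> sub v"
    proof cases
      case (2 j)
      then show ?thesis using sub_trans[OF 2(2)] sub_par[of "q j"] child[OF 2(1)] by simp
    qed simp
  qed
  moreover have "v \<notin> sub (q j)" if "j \<in> ?J" for j
    using par_notin_sub[of "q j"] child[OF that] by simp
  moreover have "finite ?J" by simp
  moreover have "finite (sub (q j))" if "j \<in> ?J" for j using finite_sub child[OF that] by blast
  moreover have "sub (q i) \<inter> sub (q j) = {}" if "i \<in> ?J" "j \<in> ?J" "i \<noteq> j" for i j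
  proof -
    have "q i \<noteq> q j" using that q_eq_iff[of i j] by simp
    then have "u \<notin> sub (q j)" if "u \<in> sub (q i)" for u
      using siblings_disjoint[of "q i" "q j" u] child[OF \<open>i \<in> ?J\<close>] child[OF \<open>j \<in> ?J\<close>] that by auto
    then show ?thesis by blast
  qed
  ultimately show ?thesis
    unfolding subtree_sum_def by (simp add: sum.UNION_disjoint)
qed

definition acc_inv :: "(nat \<Rightarrow> nat) \<Rightarrow> nat \<Rightarrow> (nat \<Rightarrow> nat) \<Rightarrow> bool" where
  "acc_inv g i h \<longleftrightarrow> 1 \<le> i \<and> i \<le> N \<and>
     (\<forall>v. h v = g v + (\<Sum>j | i \<le> j \<and> j < N \<and> par (q j) = v. subtree_sum g (q j)))"

lemma acc_inv_start: "acc_inv g N g"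
  using N_pos by (auto simp: acc_inv_def intro!: sum.neutral)

lemma acc_inv_finish: "acc_inv g 1 h \<Longrightarrow> h = subtree_sum g"
proof
  fix v assume "acc_inv g 1 h"
  then show "h v = subtree_sum g v"
    using subtree_sum_rec[of g v] by (simp add: acc_inv_def)
qed

lemma acc_inv_step:
  assumes inv: "acc_inv g (Suc i) h" and i: "1 \<le> i"
  shows "acc_inv g i (h(par (q i) := h (par (q i)) + h (q i)))"
    and "h (par (q i)) + h (q i) \<le> sum g R"
proof -
  have iN: "i < N" using inv by (simp add: acc_inv_def)
  have "{j. Suc i \<le> j \<and> j < N \<and> par (q j) = q i} = {j. 1 \<le> j \<and> j < N \<and> par (q j) = q i}"
  proof -
    \<comment> \<open>A parent has a smaller queue position than its child, so all children of
      \<open>q i\<close> have been added before \<open>q i\<close> is passed on.\<close>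
    have "Suc i \<le> j" if j: "1 \<le> j" "j < N" "par (q j) = q i" for j
    proof -
      obtain l where "l < j" "par (q j) = q l" using par_queue[of j] j by auto
      then show ?thesis using q_eq_iff[of i l] iN j by simp
    qed
    then show ?thesis using i by auto
  qed
  then have full: "h (q i) = subtree_sum g (q i)"
    using inv subtree_sum_rec[of g "q i"] by (simp add: acc_inv_def)
  have new: "{j. i \<le> j \<and> j < N \<and> par (q j) = v} =
      (if v = par (q i) then insert i {j. Suc i \<le> j \<and> j < N \<and> par (q j) = v}
       else {j. Suc i \<le> j \<and> j < N \<and> par (q j) = v})" for v
    using iN by (auto simp: Suc_le_eq order_le_less)
  show *: "acc_inv g i (h(par (q i) := h (par (q i)) + h (q i)))"
    using inv i full unfolding acc_inv_def new by auto
  \<comment> \<open>Every intermediate value is part of a subtree sum, hence at most the total over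
    \<open>R\<close>; this keeps the additions within the word size.\<close>
  let ?p = "par (q i)"
  have "h ?p + h (q i) = g ?p + (\<Sum>j | i \<le> j \<and> j < N \<and> par (q j) = ?p. subtree_sum g (q j))"
    using * unfolding acc_inv_def by (metis fun_upd_same)
  also have "\<dots> \<le> g ?p + (\<Sum>j | 1 \<le> j \<and> j < N \<and> par (q j) = ?p. subtree_sum g (q j))"
    using i by (intro add_left_mono sum_mono2) auto
  also have "\<dots> = subtree_sum g ?p" by (simp add: subtree_sum_rec[of g ?p])
  also have "\<dots> \<le> sum g R"
    unfolding subtree_sum_def using par_R[OF q_R[OF iN]] q_s[OF iN] i sub_R R_sub
    by (intro sum_mono2 finite_subset[of R "{..<n}"]) auto
  finally show "h ?p + h (q i) \<le> sum g R" .
qed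

lemma accumulate_runs:
  assumes b: "bounded W (r, a)" and W: "sum g R + 16 < W"
    and pre: "a 4 = q" "a 5 = par" "r 12 = N" "a A = g" "A \<noteq> 4" "A \<noteq> 5"
  shows "runs W (accumulate A) (8 * N + 3) (\<lambda>(r, a). a A = subtree_sum g) (r, a)"
  unfolding accumulate_def
proof (rule runs_loop[OF b, where I = "\<lambda>r a. a 4 = q \<and> a 5 = par \<and> acc_inv g (r 5) (a A)"
    and \<mu> = "\<lambda>r a. r 5" and K = N], goal_cases)
  case (2 r a)
  obtain i where i: "r 5 = Suc i" "1 \<le> i" using 2 by (cases "r 5") auto
  have inv: "acc_inv g (Suc i) (a A)" using 2 i by simp
  show ?case using 2 i acc_inv_step[OF inv i(2)] W pre by (simp add: add.commute)
next
  case (3 r a)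
  then have "r 5 = 1" by (simp add: acc_inv_def)
  then show ?case using acc_inv_finish[of g "a A"] 3 by simp
qed (use pre acc_inv_start N_pos in auto)

end

section \<open>Marks, bases and weights\<close>

text \<open>Array 8 holds the marks of the vertices above \<open>t\<close>, 9 the bases, 10 and 11 the weights
  of tails and heads, 12 the base of the head of each relevant edge.\<close>

definition mark_com :: com where
  "mark_com = Seq (Store 8 (Reg 4) (Const 1)) (accumulate 8)"

definition base_com :: com where
  "base_com = Seq (seqs [Add 15 (Reg 1) (Reg 1), Assign 5 (Const 1)])
     (While (Less (Reg 5) (Reg 12))
       (seqs [Load 6 4 (Reg 5), Load 7 5 (Reg 6), Load 8 9 (Reg 7), Load 9 8 (Reg 6),
          Cond (Equal (Reg 9) (Const 0)) Skip (Add 8 (Reg 8) (Reg 15)), Store 9 (Reg 6) (Reg 8),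
          Add 5 (Reg 5) (Const 1)]))"

definition put_weight :: "nat \<Rightarrow> nat \<Rightarrow> nat \<Rightarrow> com" where
  "put_weight x y b = seqs [Load 19 10 (Reg x), Add 19 (Reg 19) (Reg 18), Store 10 (Reg x) (Reg 19),
     Load 19 11 (Reg y), Add 19 (Reg 19) (Reg 18), Store 11 (Reg y) (Reg 19), Store 12 (Reg 5) (Reg b)]"

definition weight_com :: com where
  "weight_com = Seq (Assign 5 (Const 0))
     (While (Less (Reg 5) (Reg 2))
       (seqs [load_edge, Load 9 9 (Reg 7), Load 10 9 (Reg 8), Load 16 5 (Reg 7), Load 17 5 (Reg 8),
          Add 18 (Reg 5) (Const 1),
          Cond (Equal (Reg 9) (Reg 10)) Skip (Cond (Equal (Reg 16) (Reg 8)) Skip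
            (Cond (Equal (Reg 17) (Reg 7)) Skip
              (Cond (Less (Reg 9) (Reg 10)) (put_weight 7 8 10) (put_weight 8 7 9)))),
          Add 5 (Reg 5) (Const 1)]))"

lemma sum_fibres:
  assumes "finite S" "finite {k. P k}"
  shows "(\<Sum>u\<in>S. \<Sum>k | P k \<and> f k = u. h k) = (\<Sum>k | P k \<and> f k \<in> S. h k)"
proof -
  have "{k. P k \<and> f k \<in> S} = (\<Union>u\<in>S. {k. P k \<and> f k = u})" by auto
  moreover have "finite {k. P k \<and> f k = u}" for u
    by (rule finite_subset[OF _ assms(2)]) auto
  moreover have "{k. P k \<and> f k = u} \<inter> {k. P k \<and> f k = w} = {}" if "u \<noteq> w" for u w
    using that by auto
  ultimately show ?thesis using sum.UNION_disjoint[of S "\<lambda>u. {k. P k \<and> f k = u}" h] assms(1)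
    by (simp only:) auto
qed

context queued_cactus
begin

text \<open>The tree path to \<open>t\<close> is found as the subtree sums of the indicator of
  \<open>t\<close>, by the same sweep as the weights.\<close>

lemma mark_sum: "subtree_sum ((\<lambda>_. 0)(t := 1)) v = (if t \<in> sub v then 1 else 0)"
proof -
  have "finite (sub v)" using finite_sub sub_unreached by (cases "v \<in> R") auto
  then show ?thesis by (simp add: subtree_sum_def sum.delta fun_upd_def)
qed

lemma mark_runs:
  assumes b: "bounded W (r, a)" and W: "32 < W"
    and pre: "a 4 = q" "a 5 = par" "r 12 = N" "a 8 = (\<lambda>_. 0)" "r 4 = t"
  shows "runs W mark_com (8 * N + 4) (\<lambda>(r, a). a 8 = (\<lambda>v. if t \<in> sub v then 1 else 0)) (r, a)"
proof -
  have "runs W (Seq (Store 8 (Reg 4) (Const 1)) (accumulate 8)) (1 + (8 * N + 3))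
    (\<lambda>(r, a). a 8 = (\<lambda>v. if t \<in> sub v then 1 else 0)) (r, a)"
  proof (rule runs_Seq[OF runs_wp[OF b, where Q = "\<lambda>(r, a). a 4 = q \<and> a 5 = par \<and> r 12 = N \<and>
      a 8 = (\<lambda>_. 0)(t := 1)"] b])
    fix \<tau> assume \<tau>: "bounded W \<tau>" "case \<tau> of (r, a) \<Rightarrow> a 4 = q \<and> a 5 = par \<and> r 12 = N \<and> a 8 = (\<lambda>_. 0)(t := 1)"
    obtain r' a' where ra: "\<tau> = (r', a')" by (cases \<tau>)
    have "finite R" using R_sub finite_subset by blast
    then have "sum ((\<lambda>_. 0)(t := 1)) R \<le> (1 :: nat)" by (simp add: fun_upd_def sum.delta)
    then have "runs W (accumulate 8) (8 * N + 3) (\<lambda>(r, a). a 8 = subtree_sum ((\<lambda>_. 0)(t := 1))) (r', a')"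
      using \<tau> ra W by (intro accumulate_runs) auto
    moreover have "subtree_sum ((\<lambda>_. 0)(t := 1)) = (\<lambda>v. if t \<in> sub v then 1 else 0)"
      by (rule ext) (rule mark_sum)
    ultimately show "runs W (accumulate 8) (8 * N + 3) (\<lambda>(r, a). a 8 = (\<lambda>v. if t \<in> sub v then 1 else 0)) \<tau>"
      unfolding ra by (simp only:)
  qed (use pre W in auto)
  then show ?thesis unfolding mark_com_def by (rule runs_mono) auto
qed

text \<open>The bound by the queue index keeps all bases at most \<open>2 * n * n\<close>, within a
  word.\<close>

definition base_inv :: "nat \<Rightarrow> nat \<Rightarrow> (nat \<Rightarrow> nat) \<Rightarrow> bool" where
  "base_inv t i h \<longleftrightarrow> 1 \<le> i \<and> i \<le> N \<and> h s = 0 \<and> (\<forall>v. v \<notin> q ` {..<i} \<longrightarrow> h v = 0) \<and>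
     (\<forall>j. 0 < j \<and> j < i \<longrightarrow> h (q j) = h (par (q j)) + (if t \<in> sub (q j) then 2 * n else 0)) \<and>
     (\<forall>j<i. h (q j) \<le> 2 * n * j)"

lemma base_inv_start: "base_inv t 1 (\<lambda>_. 0)"
  using N_pos by (simp add: base_inv_def)

lemma base_inv_step:
  assumes inv: "base_inv t i h" and i: "i < N"
  shows "base_inv t (Suc i) (h(q i := h (par (q i)) + (if t \<in> sub (q i) then 2 * n else 0)))"
    and "h (par (q i)) + 2 * n \<le> 2 * n * i"
proof -
  have i1: "0 < i" using inv by (simp add: base_inv_def)
  obtain l where l: "l < i" "par (q i) = q l" using par_queue[OF i1 i] by auto
  have "h (q l) \<le> 2 * n * l" using inv l by (simp add: base_inv_def)
  then have "h (q l) + 2 * n \<le> 2 * n * Suc l" by simp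
  also have "\<dots> \<le> 2 * n * i" using l by (intro mult_le_mono2) simp
  finally show bound: "h (par (q i)) + 2 * n \<le> 2 * n * i" using l by simp
  let ?h = "h(q i := h (par (q i)) + (if t \<in> sub (q i) then 2 * n else 0))"
  have old: "?h (q j) = h (q j)" if "j < i" for j
    using q_eq_iff[of j i] that i by simp
  have "?h (q j) = ?h (par (q j)) + (if t \<in> sub (q j) then 2 * n else 0)" if j: "0 < j" "j < Suc i" for j
  proof (cases "j = i")
    case True
    then show ?thesis using old[OF l(1)] l(2) by simp
  next
    case False
    then have ji: "j < i" using j by simp
    obtain l' where l': "l' < j" "par (q j) = q l'" using par_queue[of j] j i by auto
    have "h (q j) = h (par (q j)) + (if t \<in> sub (q j) then 2 * n else 0)"
      using inv j ji unfolding base_inv_def by blast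
    then show ?thesis using old[OF ji] old[of l'] l' ji by simp
  qed
  moreover have "?h (q j) \<le> 2 * n * j" if j: "j < Suc i" for j
  proof (cases "j = i")
    case True
    then show ?thesis using bound by simp
  next
    case False
    then show ?thesis using old[of j] j inv unfolding base_inv_def by auto
  qed
  moreover have "?h s = 0" using old[of 0] i1 q_0 inv by (simp add: base_inv_def)
  moreover have "?h v = 0" if "v \<notin> q ` {..<Suc i}" for v
  proof -
    have "v \<noteq> q i" "v \<notin> q ` {..<i}" using that by auto
    then show ?thesis using inv by (simp add: base_inv_def)
  qed
  ultimately show "base_inv t (Suc i) ?h"
    using i unfolding base_inv_def by auto
qed

definition base_spec :: "nat \<Rightarrow> (nat \<Rightarrow> nat) \<Rightarrow> bool" where
  "base_spec t h \<longleftrightarrow> h s = 0 \<and> (\<forall>v\<in>R. v \<noteq> s \<longrightarrow> h v = h (par v) + (if t \<in> sub v then 2 * n else 0)) \<and>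
     (\<forall>v. v \<notin> R \<longrightarrow> h v = 0) \<and> (\<forall>v. h v \<le> 2 * n * n)"

lemma N_le: "N \<le> n"
proof -
  have "q ` {..<N} \<subseteq> {..<n}" using R_sub R_queue by simp
  from card_inj_on_le[OF inj_q this] show ?thesis by simp
qed

lemma base_inv_finish:
  assumes "base_inv t N h"
  shows "base_spec t h"
proof -
  have unreached: "h v = 0" if "v \<notin> R" for v
  proof -
    have "v \<notin> q ` {..<N}" using that by (simp add: R_queue)
    then show ?thesis using assms unfolding base_inv_def by blast
  qed
  show ?thesis
    unfolding base_spec_def
  proof (intro conjI ballI allI impI)
    fix v assume v: "v \<in> R" "v \<noteq> s"
    then obtain j where j: "j < N" "v = q j" by (auto simp: R_queue)
    then have "0 < j" using v q_0 by (cases j) auto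
    then show "h v = h (par v) + (if t \<in> sub v then 2 * n else 0)"
      using assms j unfolding base_inv_def by blast
  next
    fix v
    show "h v \<le> 2 * n * n"
    proof (cases "v \<in> R")
      case True
      then obtain j where j: "j < N" "v = q j" by (auto simp: R_queue)
      then have "h v \<le> 2 * n * j" using assms by (simp add: base_inv_def)
      also have "\<dots> \<le> 2 * n * n" using j N_le by (intro mult_le_mono2) simp
      finally show ?thesis .
    next
      case False
      then show ?thesis using unreached by simp
    qed
  next
    show "h s = 0" using assms by (simp add: base_inv_def)
  qed (use unreached in blast)
qed

lemma base_runs:
  assumes b: "bounded W (r, a)" and W: "2 * n * n + 2 * n + 16 < W"
    and pre: "a 4 = q" "a 5 = par" "r 12 = N" "r 1 = n" "a 9 = (\<lambda>_. 0)"
      "a 8 = (\<lambda>v. if t \<in> sub v then 1 else 0)"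
  shows "runs W base_com (10 * N + 4) (\<lambda>(r, a). base_spec t (a 9)) (r, a)"
  unfolding base_com_def
proof (rule runs_loop[OF b, where I = "\<lambda>r a. a 4 = q \<and> a 5 = par \<and> r 12 = N \<and> r 15 = 2 * n \<and>
    a 8 = (\<lambda>v. if t \<in> sub v then 1 else 0) \<and> base_inv t (r 5) (a 9)"
    and \<mu> = "\<lambda>r a. N - r 5" and K = "N"], goal_cases)
  case (2 r a)
  then have lt: "r 5 < N" and inv: "base_inv t (r 5) (a 9)" by auto
  have "2 * n * r 5 \<le> 2 * n * n" using lt N_le by (intro mult_le_mono2) simp
  then have bd: "a 9 (par (q (r 5))) + 2 * n + n < W" using base_inv_step(2)[OF inv lt] W by linarith
  show ?case
    using 2 base_inv_step(1)[OF inv lt] lt bd N_le W by (cases "t \<in> sub (q (r 5))") simp_all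
next
  case (3 r a)
  then have "r 5 = N" by (simp add: base_inv_def)
  then show ?case using base_inv_finish 3 by simp
qed (use pre base_inv_start W in auto)

end

locale search_cactus = queued_cactus + target_cactus
begin

definition tail_weight :: "nat \<Rightarrow> nat \<Rightarrow> nat" where
  "tail_weight i v = (\<Sum>k | (rel k \<and> k < i) \<and> tail k = v. Suc k)"

definition head_weight :: "nat \<Rightarrow> nat \<Rightarrow> nat" where
  "head_weight i v = (\<Sum>k | (rel k \<and> k < i) \<and> head k = v. Suc k)"

lemma finite_rel_less: "finite {k. (rel k \<and> k < i) \<and> P k}"
  by (rule finite_subset[of _ "{..<m}"]) (auto simp: rel_def)

lemma weight_step:
  assumes "rel i"
  shows "tail_weight (Suc i) = (tail_weight i)(tail i := tail_weight i (tail i) + Suc i)"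
    "head_weight (Suc i) = (head_weight i)(head i := head_weight i (head i) + Suc i)"
proof -
  have *: "{k. (rel k \<and> k < Suc i) \<and> P k} =
      (if P i then insert i {k. (rel k \<and> k < i) \<and> P k} else {k. (rel k \<and> k < i) \<and> P k})" for P
    using assms by (auto simp: less_Suc_eq)
  show "tail_weight (Suc i) = (tail_weight i)(tail i := tail_weight i (tail i) + Suc i)"
  proof
    fix v show "tail_weight (Suc i) v = ((tail_weight i)(tail i := tail_weight i (tail i) + Suc i)) v"
      unfolding tail_weight_def *[of "\<lambda>k. tail k = v"]
      using finite_rel_less[of i "\<lambda>k. tail k = v"] by auto
  qed
  show "head_weight (Suc i) = (head_weight i)(head i := head_weight i (head i) + Suc i)"
  proof
    fix v show "head_weight (Suc i) v = ((head_weight i)(head i := head_weight i (head i) + Suc i)) v"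
      unfolding head_weight_def *[of "\<lambda>k. head k = v"]
      using finite_rel_less[of i "\<lambda>k. head k = v"] by auto
  qed
qed

lemma weight_skip:
  assumes "\<not> rel i"
  shows "tail_weight (Suc i) = tail_weight i" "head_weight (Suc i) = head_weight i"
proof -
  have *: "rel k \<and> k < Suc i \<longleftrightarrow> rel k \<and> k < i" for k
    using assms by (auto simp: less_Suc_eq)
  show "tail_weight (Suc i) = tail_weight i" "head_weight (Suc i) = head_weight i"
    unfolding tail_weight_def head_weight_def * by simp_all
qed

lemma sum_weights_le: "(\<Sum>k | rel k \<and> P k. Suc k) \<le> m * m"
proof -
  have "(\<Sum>k | rel k \<and> P k. Suc k) \<le> (\<Sum>k<m. Suc k)"
    by (rule sum_mono2) (auto simp: rel_def)
  also have "\<dots> \<le> (\<Sum>k<m. m)" by (rule sum_mono) simp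
  finally show ?thesis by simp
qed

lemma weight_le: "tail_weight i v \<le> m * m" "head_weight i v \<le> m * m"
  using sum_weights_le[of "\<lambda>k. k < i \<and> tail k = v"] sum_weights_le[of "\<lambda>k. k < i \<and> head k = v"]
  by (simp_all add: tail_weight_def head_weight_def conj_assoc)

lemma sum_weight_R: "sum (tail_weight m) R \<le> m * m" "sum (head_weight m) R \<le> m * m"
proof -
  have "finite R" using R_sub finite_subset by blast
  moreover have "finite {k. rel k \<and> k < m}" using finite_rel_less[of m "\<lambda>_. True"] by simp
  ultimately have fin: "finite R" "finite {k. rel k \<and> k < m}" by auto
  note fibres = sum_fibres[OF fin]
  show "sum (tail_weight m) R \<le> m * m" "sum (head_weight m) R \<le> m * m"
    unfolding tail_weight_def head_weight_def fibres
    using sum_weights_le[of "\<lambda>k. k < m \<and> tail k \<in> R"] sum_weights_le[of "\<lambda>k. k < m \<and> head k \<in> R"]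
    by (simp_all only: conj_assoc)
qed

text \<open>Summing the weights of single vertices over a subtree regroups the edges by the vertex
  to which they are charged.\<close>

lemma subtree_weights: "subtree_sum (tail_weight m) = PW" "subtree_sum (head_weight m) = MW"
proof -
  have fin: "finite (sub v)" for v using finite_sub sub_unreached by (cases "v \<in> R") auto
  have fin': "finite {k. rel k}" using finite_rel[of "\<lambda>_. True"] by simp
  have *: "rel k \<and> k < m \<longleftrightarrow> rel k" for k by (auto simp: rel_def)
  have tw: "tail_weight m = (\<lambda>v. \<Sum>k | rel k \<and> tail k = v. Suc k)"
    and hw: "head_weight m = (\<lambda>v. \<Sum>k | rel k \<and> head k = v. Suc k)"
    by (simp_all only: fun_eq_iff tail_weight_def head_weight_def *) simp_all
  show "subtree_sum (tail_weight m) = PW" "subtree_sum (head_weight m) = MW"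
    unfolding fun_eq_iff subtree_sum_def tw hw sum_fibres[OF fin fin'] PW_def MW_def by simp_all
qed

lemma weight_0: "tail_weight 0 = (\<lambda>_. 0)" "head_weight 0 = (\<lambda>_. 0)"
  by (simp_all add: tail_weight_def head_weight_def fun_eq_iff)

text \<open>Array 12 is specified at relevant edges only; by \<open>rel_of_weights\<close> it is
  read nowhere else.\<close>

lemma weight_runs:
  assumes b: "bounded W (r, a)" and W: "m * m + 2 * m + 16 < W"
    and pre: "r 2 = m" "a 0 = inp" "a 5 = par" "a 9 = base" "a 10 = (\<lambda>_. 0)" "a 11 = (\<lambda>_. 0)"
    and eu: "eu = (\<lambda>k. inp (k + k + 4))" and ew: "ew = (\<lambda>k. inp (k + k + 5))"
  shows "runs W weight_com (25 * m + 3) (\<lambda>(r, a). a 10 = tail_weight m \<and> a 11 = head_weight m \<and>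
    (\<forall>k. rel k \<longrightarrow> a 12 k = base (head k))) (r, a)"
  unfolding weight_com_def
proof (rule runs_loop[OF b, where I = "\<lambda>r a. r 2 = m \<and> a 0 = inp \<and> a 5 = par \<and> a 9 = base \<and> r 5 \<le> m \<and>
    a 10 = tail_weight (r 5) \<and> a 11 = head_weight (r 5) \<and> (\<forall>k<r 5. rel k \<longrightarrow> a 12 k = base (head k))"
    and \<mu> = "\<lambda>r a. m - r 5" and K = "m"], goal_cases)
  case (2 r a)
  define i where "i = r 5"
  have i: "i < m" "r 5 = i" using 2 by (auto simp: i_def)
  have load: "wp W load_edge Q (r, a) = Q (r(7 := eu i, 6 := 2 * i + 5, 8 := ew i), a)" for Q
    using wp_load_edge[OF _ eu ew, of a r W Q] 2 i W by simp
  have bd: "tail_weight i v + Suc i < W" "head_weight i v + Suc i < W" for v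
    using weight_le[of i v] W i by linarith+
  have hb: "\<forall>k<Suc i. rel k \<longrightarrow> ((a 12)(i := base (head i))) k = base (head k)"
    using 2 i by (auto simp: less_Suc_eq)
  have hb': "\<forall>k<Suc i. rel k \<longrightarrow> a 12 k = base (head k)" if "\<not> rel i"
    using 2 i that by (auto simp: less_Suc_eq)
  show ?case
  proof (cases "rel i")
    case True
    then have "base (eu i) \<noteq> base (ew i)" "par (eu i) \<noteq> ew i" "par (ew i) \<noteq> eu i"
      by (auto simp: rel_def tree_edge_def)
    then show ?thesis
      using 2 i W bd weight_step[OF True] hb
      by (cases "base (eu i) < base (ew i)")
        (simp_all add: put_weight_def load tail_def head_def add.commute)
  next
    case False
    then have "base (eu i) = base (ew i) \<or> par (eu i) = ew i \<or> par (ew i) = eu i"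
      using i by (auto simp: rel_def tree_edge_def)
    then show ?thesis
      using 2 i W weight_skip[OF False] hb'[OF False] by (auto simp add: load)
  qed
next
  case (3 r a)
  then have "r 5 = m" by simp
  then show ?case using 3 rel_less by auto
qed (use pre W weight_0 in \<open>auto simp: load_edge_def put_weight_def\<close>)

end

section \<open>Literals and clauses\<close>

text \<open>Arrays 13 and 14 hold the literals and positions of the vertices, 15 and 16 those of the
  edges. Register 20 holds \<open>Suc m\<close> and register 21 the false literal.\<close>

definition vlit_com :: com where
  "vlit_com = Seq (seqs [Add 20 (Reg 2) (Const 1), Add 21 (Reg 20) (Reg 2), Assign 5 (Const 0)])
     (While (Less (Reg 5) (Reg 1))
       (seqs [Load 6 8 (Reg 5), Load 7 10 (Reg 5), Load 8 11 (Reg 5), Load 9 9 (Reg 5), Load 16 6 (Reg 5),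
          Cond (Equal (Reg 7) (Reg 8))
            (seqs [Cond (Equal (Reg 6) (Const 0)) (Assign 17 (Reg 21)) (Assign 17 (Reg 2)),
               Add 18 (Reg 9) (Reg 16)])
            (Cond (Less (Reg 7) (Reg 8))
              (seqs [Sub 19 (Reg 8) (Reg 7), Sub 19 (Reg 19) (Const 1),
                 Cond (Equal (Reg 6) (Const 0))
                   (seqs [Assign 17 (Reg 19), Sub 18 (Reg 9) (Reg 16)])
                   (seqs [Load 22 12 (Reg 19),
                      Cond (Equal (Reg 22) (Reg 9)) (Assign 17 (Reg 2)) (Add 17 (Reg 20) (Reg 19)),
                      Add 18 (Reg 9) (Reg 16)])])
              (seqs [Sub 19 (Reg 7) (Reg 8), Sub 19 (Reg 19) (Const 1), Assign 17 (Reg 19),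
                 Add 18 (Reg 9) (Reg 16)])),
          Store 13 (Reg 5) (Reg 17), Store 14 (Reg 5) (Reg 18), Add 5 (Reg 5) (Const 1)]))"

definition tlit_com :: "nat \<Rightarrow> com" where
  "tlit_com x = seqs [Load 19 8 (Reg x),
     Cond (Equal (Reg 19) (Const 0)) (Load 18 13 (Reg x))
       (seqs [Load 9 10 (Reg x), Load 10 11 (Reg x),
          Cond (Equal (Reg 9) (Reg 10)) (Assign 18 (Reg 2))
            (seqs [Sub 10 (Reg 10) (Reg 9), Sub 10 (Reg 10) (Const 1), Add 18 (Reg 20) (Reg 10)])])]"

definition elit_com :: com where
  "elit_com = Seq (Assign 5 (Const 0))
     (While (Less (Reg 5) (Reg 2))
       (seqs [load_edge, Load 16 5 (Reg 7), Load 17 5 (Reg 8),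
          Cond (Equal (Reg 16) (Reg 8)) (tlit_com 7)
            (Cond (Equal (Reg 17) (Reg 7)) (tlit_com 8)
              (seqs [Load 9 9 (Reg 7), Load 10 9 (Reg 8),
                 Cond (Equal (Reg 9) (Reg 10)) (Assign 18 (Reg 21)) (Assign 18 (Reg 5))])),
          Load 9 14 (Reg 7), Load 10 14 (Reg 8), Cond (Less (Reg 9) (Reg 10)) Skip (Assign 9 (Reg 10)),
          Store 15 (Reg 5) (Reg 18), Store 16 (Reg 5) (Reg 9), Add 5 (Reg 5) (Const 1)]))"

context search_cactus
begin

text \<open>No relevant edge leaves the subtree of a tree path vertex. So the truncated difference
  in \<open>vlit\<close> and \<open>tlit\<close> is exact there, and the program needs no branch for
  the other sign.\<close>

lemma marked_PW_le: "t \<in> sub v \<Longrightarrow> PW v \<le> MW v"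
proof -
  assume t: "t \<in> sub v"
  from marked_R[OF t] show ?thesis
    by (cases rule: weight_cases) (use marked_not_out t in auto)
qed

text \<open>A difference of sums decodes to a genuine relevant edge, so that lookups under this
  index are meaningful and the index is below \<open>m\<close>.\<close>

lemma rel_of_weights: "PW v < MW v \<Longrightarrow> rel (MW v - PW v - 1)"
proof -
  assume less: "PW v < MW v"
  have "v \<in> R" using PW_unreached[of v] less by (cases "v \<in> R") auto
  then show ?thesis by (cases rule: weight_cases) (use less in auto)
qed

lemma vlit_runs:
  assumes b: "bounded W (r, a)" and W: "2 * n * n + 3 * n + 2 * m + 16 < W"
    and pre: "r 1 = n" "r 2 = m" "a 8 = (\<lambda>v. if t \<in> sub v then 1 else 0)" "a 9 = base" "a 10 = PW" "a 11 = MW"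
      "\<forall>k. rel k \<longrightarrow> a 12 k = base (head k)" "a 6 = dep"
    and base_le: "\<And>v. base v \<le> 2 * n * n" and dep_le: "\<And>v. dep v \<le> n"
  shows "runs W vlit_com (30 * n + 5) (\<lambda>(r, a). r 20 = Suc m \<and> r 21 = Suc m + m \<and>
    (\<forall>v<n. a 13 v = vlit v \<and> a 14 v = vpos v)) (r, a)"
  unfolding vlit_com_def
proof (rule runs_loop[OF b, where I = "\<lambda>r a. r 1 = n \<and> r 2 = m \<and> a 8 = (\<lambda>v. if t \<in> sub v then 1 else 0) \<and>
    a 9 = base \<and> a 10 = PW \<and> a 11 = MW \<and> (\<forall>k. rel k \<longrightarrow> a 12 k = base (head k)) \<and> a 6 = dep \<and>
    r 20 = Suc m \<and> r 21 = Suc m + m \<and> (\<forall>v<r 5. a 13 v = vlit v \<and> a 14 v = vpos v) \<and> r 5 \<le> n"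
    and \<mu> = "\<lambda>r a. n - r 5" and K = "n"], goal_cases)
  case (2 r a)
  define v where "v = r 5"
  have v: "r 5 = v" "v < n" using 2 by (auto simp: v_def)
  have bd: "base v + dep v < W" using base_le[of v] dep_le[of v] W by linarith
  have upd: "\<forall>u<Suc v. ((a 13)(v := vlit v)) u = vlit u \<and> ((a 14)(v := vpos v)) u = vpos u"
    using 2 v by (auto simp: less_Suc_eq)
  consider "PW v = MW v" | "PW v < MW v" "t \<in> sub v" "rel (MW v - PW v - 1)"
    | "PW v < MW v" "t \<notin> sub v" "rel (MW v - PW v - 1)" | "MW v < PW v" "t \<notin> sub v"
    using marked_PW_le[of v] rel_of_weights[of v] by linarith
  then show ?case
  proof cases
    case 1
    then show ?thesis using 2 v bd W upd by (cases "t \<in> sub v") (simp_all add: vlit_def vpos_def)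
  next
    case c: 2
    have "MW v - PW v - 1 < m" using c(3) rel_less by blast
    then have "Suc (m + MW v - Suc (PW v)) < W" using W c(1) by linarith
    then show ?thesis using 2 v bd W upd c
      by (cases "base (head (MW v - PW v - 1)) = base v") (simp_all add: vlit_def vpos_def)
  next
    case 3
    then show ?thesis using 2 v bd W upd by (simp add: vlit_def vpos_def)
  next
    case 4
    then show ?thesis using 2 v bd W upd by (simp add: vlit_def vpos_def)
  qed
qed (use pre W in auto)

text \<open>The branches leave different values in the scratch registers; quantifying over these
  values gives the callers one rule for all branches.\<close>

lemma wp_tlit_com:
  assumes "a 8 = (\<lambda>v. if t \<in> sub v then 1 else 0)" "a 10 = PW" "a 11 = MW" "r 20 = Suc m" "r 2 = m"
    "a 13 (r x) = vlit (r x)" "2 * m + 16 < W" "x = 7 \<or> x = 8"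
    "\<And>p9 p10 p19. Q (r(19 := p19, 9 := p9, 10 := p10, 18 := tlit (r x)), a)"
  shows "wp W (tlit_com x) Q (r, a)"
proof -
  define v where "v = r x"
  have v: "r x = v" by (simp add: v_def)
  have x: "x \<noteq> 19" "x \<noteq> 9" "x \<noteq> 10" "x \<noteq> 18" using assms(8) by auto
  have Q: "Q (r', a)" if "\<And>y. y \<notin> {9, 10, 18, 19} \<Longrightarrow> r' y = r y" "r' 18 = tlit v" for r'
  proof -
    have "r' = r(19 := r' 19, 9 := r' 9, 10 := r' 10, 18 := tlit v)"
      using that by (auto simp: fun_eq_iff)
    then show ?thesis using assms(9)[of "r' 19" "r' 9" "r' 10"] v by metis
  qed
  have "MW v - PW v - 1 < m" if "t \<in> sub v" "MW v \<noteq> PW v"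
    using rel_less[OF rel_of_weights[of v]] marked_PW_le[OF that(1)] that by auto
  then have bd: "Suc (m + MW v - Suc (PW v)) < W" if "t \<in> sub v" "MW v \<noteq> PW v"
    using assms(7) that marked_PW_le[OF that(1)] by force
  show ?thesis
  proof (cases "t \<in> sub v")
    case True
    show ?thesis
    proof (cases "MW v = PW v")
      case eq: True
      show ?thesis using assms(1-7) v x True eq unfolding tlit_com_def
        by (simp, intro Q) (simp_all add: tlit_def)
    next
      case ne: False
      show ?thesis using assms(1-7) v x True ne bd[OF True ne] marked_PW_le[OF True] unfolding tlit_com_def
        by (simp, intro Q) (simp_all add: tlit_def)
    qed
  next
    case False
    show ?thesis using assms(1-7) v x False unfolding tlit_com_def
      by (simp, intro Q) (simp_all add: tlit_def)
  qed
qed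

lemma elit_runs:
  assumes b: "bounded W (r, a)" and W: "2 * m + 16 < W"
    and pre: "r 2 = m" "a 0 = inp" "a 5 = par" "a 8 = (\<lambda>v. if t \<in> sub v then 1 else 0)" "a 9 = base"
      "a 10 = PW" "a 11 = MW" "r 20 = Suc m" "r 21 = Suc m + m" "\<forall>v<n. a 13 v = vlit v \<and> a 14 v = vpos v"
    and eu: "eu = (\<lambda>k. inp (k + k + 4))" and ew: "ew = (\<lambda>k. inp (k + k + 5))"
  shows "runs W elit_com (30 * m + 5) (\<lambda>(r, a). \<forall>k<m. a 15 k = elit k \<and> a 16 k = epos k) (r, a)"
  unfolding elit_com_def
proof (rule runs_loop[OF b, where I = "\<lambda>r a. r 2 = m \<and> a 0 = inp \<and> a 5 = par \<and>
    a 8 = (\<lambda>v. if t \<in> sub v then 1 else 0) \<and> a 9 = base \<and> a 10 = PW \<and> a 11 = MW \<and>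
    r 20 = Suc m \<and> r 21 = Suc m + m \<and> (\<forall>v<n. a 13 v = vlit v \<and> a 14 v = vpos v) \<and>
    (\<forall>k<r 5. a 15 k = elit k \<and> a 16 k = epos k) \<and> r 5 \<le> m"
    and \<mu> = "\<lambda>r a. m - r 5" and K = "m"], goal_cases)
  case (2 r a)
  define i where "i = r 5"
  have i: "r 5 = i" "i < m" using 2 by (auto simp: i_def)
  have load: "wp W load_edge Q (r, a) = Q (r(7 := eu i, 6 := 2 * i + 5, 8 := ew i), a)" for Q
    using wp_load_edge[OF _ eu ew, of a r W Q] 2 i W by simp
  have uw: "a 13 (eu i) = vlit (eu i)" "a 14 (eu i) = vpos (eu i)" "a 13 (ew i) = vlit (ew i)"
      "a 14 (ew i) = vpos (ew i)"
    using 2 ends_less[OF i(2)] by auto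
  have upd: "\<forall>k<Suc i. ((a 15)(i := elit i)) k = elit k \<and> ((a 16)(i := epos i)) k = epos k"
    using 2 i by (auto simp: less_Suc_eq)
  have epos: "epos i = (if vpos (eu i) < vpos (ew i) then vpos (eu i) else vpos (ew i))"
    by (auto simp: epos_def)
  consider "par (eu i) = ew i" "elit i = tlit (eu i)"
    | "par (eu i) \<noteq> ew i" "par (ew i) = eu i" "elit i = tlit (ew i)"
    | "par (eu i) \<noteq> ew i" "par (ew i) \<noteq> eu i" "elit i = (if base (eu i) \<noteq> base (ew i) then i else Suc m + m)"
    by (cases "par (eu i) = ew i"; cases "par (ew i) = eu i") (simp_all add: elit_def)
  then show ?case
  proof cases
    case 1
    show ?thesis using 2 1 i W uw upd epos
      by (cases "vpos (eu i) < vpos (ew i)") (simp_all add: load wp_tlit_com)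
  next
    case c: 2
    show ?thesis using 2 c i W uw upd epos
      by (cases "vpos (eu i) < vpos (ew i)") (simp_all add: load wp_tlit_com)
  next
    case 3
    then show ?thesis using 2 i W uw upd epos
      by (cases "vpos (eu i) < vpos (ew i)"; cases "base (eu i) = base (ew i)") (simp_all add: load)
  qed
qed (use pre W in \<open>auto simp: load_edge_def tlit_com_def\<close>)

end

definition neg_lit :: "nat \<Rightarrow> nat \<Rightarrow> nat" where
  "neg_lit M l = (if l < M then l + M else l - M)"

definition neg_com :: "nat \<Rightarrow> nat \<Rightarrow> com" where
  "neg_com x y = Cond (Less (Reg x) (Reg 20)) (Add y (Reg x) (Reg 20)) (Sub y (Reg x) (Reg 20))"

lemma wp_neg_com:
  assumes "r 20 = M" "r x < 2 * M" "2 * M \<le> W"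
  shows "wp W (neg_com x y) Q (r, a) = Q (r(y := neg_lit M (r x)), a)"
  using assms by (auto simp: neg_com_def neg_lit_def)

text \<open>Arrays 17 to 19 hold the linked lists of implications.\<close>

definition clause_init :: com where
  "clause_init = seqs [Assign 10 (Const 0), addarc 17 18 19 10 21 2 9, Add 5 (Reg 2) (Reg 2),
     Add 5 (Reg 5) (Const 4), Assign 6 (Const 0), Load 7 0 (Reg 5), Add 5 (Reg 5) (Const 1)]"

definition clause_body :: com where
  "clause_body = Cond (Equal (Reg 7) (Const 0))
     (seqs [Add 6 (Reg 6) (Const 1), Load 7 0 (Reg 5), Add 5 (Reg 5) (Const 1)])
     (seqs [Load 8 0 (Reg 5), Add 5 (Reg 5) (Const 1), Sub 7 (Reg 7) (Const 1),
        Load 13 13 (Reg 6), Load 14 14 (Reg 6), Load 16 15 (Reg 8), Load 17 16 (Reg 8),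
        Cond (Less (Reg 17) (Reg 14)) Skip
          (seqs [neg_com 13 18, neg_com 16 19, addarc 17 18 19 10 13 19 9, addarc 17 18 19 10 16 18 9])])"

definition clause_com :: com where
  "clause_com = Seq clause_init (While (Less (Reg 6) (Reg 1)) clause_body)"

text \<open>The clause that forbids \<open>vl v\<close> and \<open>el k\<close> together becomes two
  implications, each the contrapositive of the other.\<close>

definition clause_arcs :: "nat \<Rightarrow> (nat \<Rightarrow> nat) \<Rightarrow> (nat \<Rightarrow> nat) \<Rightarrow> (nat \<Rightarrow> nat) \<Rightarrow> (nat \<Rightarrow> nat) \<Rightarrow>
    (nat \<times> nat) set \<Rightarrow> (nat \<times> nat) set" where
  "clause_arcs M vl vp el ep S = {(vl v, neg_lit M (el k)) | v k. (v, k) \<in> S \<and> vp v \<le> ep k} \<union>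
     {(el k, neg_lit M (vl v)) | v k. (v, k) \<in> S \<and> vp v \<le> ep k}"

definition reads :: "(nat \<Rightarrow> nat) \<Rightarrow> nat \<Rightarrow> nat list \<Rightarrow> bool" where
  "reads inp z xs \<longleftrightarrow> (\<forall>i<length xs. inp (z + i) = xs ! i)"

lemma reads_Cons: "reads inp z (x # xs) \<longleftrightarrow> inp z = x \<and> reads inp (Suc z) xs"
  by (auto simp: reads_def nth_Cons split: nat.splits)

abbreviation encode_lists :: "nat list list \<Rightarrow> nat list" where
  "encode_lists fs \<equiv> concat (map (\<lambda>l. length l # l) fs)"

lemma clause_arcs_insert: "clause_arcs M vl vp el ep (insert (v, k) S) =
    (if vp v \<le> ep k then {(vl v, neg_lit M (el k)), (el k, neg_lit M (vl v))} else {}) \<union>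
    clause_arcs M vl vp el ep S"
  by (auto simp: clause_arcs_def)

definition scanned_pairs :: "nat list list \<Rightarrow> nat \<Rightarrow> nat list \<Rightarrow> (nat \<times> nat) set" where
  "scanned_pairs fs v pre = {(v', k). v' < v \<and> k \<in> set (fs ! v')} \<union> {v} \<times> set pre"

text \<open>The list of \<open>v\<close> is split into the processed part \<open>pre\<close> and the
  rest \<open>l\<close>, which starts at address \<open>z\<close>. Each entry may add two arcs; the
  words holding list lengths leave enough slack in the bound on \<open>c\<close> for the initial
  arc.\<close>

definition clause_inv :: "nat \<Rightarrow> nat \<Rightarrow> (nat \<Rightarrow> nat) \<Rightarrow> (nat \<Rightarrow> nat) \<Rightarrow> (nat \<Rightarrow> nat) \<Rightarrow> (nat \<Rightarrow> nat) \<Rightarrow>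
    (nat \<Rightarrow> nat) \<Rightarrow> nat list list \<Rightarrow> nat \<Rightarrow> nat \<Rightarrow> nat \<Rightarrow> nat \<Rightarrow> nat \<Rightarrow> nat list \<Rightarrow> nat list \<Rightarrow> (nat \<times> nat) list \<Rightarrow> bool" where
  "clause_inv m M vl vp el ep inp fs z_end v rem z c pre l as \<longleftrightarrow>
     c = length as \<and> set as = insert (M + m, m) (clause_arcs M vl vp el ep (scanned_pairs fs v pre)) \<and>
     v \<le> length fs \<and>
     (v < length fs \<longrightarrow> fs ! v = pre @ l \<and> rem = length l \<and> z + length l + length (encode_lists (drop (Suc v) fs)) = z_end \<and>
        reads inp z (l @ encode_lists (drop (Suc v) fs)) \<and> c + 2 * (length l + length (encode_lists (drop (Suc v) fs))) \<le> 2 * length (encode_lists fs)) \<and>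
     (v = length fs \<longrightarrow> pre = [] \<and> c \<le> 2 * length (encode_lists fs))"

lemma clause_inv_next:
  assumes inv: "clause_inv m M vl vp el ep inp fs z_end v 0 z c pre l as" and v: "v < length fs"
  shows "clause_inv m M vl vp el ep inp fs z_end (Suc v) (inp z) (Suc z) c []
      (if Suc v < length fs then fs ! Suc v else []) as"
    and "Suc v < length fs \<Longrightarrow> z < z_end" "z \<le> z_end"
proof -
  have l: "l = []" "fs ! v = pre" using inv v by (auto simp: clause_inv_def)
  have pairs: "scanned_pairs fs (Suc v) [] = scanned_pairs fs v pre"
    using l by (auto simp: scanned_pairs_def less_Suc_eq)
  have d: "drop (Suc v) fs = fs ! Suc v # drop (Suc (Suc v)) fs" if "Suc v < length fs"
    using that by (simp add: Cons_nth_drop_Suc)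
  have zz: "z + length (encode_lists (drop (Suc v) fs)) = z_end" using inv v l by (simp add: clause_inv_def)
  then show "z \<le> z_end" by simp
  show "z < z_end" if "Suc v < length fs" using zz d[OF that] by simp
  show "clause_inv m M vl vp el ep inp fs z_end (Suc v) (inp z) (Suc z) c []
      (if Suc v < length fs then fs ! Suc v else []) as"
  proof (cases "Suc v < length fs")
    case True
    then show ?thesis using inv v l d[OF True] pairs
      unfolding clause_inv_def by (auto simp: reads_Cons)
  next
    case False
    \<comment> \<open>Behind the last list the counter is loaded from one word past the input;
      \<open>clause_inv\<close> claims nothing about it in this case.\<close>
    then have "Suc v = length fs" using v by simp
    then show ?thesis using inv v l pairs unfolding clause_inv_def by auto
  qed
qed

lemma clause_inv_scan:
  assumes inv: "clause_inv m M vl vp el ep inp fs z_end v rem z c pre l as" and v: "v < length fs"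
    and rem: "rem \<noteq> 0"
  shows "inp z = hd l" "z < z_end" "c + 2 \<le> 2 * length (encode_lists fs)" "hd l \<in> set (fs ! v)"
    and "\<not> vp v \<le> ep (hd l) \<Longrightarrow>
      clause_inv m M vl vp el ep inp fs z_end v (rem - 1) (Suc z) c (pre @ [hd l]) (tl l) as"
    and "vp v \<le> ep (hd l) \<Longrightarrow>
      clause_inv m M vl vp el ep inp fs z_end v (rem - 1) (Suc z) (Suc (Suc c)) (pre @ [hd l]) (tl l)
        ((as @ [(vl v, neg_lit M (el (hd l)))]) @ [(el (hd l), neg_lit M (vl v))])"
proof -
  obtain k l' where l: "l = k # l'" using inv v rem by (cases l) (auto simp: clause_inv_def)
  have pairs: "scanned_pairs fs v (pre @ [k]) = insert (v, k) (scanned_pairs fs v pre)"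
    by (auto simp: scanned_pairs_def)
  show "inp z = hd l" "z < z_end" "c + 2 \<le> 2 * length (encode_lists fs)" "hd l \<in> set (fs ! v)"
    using inv v l by (auto simp: clause_inv_def reads_Cons)
  show "clause_inv m M vl vp el ep inp fs z_end v (rem - 1) (Suc z) c (pre @ [hd l]) (tl l) as"
    if "\<not> vp v \<le> ep (hd l)"
    using inv v l that unfolding clause_inv_def by (auto simp: reads_Cons pairs clause_arcs_insert)
  show "clause_inv m M vl vp el ep inp fs z_end v (rem - 1) (Suc z) (Suc (Suc c)) (pre @ [hd l]) (tl l)
        ((as @ [(vl v, neg_lit M (el (hd l)))]) @ [(el (hd l), neg_lit M (vl v))])"
    if "vp v \<le> ep (hd l)"
    using inv v l that unfolding clause_inv_def by (auto simp: reads_Cons pairs clause_arcs_insert)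
qed

lemma clause_runs:
  fixes fs :: "nat list list"
  assumes b: "bounded W (r, a)" and W: "4 * m + n + 2 * length (encode_lists fs) + 32 < W"
    and pre: "r 1 = n" "r 2 = m" "r 20 = Suc m" "r 21 = Suc m + m" "a 0 = inp" "a 17 = (\<lambda>_. 0)"
    and lits: "\<forall>v<n. a 13 v = vl v \<and> a 14 v = vp v" "\<forall>k<m. a 15 k = el k \<and> a 16 k = ep k"
    and lits_less: "\<forall>v<n. vl v < 2 * Suc m" "\<forall>k<m. el k < 2 * Suc m"
    and fs: "length fs = n" "\<forall>l\<in>set fs. set l \<subseteq> {..<m}" "0 < n"
    and reads: "reads inp (m + m + 4) (encode_lists fs)"
  shows "runs W clause_com (30 * length (encode_lists fs) + 60) (\<lambda>(r, a). \<exists>as. linked as (a 17) (a 18) (a 19) \<and>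
      length as \<le> 2 * length (encode_lists fs) \<and>
      set as = insert (Suc m + m, m) (clause_arcs (Suc m) vl vp el ep {(v, k). v < n \<and> k \<in> set (fs ! v)})) (r, a)"
proof -
  define L where "L = length (encode_lists fs)"
  define z_end where "z_end = m + m + 4 + L"
  let ?inv = "clause_inv m (Suc m) vl vp el ep inp fs z_end"
  let ?I = "\<lambda>r a. r 1 = n \<and> r 20 = Suc m \<and> a 0 = inp \<and> (\<forall>v<n. a 13 v = vl v \<and> a 14 v = vp v) \<and>
    (\<forall>k<m. a 15 k = el k \<and> a 16 k = ep k) \<and>
    (\<exists>pre l as. linked as (a 17) (a 18) (a 19) \<and> ?inv (r 6) (r 7) (r 5) (r 10) pre l as)"
  \<comment> \<open>Every iteration that does not end the loop consumes one input word, an entry or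
    a list length; the \<open>Suc\<close> pays for the iteration that finds the last list used
    up.\<close>
  let ?\<mu> = "\<lambda>r a. if r 6 < n then Suc (z_end - r 5) else 0"
  have fs0: "fs = fs ! 0 # drop (Suc 0) fs" using fs(1,3) by (cases fs) auto
  have "encode_lists fs = length (fs ! 0) # fs ! 0 @ encode_lists (drop (Suc 0) fs)"
    by (subst fs0) simp
  then have enc: "L = Suc (length (fs ! 0) + length (encode_lists (drop (Suc 0) fs)))"
    "inp (m + m + 4) = length (fs ! 0)" "reads inp (Suc (m + m + 4)) (fs ! 0 @ encode_lists (drop (Suc 0) fs))"
    using reads by (simp_all add: L_def reads_Cons)
  have "runs W clause_com (30 * L + 60) (\<lambda>(r, a). \<exists>as. linked as (a 17) (a 18) (a 19) \<and>
      length as \<le> 2 * L \<and>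
      set as = insert (Suc m + m, m) (clause_arcs (Suc m) vl vp el ep {(v, k). v < n \<and> k \<in> set (fs ! v)})) (r, a)"
    unfolding clause_com_def
  proof (rule runs_loop[OF b, where I = ?I and \<mu> = ?\<mu> and K = L], goal_cases)
    case 1
    \<comment> \<open>The arc from the negation of variable \<open>m\<close> to \<open>m\<close>
      itself forces this variable to be true.\<close>
    have "linked [(Suc m + m, m)] ((a 17)(Suc m + m := 1)) ((a 18)(1 := 0)) ((a 19)(1 := m))"
      using linked_snoc[OF linked_Nil, of 1 0 "Suc m + m" m "a 18" "a 19"] pre by simp
    moreover have "?inv 0 (length (fs ! 0)) (Suc (m + m + 4)) 1 [] (fs ! 0) [(Suc m + m, m)]"
      unfolding clause_inv_def using enc fs by (auto simp: scanned_pairs_def clause_arcs_def z_end_def L_def)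
    ultimately have "\<exists>pre l as. linked as ((a 17)(Suc m + m := 1)) ((a 18)(1 := 0)) ((a 19)(1 := m)) \<and>
      ?inv 0 (length (fs ! 0)) (Suc (m + m + 4)) 1 pre l as" by blast
    moreover have "a 0 (m + m + 4) = length (fs ! 0)" using enc(2) pre by simp
    ultimately show ?case
      using pre lits W enc(1) fs(3) unfolding clause_init_def
      by (simp add: addarc_def z_end_def)
  next
    case (2 r a)
    then obtain pre l as where l: "linked as (a 17) (a 18) (a 19)" and inv: "?inv (r 6) (r 7) (r 5) (r 10) pre l as"
      by auto
    have v: "r 6 < n" "r 6 < length fs" using 2 fs by auto
    show ?case
    proof (cases "r 7 = 0")
      case True
      note nxt = clause_inv_next[OF inv[unfolded True] v(2)]
      have "\<exists>pre l as. linked as (a 17) (a 18) (a 19) \<and> ?inv (Suc (r 6)) (inp (r 5)) (Suc (r 5)) (r 10) pre l as"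
        using l nxt(1) by blast
      then show ?thesis
        using 2 True v nxt(2,3) W fs(1) unfolding clause_body_def
        by (auto simp: z_end_def L_def)
    next
      case False
      note nxt = clause_inv_scan[OF inv v(2) False]
      have k: "inp (r 5) = hd l" "hd l < m" using nxt(1,4) v(2) fs(2) nth_mem by (blast | auto)+
      have c: "r 10 = length as" using inv by (simp add: clause_inv_def)
      have lv: "a 13 (r 6) = vl (r 6)" "a 14 (r 6) = vp (r 6)" "a 15 (hd l) = el (hd l)" "a 16 (hd l) = ep (hd l)"
        "vl (r 6) < 2 * Suc m" "el (hd l) < 2 * Suc m"
        using 2 v k lits_less by auto
      show ?thesis
      proof (cases "vp (r 6) \<le> ep (hd l)")
        case T: True
        let ?x = "vl (r 6)" and ?y = "el (hd l)"
        let ?nx = "neg_lit (Suc m) ?x" and ?ny = "neg_lit (Suc m) ?y"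
        have "linked ((as @ [(?x, ?ny)]) @ [(?y, ?nx)])
          ((a 17)(?x := Suc (r 10), ?y := Suc (Suc (r 10))))
          ((a 18)(Suc (r 10) := a 17 ?x, Suc (Suc (r 10)) := ((a 17)(?x := Suc (r 10))) ?y))
          ((a 19)(Suc (r 10) := ?ny, Suc (Suc (r 10)) := ?nx))"
          using l c by (intro linked_snoc) auto
        then have "\<exists>pre l as. linked as
          ((a 17)(?x := Suc (r 10), ?y := Suc (Suc (r 10))))
          ((a 18)(Suc (r 10) := a 17 ?x, Suc (Suc (r 10)) := ((a 17)(?x := Suc (r 10))) ?y))
          ((a 19)(Suc (r 10) := ?ny, Suc (Suc (r 10)) := ?nx)) \<and>
          ?inv (r 6) (r 7 - 1) (Suc (r 5)) (Suc (Suc (r 10))) pre l as"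
          using nxt(6)[OF T] by blast
        then show ?thesis
          using 2 False v nxt(2,3) W fs(1) lv k T unfolding clause_body_def addarc_def
          by (simp add: wp_neg_com z_end_def L_def)
      next
        case F: False
        have "\<exists>pre l as. linked as (a 17) (a 18) (a 19) \<and> ?inv (r 6) (r 7 - 1) (Suc (r 5)) (r 10) pre l as"
          using l nxt(5)[OF F] by blast
        then show ?thesis
          using 2 False v nxt(2) W fs(1) lv k F unfolding clause_body_def
          by (simp add: z_end_def L_def)
      qed
    qed
  next
    case (3 r a)
    then obtain pre l as where l: "linked as (a 17) (a 18) (a 19)" and inv: "?inv (r 6) (r 7) (r 5) (r 10) pre l as"
      by auto
    have "r 6 = length fs" using 3 inv fs by (simp add: clause_inv_def)
    then have "length as \<le> 2 * L" "set as = insert (Suc m + m, m)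
        (clause_arcs (Suc m) vl vp el ep (scanned_pairs fs (length fs) []))"
      using inv by (auto simp: clause_inv_def L_def)
    moreover have "scanned_pairs fs (length fs) [] = {(v, k). v < n \<and> k \<in> set (fs ! v)}"
      using fs(1) by (auto simp: scanned_pairs_def)
    ultimately show ?case using l by auto
  next
    case 4
    show ?case by (simp add: clause_init_def clause_body_def addarc_def neg_com_def)
  qed
  then show ?thesis by (simp add: L_def)
qed

section \<open>Linear-time 2-satisfiability\<close>

text \<open>For every unassigned variable, unit propagation from its two literals runs in lockstep. The
  search that first completes without a conflict is committed; the steps of the other search are
  paid for by it. Marks are stamped with the number of the stage and never erased: a mark counts as
  an assigned literal iff its stage was won by the search that set it.\<close>

definition sat :: "(nat \<times> nat) list \<Rightarrow> nat \<Rightarrow> bool" where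
  "sat as M \<longleftrightarrow> (\<exists>V. (\<forall>l<M. V (l + M) \<longleftrightarrow> \<not> V l) \<and> (\<forall>(x, y)\<in>set as. V x \<longrightarrow> V y))"

text \<open>Closure under contraposition, as in the implication graph of any set of 2-clauses. It
  keeps a propagation from contradicting literals that were committed earlier.\<close>

definition skew :: "(nat \<times> nat) list \<Rightarrow> nat \<Rightarrow> bool" where
  "skew as M \<longleftrightarrow> set as \<subseteq> {..<2 * M} \<times> {..<2 * M} \<and>
     (\<forall>(x, y)\<in>set as. (neg_lit M y, neg_lit M x) \<in> set as)"

lemma neg_lit_simps:
  assumes "y < 2 * M"
  shows "neg_lit M y < 2 * M" "neg_lit M (neg_lit M y) = y" "neg_lit M y \<noteq> y"
  using assms by (auto simp: neg_lit_def)

text \<open>The contradiction follows from \<open>l\<close> alone, without appeal to committed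
  literals; so two opposite refuted literals refute the whole instance.\<close>

definition refuted :: "(nat \<times> nat) list \<Rightarrow> nat \<Rightarrow> nat \<Rightarrow> bool" where
  "refuted as M l \<longleftrightarrow> (\<exists>z<2 * M. (l, z) \<in> (set as)\<^sup>* \<and> (l, neg_lit M z) \<in> (set as)\<^sup>*)"

lemma refuted_false:
  assumes V: "\<forall>l<M. V (l + M) \<longleftrightarrow> \<not> V l" "\<forall>(x, y)\<in>set as. V x \<longrightarrow> V y" and r: "refuted as M l"
  shows "\<not> V l"
proof
  assume "V l"
  have *: "(l, y) \<in> (set as)\<^sup>* \<Longrightarrow> V y" for y
    by (induction rule: rtrancl_induct) (use V(2) \<open>V l\<close> in auto)
  obtain z where z: "z < 2 * M" "V z" "V (neg_lit M z)" using r * by (auto simp: refuted_def)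
  show False
  proof (cases "z < M")
    case True
    then show ?thesis using z V(1) by (auto simp: neg_lit_def)
  next
    case False
    then obtain w where w: "z = w + M" by (metis le_add_diff_inverse2 linorder_not_less)
    then show ?thesis using z V(1) False by (simp add: neg_lit_def)
  qed
qed

lemma refuted_unsat:
  assumes "x < M" "refuted as M x" "refuted as M (x + M)"
  shows "\<not> sat as M"
proof
  assume "sat as M"
  then obtain V where V: "\<forall>l<M. V (l + M) \<longleftrightarrow> \<not> V l" "\<forall>(x, y)\<in>set as. V x \<longrightarrow> V y"
    unfolding sat_def by blast
  show False using refuted_false[OF V assms(2)] refuted_false[OF V assms(3)] V(1) assms(1) by simp
qed

text \<open>A consistent partial assignment satisfying every implication that starts in it. Such a
  set can be kept whatever is chosen later, so commitments are never undone.\<close>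

definition closed_lits :: "(nat \<times> nat) list \<Rightarrow> nat \<Rightarrow> nat set \<Rightarrow> bool" where
  "closed_lits as M C \<longleftrightarrow> C \<subseteq> {..<2 * M} \<and> (\<forall>(x, y)\<in>set as. x \<in> C \<longrightarrow> y \<in> C) \<and>
     (\<forall>y\<in>C. neg_lit M y \<notin> C)"

lemma total_closed_sat:
  assumes "closed_lits as M C" "\<forall>l<M. l \<in> C \<or> l + M \<in> C"
  shows "sat as M"
  unfolding sat_def
proof (intro exI[of _ "\<lambda>y. y \<in> C"] conjI allI impI)
  fix l assume l: "l < M"
  then have "neg_lit M l = l + M" by (simp add: neg_lit_def)
  then have "\<not> (l \<in> C \<and> l + M \<in> C)" using assms(1) unfolding closed_lits_def by metis
  then show "(l + M \<in> C) = (l \<notin> C)" using assms(2) l by blast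
qed (use assms in \<open>auto simp: closed_lits_def\<close>)

text \<open>The cost of propagating all literals that are not yet committed; committing a search
  lowers it by exactly the number of steps of that search.\<close>

definition potential :: "(nat \<times> nat) list \<Rightarrow> nat \<Rightarrow> nat set \<Rightarrow> nat" where
  "potential as M C = (\<Sum>y\<in>{..<2 * M} - C. Suc (out_arcs as y))"

text \<open>\<open>C\<close> is the committed set, \<open>st\<close> the stamp and \<open>l0\<close>
  the root of the search. \<open>h\<close> counts popped literals including the one being scanned,
  which is therefore \<open>q (h - 1)\<close>; before the first pop \<open>p\<close> is 0. The last
  equation accounts for every step: \<open>j\<close> is the full cost of the popped literals minus
  what is left of the current chain.\<close>

definition search_inv :: "(nat \<times> nat) list \<Rightarrow> nat \<Rightarrow> nat set \<Rightarrow> nat \<Rightarrow> nat \<Rightarrow> (nat \<Rightarrow> nat) \<Rightarrow> nat \<Rightarrow> nat \<Rightarrow> nat \<Rightarrow>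
    (nat \<Rightarrow> nat) \<Rightarrow> nat \<Rightarrow> bool" where
  "search_inv as M C st l0 q h t p mk j \<longleftrightarrow>
     h \<le> t \<and> inj_on q {..<t} \<and> l0 \<in> q ` {..<t} \<and> q ` {..<t} \<subseteq> {..<2 * M} \<and>
     (\<forall>y. mk y = st \<longleftrightarrow> y \<in> q ` {..<t}) \<and>
     (\<forall>y\<in>q ` {..<t}. neg_lit M y \<notin> q ` {..<t} \<and> y \<notin> C \<and> neg_lit M y \<notin> C \<and> (l0, y) \<in> (set as)\<^sup>*) \<and>
     pointer as (q (h - 1)) p \<and> (p \<noteq> 0 \<longrightarrow> 1 \<le> h) \<and>
     (\<forall>i<h. \<forall>k<length as. fst (as ! k) = q i \<and> (i = h - 1 \<longrightarrow> p \<le> k) \<longrightarrow> snd (as ! k) \<in> q ` {..<t} \<union> C) \<and>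
     j + count_arcs as (q (h - 1)) p = (\<Sum>i<h. Suc (out_arcs as (q i)))"

lemma search_lits:
  assumes "search_inv as M C st l0 q h t p mk j"
  shows "\<forall>y. mk y = st \<longleftrightarrow> y \<in> q ` {..<t}"
    "\<forall>y\<in>q ` {..<t}. neg_lit M y \<notin> q ` {..<t} \<and> y \<notin> C \<and> neg_lit M y \<notin> C \<and> (l0, y) \<in> (set as)\<^sup>*"
    "q ` {..<t} \<subseteq> {..<2 * M}"
  using assms unfolding search_inv_def by - (elim conjE, assumption)+

section \<open>Steps of a single propagation\<close>

lemma search_start:
  assumes "l0 < 2 * M" "l0 \<notin> C" "neg_lit M l0 \<notin> C" "\<forall>y. mk y \<noteq> st"
  shows "search_inv as M C st l0 (q(0 := l0)) 0 1 0 (mk(l0 := st)) 0"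
  using assms neg_lit_simps(3)[OF assms(1)]
  by (auto simp: search_inv_def lessThan_Suc pointer_def)

lemma search_pop:
  assumes inv: "search_inv as M C st l0 q h t 0 mk j" and h: "h < t" and l: "linked as hp nx tg"
  shows "search_inv as M C st l0 q (Suc h) t (hp (q h)) mk (Suc j)"
proof -
  have old: "snd (as ! k) \<in> q ` {..<t} \<union> C" if "i < h" "k < length as" "fst (as ! k) = q i" for i k
    using inv that unfolding search_inv_def by blast
  have new: "fst (as ! k) \<noteq> q h" if "hp (q h) \<le> k" "k < length as" for k
    using linked_hd(3)[OF l that] .
  have "\<forall>i<Suc h. \<forall>k<length as. fst (as ! k) = q i \<and> (i = Suc h - 1 \<longrightarrow> hp (q h) \<le> k) \<longrightarrow>
      snd (as ! k) \<in> q ` {..<t} \<union> C"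
    using old new by (metis diff_Suc_1 less_Suc_eq)
  then show ?thesis
    using inv h linked_hd(1,2)[OF l, of "q h"] unfolding search_inv_def by auto
qed

text \<open>A conflict can arise only inside the search: were the negation of the new literal
  committed, contraposition would commit the negation of the scanned literal as well, which the
  invariant excludes.\<close>

lemma search_scan:
  assumes inv: "search_inv as M C st l0 q h t p mk j" and p: "p \<noteq> 0" and l: "linked as hp nx tg"
    and sk: "skew as M" and C: "closed_lits as M C"
  shows "tg p < 2 * M"
    and "tg p \<in> C \<or> mk (tg p) = st \<Longrightarrow> search_inv as M C st l0 q h t (nx p) mk (Suc j)"
    and "tg p \<notin> C \<Longrightarrow> mk (tg p) \<noteq> st \<Longrightarrow> mk (neg_lit M (tg p)) = st \<Longrightarrow> refuted as M l0"
    and "tg p \<notin> C \<Longrightarrow> mk (tg p) \<noteq> st \<Longrightarrow> mk (neg_lit M (tg p)) \<noteq> st \<Longrightarrow>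
      search_inv as M C st l0 (q(t := tg p)) h (Suc t) (nx p) (mk(tg p := st)) (Suc j)"
proof -
  let ?x = "q (h - 1)" and ?y = "tg p"
  have h: "1 \<le> h" "h \<le> t" and ptr: "pointer as ?x p" using inv p by (auto simp: search_inv_def)
  note nxt = linked_next[OF l ptr p]
  have S: "\<And>y. mk y = st \<longleftrightarrow> y \<in> q ` {..<t}" using inv unfolding search_inv_def by blast
  have xS: "?x \<in> q ` {..<t}" using h by auto
  have x: "neg_lit M ?x \<notin> C" "(l0, ?x) \<in> (set as)\<^sup>*" using inv xS unfolding search_inv_def by blast+
  show y: "?y < 2 * M" using nxt(1) sk by (auto simp: skew_def)
  have reach: "(l0, ?y) \<in> (set as)\<^sup>*" using x(2) nxt(1) by (rule rtrancl_into_rtrancl)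
  have negC: "neg_lit M ?y \<notin> C"
  proof
    assume "neg_lit M ?y \<in> C"
    moreover have "(neg_lit M ?y, neg_lit M ?x) \<in> set as" using sk nxt(1) by (auto simp: skew_def)
    ultimately show False using C x(1) by (auto simp: closed_lits_def)
  qed
  have old: "snd (as ! k) \<in> q ` {..<t} \<union> C"
    if "i < h" "k < length as" "fst (as ! k) = q i" "i = h - 1 \<longrightarrow> p \<le> k" for i k
    using inv that unfolding search_inv_def by blast
  have scanned: "snd (as ! k) \<in> insert ?y (q ` {..<t} \<union> C)"
    if k: "i < h" "k < length as" "fst (as ! k) = q i" "i = h - 1 \<longrightarrow> nx p \<le> k" for i k
  proof (cases "i = h - 1 \<and> k < p")
    case True
    then have "k = p - 1" using nxt(5)[of k] k by auto
    then show ?thesis using nxt(2) by simp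
  next
    case False
    then show ?thesis using old[OF k(1-3)] by auto
  qed
  have work: "Suc j + count_arcs as ?x (nx p) = (\<Sum>i<h. Suc (out_arcs as (q i)))"
    using inv nxt(4) by (simp add: search_inv_def)
  show "search_inv as M C st l0 q h t (nx p) mk (Suc j)" if "?y \<in> C \<or> mk ?y = st"
  proof -
    have "?y \<in> q ` {..<t} \<union> C" using that S by blast
    then have "insert ?y (q ` {..<t} \<union> C) = q ` {..<t} \<union> C" by (rule insert_absorb)
    note sc = scanned[unfolded this]
    have "\<forall>i<h. \<forall>k<length as. fst (as ! k) = q i \<and> (i = h - 1 \<longrightarrow> nx p \<le> k) \<longrightarrow>
        snd (as ! k) \<in> q ` {..<t} \<union> C" by (intro allI impI, elim conjE) (rule sc)
    moreover have "nx p \<noteq> 0 \<longrightarrow> 1 \<le> h" using h by simp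
    ultimately show ?thesis
      using inv nxt(3) work unfolding search_inv_def by (elim conjE, intro conjI) assumption+
  qed
  show "refuted as M l0" if "mk (neg_lit M ?y) = st"
  proof -
    have "neg_lit M ?y \<in> q ` {..<t}" using that S by blast
    then have "(l0, neg_lit M ?y) \<in> (set as)\<^sup>*" using inv unfolding search_inv_def by blast
    then show ?thesis using reach y unfolding refuted_def by blast
  qed
  show "search_inv as M C st l0 (q(t := ?y)) h (Suc t) (nx p) (mk(?y := st)) (Suc j)"
    if yC: "?y \<notin> C" and y1: "mk ?y \<noteq> st" and y2: "mk (neg_lit M ?y) \<noteq> st"
  proof -
    let ?q = "q(t := ?y)"
    have fresh: "?y \<notin> q ` {..<t}" "neg_lit M ?y \<notin> q ` {..<t}" using y1 y2 S by blast+
    have img: "?q ` {..<Suc t} = insert ?y (q ` {..<t})" by (auto simp: lessThan_Suc image_iff)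
    have inj: "inj_on ?q {..<Suc t}"
      using inv fresh by (auto simp: search_inv_def lessThan_Suc inj_on_def) (metis imageI lessThan_iff)+
    have qi: "?q i = q i" if "i < h" for i using that h by auto
    have qx: "?q (h - 1) = ?x" using h by auto
    have lits: "\<forall>z\<in>insert ?y (q ` {..<t}). neg_lit M z \<notin> insert ?y (q ` {..<t}) \<and> z \<notin> C \<and> neg_lit M z \<notin> C \<and>
        (l0, z) \<in> (set as)\<^sup>*"
    proof
      fix z assume "z \<in> insert ?y (q ` {..<t})"
      then consider "z = ?y" | "z \<in> q ` {..<t}" by blast
      then show "neg_lit M z \<notin> insert ?y (q ` {..<t}) \<and> z \<notin> C \<and> neg_lit M z \<notin> C \<and> (l0, z) \<in> (set as)\<^sup>*"
      proof cases
        case 1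
        then show ?thesis using fresh yC negC reach neg_lit_simps(3)[OF y] by simp
      next
        case 2
        then have "z < 2 * M" "neg_lit M z \<notin> q ` {..<t} \<and> z \<notin> C \<and> neg_lit M z \<notin> C \<and> (l0, z) \<in> (set as)\<^sup>*"
          using inv unfolding search_inv_def by blast+
        moreover have "neg_lit M z \<noteq> ?y" using neg_lit_simps(2)[OF \<open>z < 2 * M\<close>] fresh(2) 2 by metis
        ultimately show ?thesis by blast
      qed
    qed
    show ?thesis
      unfolding search_inv_def img
    proof (intro conjI)
      show "\<forall>z. (mk(?y := st)) z = st \<longleftrightarrow> z \<in> insert ?y (q ` {..<t})" using S by auto
      show "\<forall>i<h. \<forall>k<length as. fst (as ! k) = ?q i \<and> (i = h - 1 \<longrightarrow> nx p \<le> k) \<longrightarrow>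
          snd (as ! k) \<in> insert ?y (q ` {..<t}) \<union> C" using scanned qi by auto
      show "Suc j + count_arcs as (?q (h - 1)) (nx p) = (\<Sum>i<h. Suc (out_arcs as (?q i)))"
      proof -
        have "(\<Sum>i<h. Suc (out_arcs as (?q i))) = (\<Sum>i<h. Suc (out_arcs as (q i)))"
          by (rule sum.cong) (use qi in auto)
        then show ?thesis using work qx by (simp only:)
      qed
      show "pointer as (?q (h - 1)) (nx p)" using nxt(3) qx by simp
      show "insert ?y (q ` {..<t}) \<subseteq> {..<2 * M}" using inv y by (auto simp: search_inv_def)
      show "l0 \<in> insert ?y (q ` {..<t})" using inv by (simp add: search_inv_def)
    qed (use inj lits h in auto)
  qed
qed

text \<open>Steps are charged to queued literals and their arcs, and queued literals are distinct
  and not committed.\<close>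

lemma search_bounds:
  assumes inv: "search_inv as M C st l0 q h t p mk j"
  shows "t \<le> 2 * M" "j \<le> potential as M C"
proof -
  have inj: "inj_on q {..<t}" and range: "q ` {..<t} \<subseteq> {..<2 * M}" and h: "h \<le> t"
    using inv by (auto simp: search_inv_def)
  show "t \<le> 2 * M" using card_inj_on_le[OF inj range] by simp
  have "j \<le> (\<Sum>i<h. Suc (out_arcs as (q i)))" using inv unfolding search_inv_def by linarith
  also have "\<dots> = (\<Sum>y\<in>q ` {..<h}. Suc (out_arcs as y))"
    using inj_on_subset[OF inj, of "{..<h}"] h by (simp add: sum.reindex)
  also have "\<dots> \<le> potential as M C"
    unfolding potential_def
  proof (rule sum_mono2)
    have "q ` {..<h} \<subseteq> q ` {..<t}" using h by auto
    then show "q ` {..<h} \<subseteq> {..<2 * M} - C" using search_lits(2)[OF inv] range by blast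
  qed auto
  finally show "j \<le> potential as M C" .
qed

text \<open>With nothing left to scan, the number of steps equals the full cost of the queued
  literals, which is exactly what leaves the potential.\<close>

lemma search_finish:
  assumes inv: "search_inv as M C st l0 q h t 0 mk j" and t: "\<not> h < t" and C: "closed_lits as M C"
  shows "closed_lits as M (C \<union> {y. mk y = st})" "l0 \<in> {y. mk y = st}"
    "potential as M (C \<union> {y. mk y = st}) + j = potential as M C"
proof -
  have ht: "h = t" and inj: "inj_on q {..<t}" using inv t by (auto simp: search_inv_def)
  have S: "{y. mk y = st} = q ` {..<t}" using search_lits(1)[OF inv] by blast
  have lits: "neg_lit M y \<notin> q ` {..<t}" "y \<notin> C" "neg_lit M y \<notin> C" "y < 2 * M" if "y \<in> q ` {..<t}" for y
    using search_lits(2,3)[OF inv] that by blast+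
  show "l0 \<in> {y. mk y = st}" using inv S by (simp add: search_inv_def)
  show "closed_lits as M (C \<union> {y. mk y = st})"
    unfolding closed_lits_def S
  proof (intro conjI)
    show "C \<union> q ` {..<t} \<subseteq> {..<2 * M}" using C lits(4) by (auto simp: closed_lits_def)
    show "\<forall>(x, y)\<in>set as. x \<in> C \<union> q ` {..<t} \<longrightarrow> y \<in> C \<union> q ` {..<t}"
    proof (intro ballI, clarify)
      fix x y assume xy: "(x, y) \<in> set as" "x \<in> C \<union> q ` {..<t}" "y \<notin> q ` {..<t}"
      obtain k where k: "k < length as" "as ! k = (x, y)" using xy(1) by (auto simp: in_set_conv_nth)
      show "y \<in> C"
      proof (cases "x \<in> C")
        case True
        then show ?thesis using C xy(1) by (auto simp: closed_lits_def)
      next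
        case False
        then obtain i where i: "i < t" "x = q i" using xy(2) by auto
        have "fst (as ! k) = q i \<and> (i = h - 1 \<longrightarrow> 0 \<le> k)" "i < h" using k i ht by auto
        moreover have "\<forall>i<h. \<forall>k<length as. fst (as ! k) = q i \<and> (i = h - 1 \<longrightarrow> 0 \<le> k) \<longrightarrow>
            snd (as ! k) \<in> q ` {..<t} \<union> C"
          using inv unfolding search_inv_def by (elim conjE) assumption
        ultimately have "snd (as ! k) \<in> q ` {..<t} \<union> C" using k(1) by blast
        then show ?thesis using k xy(3) by simp
      qed
    qed
    show "\<forall>y\<in>C \<union> q ` {..<t}. neg_lit M y \<notin> C \<union> q ` {..<t}"
    proof
      fix y assume "y \<in> C \<union> q ` {..<t}"
      then consider "y \<in> C" | "y \<in> q ` {..<t}" by blast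
      then show "neg_lit M y \<notin> C \<union> q ` {..<t}"
      proof cases
        case 1
        then have "y < 2 * M" "neg_lit M y \<notin> C" using C by (auto simp: closed_lits_def)
        moreover have "neg_lit M y \<notin> q ` {..<t}"
          using lits(3)[of "neg_lit M y"] neg_lit_simps(2)[OF \<open>y < 2 * M\<close>] 1 by auto
        ultimately show ?thesis by blast
      qed (use lits in blast)
    qed
  qed
  have "j = (\<Sum>y\<in>q ` {..<t}. Suc (out_arcs as y))"
    using inv ht inj by (simp add: search_inv_def sum.reindex)
  moreover have "{..<2 * M} - C = ({..<2 * M} - (C \<union> q ` {..<t})) \<union> q ` {..<t}" using lits by auto
  moreover have "(\<Sum>y\<in>({..<2 * M} - (C \<union> q ` {..<t})) \<union> q ` {..<t}. Suc (out_arcs as y)) =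
      (\<Sum>y\<in>{..<2 * M} - (C \<union> q ` {..<t}). Suc (out_arcs as y)) + (\<Sum>y\<in>q ` {..<t}. Suc (out_arcs as y))"
    by (rule sum.union_disjoint) auto
  ultimately show "potential as M (C \<union> {y. mk y = st}) + j = potential as M C"
    unfolding potential_def S by simp
qed

text \<open>Registers 5 and 7 hold the current variable and its stamp; register 6 tells whether the two
  searches of the current variable are running, and 22 counts their steps. Arrays 20 and 22 hold
  the stamps, 21 and 23 the queues, 24 and 25 flag the stages won by either search.\<close>

definition assigned_com :: "nat \<Rightarrow> nat \<Rightarrow> nat \<Rightarrow> nat \<Rightarrow> nat \<Rightarrow> com" where
  "assigned_com mk w mk' w' y = seqs [Load 8 mk (Reg y), Load 8 w (Reg 8), Load 9 mk' (Reg y),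
     Load 9 w' (Reg 9), Add 10 (Reg 8) (Reg 9)]"

definition step_com :: "nat \<Rightarrow> nat \<Rightarrow> nat \<Rightarrow> nat \<Rightarrow> nat \<Rightarrow> nat \<Rightarrow> nat \<Rightarrow> nat \<Rightarrow> nat \<Rightarrow> com" where
  "step_com mk q w mk' w' h t p cf = Cond (Equal (Reg cf) (Const 0))
     (Cond (Equal (Reg p) (Const 0))
        (Cond (Less (Reg h) (Reg t))
           (seqs [Load 8 q (Reg h), Add h (Reg h) (Const 1), Load p 17 (Reg 8)])
           (seqs [Store w (Reg 7) (Const 1), Add 5 (Reg 5) (Const 1), Assign 6 (Const 0)]))
        (seqs [Load 23 19 (Reg p), Load p 18 (Reg p), assigned_com mk w mk' w' 23,
           Cond (Equal (Reg 10) (Const 0))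
             (seqs [Load 8 mk (Reg 23),
                Cond (Equal (Reg 8) (Reg 7)) Skip
                  (seqs [neg_com 23 24, Load 8 mk (Reg 24),
                     Cond (Equal (Reg 8) (Reg 7)) (Assign cf (Const 1))
                       (seqs [Store mk (Reg 23) (Reg 7), Store q (Reg t) (Reg 23), Add t (Reg t) (Const 1)])])])
             Skip]))
     Skip"

definition start_com :: com where
  "start_com = seqs [Add 7 (Reg 5) (Const 1), Store 20 (Reg 5) (Reg 7), Store 21 (Const 0) (Reg 5),
     Assign 11 (Const 0), Assign 12 (Const 1), Assign 13 (Const 0), Assign 14 (Const 0),
     Store 22 (Reg 24) (Reg 7), Store 23 (Const 0) (Reg 24),
     Assign 16 (Const 0), Assign 17 (Const 1), Assign 18 (Const 0), Assign 19 (Const 0),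
     Assign 22 (Const 0), Assign 6 (Const 1)]"

definition sat_body :: com where
  "sat_body = Cond (Equal (Reg 6) (Const 0))
     (seqs [assigned_com 20 24 22 25 5,
        Cond (NotEqual (Reg 10) (Const 0)) (Add 5 (Reg 5) (Const 1))
          (seqs [Add 24 (Reg 5) (Reg 20), assigned_com 20 24 22 25 24,
             Cond (NotEqual (Reg 10) (Const 0)) (Add 5 (Reg 5) (Const 1)) start_com])])
     (Seq (step_com 20 21 24 22 25 11 12 13 14)
        (Cond (Equal (Reg 6) (Const 0)) Skip
           (Seq (step_com 22 23 25 20 24 16 17 18 19)
              (Cond (Equal (Reg 6) (Const 0)) Skip
                 (seqs [Add 22 (Reg 22) (Const 1),
                    Cond (Equal (Reg 14) (Const 0)) Skip
                      (Cond (Equal (Reg 19) (Const 0)) Skip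
                         (seqs [Assign 0 (Const 0), Assign 5 (Reg 20)]))])))))"

definition sat_com :: com where
  "sat_com = Seq (seqs [Assign 5 (Const 0), Assign 6 (Const 0), Assign 0 (Const 1)])
     (While (Less (Reg 5) (Reg 20)) sat_body)"

text \<open>Stamps start at 1, so the initial mark 0 refers to a stage that is never won.\<close>

definition assigned :: "(nat \<Rightarrow> nat \<Rightarrow> nat) \<Rightarrow> nat set" where
  "assigned a = {y. a 24 (a 20 y) + a 25 (a 22 y) \<noteq> 0}"

text \<open>After a conflict the search stands still and only the refutation of its root is
  remembered, so no claim about its queue has to be maintained.\<close>

definition search_state :: "(nat \<times> nat) list \<Rightarrow> nat \<Rightarrow> nat set \<Rightarrow> nat \<Rightarrow> nat \<Rightarrow> (nat \<Rightarrow> nat) \<Rightarrow> nat \<Rightarrow> nat \<Rightarrow> nat \<Rightarrow>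
    (nat \<Rightarrow> nat) \<Rightarrow> nat \<Rightarrow> nat \<Rightarrow> bool" where
  "search_state as M C st l0 q h t p mk cf j \<longleftrightarrow>
     (if cf = 0 then search_inv as M C st l0 q h t p mk j else refuted as M l0)"

text \<open>Registers and arrays are parameters because both searches run the same code with their
  roles exchanged. The two outcomes, going on or winning the stage, enter as premises about the
  postcondition.\<close>

lemma wp_step_com:
  assumes dist: "distinct [5, 6, 7, 8, 9, 10, 20, 23, 24, h, t, p, cf]" "distinct [17, 18, 19, mk, q, w, mk', w']"
    and W: "4 * M + 16 < W" and r: "r 20 = M" "r 7 = st" "r 5 < M"
    and l: "linked as (a 17) (a 18) (a 19)" and sk: "skew as M" and cl: "closed_lits as M C"
    and C: "\<And>y. y \<in> C \<longleftrightarrow> a w (a mk y) + a w' (a mk' y) \<noteq> 0"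
    and win: "\<And>z. a w z \<le> 1" "\<And>z. a w' z \<le> 1"
    and state: "search_state as M C st root (a q) (r h) (r t) (r p) (a mk) (r cf) j"
    and continue: "\<And>r' a'. (\<And>z. z \<notin> {8, 9, 10, 23, 24, h, t, p, cf} \<Longrightarrow> r' z = r z) \<Longrightarrow>
      (\<And>A. A \<notin> {mk, q} \<Longrightarrow> a' A = a A) \<Longrightarrow>
      (\<And>y. a' mk y \<noteq> a mk y \<Longrightarrow> y \<notin> C \<and> a' mk y = st) \<Longrightarrow>
      search_state as M C st root (a' q) (r' h) (r' t) (r' p) (a' mk) (r' cf) (Suc j) \<Longrightarrow> Q (r', a')"
    and finish: "r cf = 0 \<Longrightarrow> r p = 0 \<Longrightarrow> \<not> r h < r t \<Longrightarrow>
      Q (r(5 := Suc (r 5), 6 := 0), a(w := (a w)(st := 1)))"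
  shows "wp W (step_com mk q w mk' w' h t p cf) Q (r, a)"
proof (cases "r cf = 0")
  case False
  then have "refuted as M root" using state by (simp add: search_state_def)
  then have "Q (r, a)" using False by (intro continue) (auto simp: search_state_def)
  then show ?thesis using False by (simp add: step_com_def)
next
  case cf: True
  then have inv: "search_inv as M C st root (a q) (r h) (r t) (r p) (a mk) j"
    using state by (simp add: search_state_def)
  note bds = search_bounds(1)[OF inv]
  show ?thesis
  proof (cases "r p = 0")
    case p: True
    show ?thesis
    proof (cases "r h < r t")
      case True
      have "Q (r(8 := a q (r h), h := Suc (r h), p := a 17 (a q (r h))), a)"
        by (rule continue) (use cf dist search_pop[OF inv[unfolded p] True l] in \<open>auto simp: search_state_def\<close>)
      then show ?thesis using cf p True dist bds W by (simp add: step_com_def)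
    next
      case False
      then show ?thesis using cf p finish dist W r by (simp add: step_com_def)
    qed
  next
    case p: False
    note scan = search_scan[OF inv p l sk cl]
    define y where "y = a 19 (r p)"
    have y: "a 19 (r p) = y" by (simp add: y_def)
    let ?w1 = "a w (a mk y)" and ?w2 = "a w' (a mk' y)"
    have ww: "?w1 + ?w2 < W" using win(1)[of "a mk y"] win(2)[of "a mk' y"] W by linarith
    let ?r1 = "r(23 := y, p := a 18 (r p), 8 := ?w1, 9 := ?w2, 10 := ?w1 + ?w2)"
    have y2: "y < 2 * M" using scan(1) y by simp
    have "q \<noteq> mk" using dist by auto
    then have step: "wp W (step_com mk q w mk' w' h t p cf) Q (r, a) \<longleftrightarrow>
       (if ?w1 + ?w2 = 0 then
          (if a mk y = st then Q (?r1(8 := a mk y), a)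
           else if a mk (neg_lit M y) = st
             then Q (?r1(8 := a mk y, 24 := neg_lit M y, 8 := a mk (neg_lit M y), cf := 1), a)
             else r t + 1 < W \<and> Q (?r1(8 := a mk y, 24 := neg_lit M y, 8 := a mk (neg_lit M y), t := Suc (r t)),
                  a(mk := (a mk)(y := st), q := (a q)(r t := y))))
        else Q (?r1, a))"
      using cf p dist W r y2 ww by (simp add: step_com_def assigned_com_def y wp_neg_com)
    have keep: "Q (r', a)"
      if "y \<in> C \<or> a mk y = st" "\<And>z. z \<notin> {8, 9, 10, 23, p} \<Longrightarrow> r' z = r z" "r' p = a 18 (r p)" for r'
      by (rule continue) (use that dist cf scan(2) y in \<open>auto simp: search_state_def\<close>)
    show ?thesis
    proof (cases "y \<in> C")
      case True
      have "Q (?r1, a)" by (rule keep) (use True dist in auto)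
      moreover have ne: "(?w1 + ?w2 = 0) = False" using True C[of y] by simp
      ultimately show ?thesis by (simp only: step ne if_False)
    next
      case yC: False
      have w0: "?w1 + ?w2 = 0" using yC C[of y] by simp
      show ?thesis
      proof (cases "a mk y = st")
        case True
        have "Q (?r1(8 := a mk y), a)" by (rule keep) (use True dist in auto)
        then show ?thesis unfolding step using True w0 by simp
      next
        case y1: False
        show ?thesis
        proof (cases "a mk (neg_lit M y) = st")
          case True
          have "refuted as M root" using scan(3) yC y1 True y by simp
          then have "Q (?r1(8 := a mk y, 24 := neg_lit M y, 8 := a mk (neg_lit M y), cf := 1), a)"
            by (intro continue) (use dist in \<open>auto simp: search_state_def\<close>)
          then show ?thesis unfolding step using True w0 y1 by simp
        next
          case y2: False
          have new: "search_inv as M C st root ((a q)(r t := y)) (r h) (Suc (r t)) (a 18 (r p)) ((a mk)(y := st)) (Suc j)"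
            using scan(4) yC y1 y2 y by simp
          have "Q (?r1(8 := a mk y, 24 := neg_lit M y, 8 := a mk (neg_lit M y), t := Suc (r t)),
                  a(mk := (a mk)(y := st), q := (a q)(r t := y)))"
            by (rule continue) (use dist cf new yC in \<open>auto simp: search_state_def split: if_splits\<close>)
          then show ?thesis unfolding step using y1 y2 w0 search_bounds(1)[OF new] W by simp
        qed
      qed
    qed
  qed
qed


text \<open>When both roots are refuted, register 0 is cleared and register 5 jumps to
  \<open>M\<close> to end the loop; the claims about stamps and searches are therefore made only
  while \<open>r 5 < M\<close>.\<close>

definition sat_inv :: "(nat \<times> nat) list \<Rightarrow> nat \<Rightarrow> (nat \<Rightarrow> nat) \<Rightarrow> (nat \<Rightarrow> nat \<Rightarrow> nat) \<Rightarrow> bool" where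
  "sat_inv as M r a \<longleftrightarrow>
     linked as (a 17) (a 18) (a 19) \<and> r 20 = M \<and> r 5 \<le> M \<and> (\<forall>z. a 24 z \<le> 1 \<and> a 25 z \<le> 1) \<and>
     closed_lits as M (assigned a) \<and>
     (r 0 = 0 \<longrightarrow> r 5 = M \<and> \<not> sat as M) \<and>
     (r 0 \<noteq> 0 \<longrightarrow> r 0 = 1 \<and> (\<forall>l<r 5. l \<in> assigned a \<or> l + M \<in> assigned a)) \<and>
     (r 5 < M \<longrightarrow> (\<forall>y. a 20 y \<le> r 5 + r 6 \<and> a 22 y \<le> r 5 + r 6) \<and>
        (\<forall>z>r 5. a 24 z = 0 \<and> a 25 z = 0) \<and> r 6 \<le> 1 \<and>
        (r 6 = 1 \<longrightarrow> r 7 = Suc (r 5) \<and> (r 14 = 0 \<or> r 19 = 0) \<and>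
           search_state as M (assigned a) (r 7) (r 5) (a 21) (r 11) (r 12) (r 13) (a 20) (r 14) (r 22) \<and>
           search_state as M (assigned a) (r 7) (r 5 + M) (a 23) (r 16) (r 17) (r 18) (a 22) (r 19) (r 22)))"

text \<open>Each variable has two units, one for starting its searches and one for ending the stage.
  One iteration advances both searches, so a single step counter is subtracted; when a search wins,
  this counter is exactly the loss of potential.\<close>

definition sat_measure :: "(nat \<times> nat) list \<Rightarrow> nat \<Rightarrow> (nat \<Rightarrow> nat) \<Rightarrow> (nat \<Rightarrow> nat \<Rightarrow> nat) \<Rightarrow> nat" where
  "sat_measure as M r a =
     (if M \<le> r 5 then 0 else if r 6 = 0 then 2 * (M - r 5) + potential as M (assigned a)
      else 2 * (M - r 5) - 1 + (potential as M (assigned a) - r 22))"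

section \<open>Iterations of the satisfiability loop\<close>

lemma potential_le: "potential as M C \<le> 2 * M + length as"
proof -
  have "potential as M C \<le> (\<Sum>y<2 * M. Suc (out_arcs as y))"
    unfolding potential_def by (rule sum_mono2) auto
  also have "\<dots> = 2 * M + (\<Sum>y<2 * M. out_arcs as y)" by (simp add: sum_Suc)
  also have "\<dots> \<le> 2 * M + length as" using sum_count_arcs[of "{..<2 * M}" as "length as"] by simp
  finally show ?thesis .
qed

lemma wp_assigned_com:
  assumes "\<And>z. a 24 z \<le> 1" "\<And>z. a 25 z \<le> 1" "2 < W" "y \<noteq> 8" "y \<noteq> 9"
    and Q: "\<And>r'. (\<And>z. z \<notin> {8, 9, 10} \<Longrightarrow> r' z = r z) \<Longrightarrow> (r' 10 \<noteq> 0 \<longleftrightarrow> r y \<in> assigned a) \<Longrightarrow> Q (r', a)"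
  shows "wp W (assigned_com 20 24 22 25 y) Q (r, a)"
proof -
  have "a 24 (a 20 (r y)) + a 25 (a 22 (r y)) < W"
    using assms(1)[of "a 20 (r y)"] assms(2)[of "a 22 (r y)"] assms(3) by linarith
  moreover have "Q (r(8 := a 24 (a 20 (r y)), 9 := a 25 (a 22 (r y)), 10 := a 24 (a 20 (r y)) + a 25 (a 22 (r y))), a)"
    by (rule Q) (auto simp: assigned_def)
  ultimately show ?thesis using assms(4,5) by (simp add: assigned_com_def)
qed

lemma sat_start:
  assumes inv: "sat_inv as M r a" and lt: "r 5 < M" and idle: "r 6 = 0"
    and new: "r 5 \<notin> assigned a" "r 5 + M \<notin> assigned a"
    and r': "r' 5 = r 5" "r' 6 = 1" "r' 7 = Suc (r 5)" "r' 20 = M" "r' 0 = r 0" "r' 11 = 0" "r' 12 = 1" "r' 13 = 0"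
      "r' 14 = 0" "r' 16 = 0" "r' 17 = 1" "r' 18 = 0" "r' 19 = 0" "r' 22 = 0"
    and a': "\<And>A. A \<notin> {20, 21, 22, 23} \<Longrightarrow> a' A = a A" "a' 20 = (a 20)(r 5 := Suc (r 5))" "a' 21 = (a 21)(0 := r 5)"
      "a' 22 = (a 22)(r 5 + M := Suc (r 5))" "a' 23 = (a 23)(0 := r 5 + M)"
  shows "sat_inv as M r' a' \<and> sat_measure as M r' a' < sat_measure as M r a"
proof -
  have r0: "r 0 = 1" using inv lt by (auto simp: sat_inv_def)
  have stamps: "\<And>y. a 20 y \<le> r 5" "\<And>y. a 22 y \<le> r 5" "\<And>z. r 5 < z \<Longrightarrow> a 24 z = 0 \<and> a 25 z = 0"
    using inv lt idle by (auto simp: sat_inv_def)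
  have neg: "neg_lit M (r 5) = r 5 + M" "neg_lit M (r 5 + M) = r 5" using lt by (auto simp: neg_lit_def)
  \<comment> \<open>The new marks carry the stamp of a stage that nobody has won, so they do not
    count yet, and they overwrite only marks of unassigned literals.\<close>
  have same: "assigned a' = assigned a"
    using new stamps(3)[of "Suc (r 5)"] by (auto simp: assigned_def a')
  have ne: "a 20 y \<noteq> Suc (r 5)" "a 22 y \<noteq> Suc (r 5)" for y
    using stamps(1,2)[of y] by linarith+
  have s0: "search_inv as M (assigned a) (Suc (r 5)) (r 5) (a' 21) 0 1 0 (a' 20) 0"
    unfolding a' by (rule search_start) (use lt new neg ne in auto)
  have s1: "search_inv as M (assigned a) (Suc (r 5)) (r 5 + M) (a' 23) 0 1 0 (a' 22) 0"
    unfolding a' by (rule search_start) (use lt new neg ne in auto)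
  have st: "a' 20 y \<le> Suc (r 5)" "a' 22 y \<le> Suc (r 5)" for y
    using stamps(1,2)[of y] by (auto simp: a'(2,4))
  have "sat_inv as M r' a'"
    using inv lt r0 s0 s1 st stamps(3) same a'(1) r' by (simp add: sat_inv_def search_state_def)
  moreover have "sat_measure as M r' a' < sat_measure as M r a"
    using lt idle r' same by (simp add: sat_measure_def)
  ultimately show ?thesis by simp
qed

lemma sat_body_idle:
  assumes inv: "sat_inv as M r a" and lt: "r 5 < M" and idle: "r 6 = 0"
    and W: "4 * M + length as + 16 < W"
  shows "wp W sat_body (\<lambda>(r', a'). sat_inv as M r' a' \<and> sat_measure as M r' a' < sat_measure as M r a) (r, a)"
proof -
  let ?Q = "\<lambda>(r', a'). sat_inv as M r' a' \<and> sat_measure as M r' a' < sat_measure as M r a"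
  have win: "\<And>z. a 24 z \<le> 1" "\<And>z. a 25 z \<le> 1" and r20: "r 20 = M" using inv by (auto simp: sat_inv_def)
  have r0: "r 0 = 1" using inv lt by (auto simp: sat_inv_def)
  have stamps: "\<And>y. a 20 y \<le> r 5" "\<And>y. a 22 y \<le> r 5" "\<And>z. r 5 < z \<Longrightarrow> a 24 z = 0 \<and> a 25 z = 0"
    using inv lt idle by (auto simp: sat_inv_def)
  have skip: "?Q (r'(5 := Suc (r' 5)), a)"
    if "r 5 \<in> assigned a \<or> r 5 + M \<in> assigned a" "\<And>z. z \<notin> {8, 9, 10, 24} \<Longrightarrow> r' z = r z" for r'
  proof -
    have "\<forall>l<Suc (r 5). l \<in> assigned a \<or> l + M \<in> assigned a"
      using inv r0 that(1) by (auto simp: sat_inv_def less_Suc_eq)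
    moreover have "a 20 y \<le> Suc (r 5)" "a 22 y \<le> Suc (r 5)" for y
      using stamps(1,2)[of y] by linarith+
    ultimately have "sat_inv as M (r'(5 := Suc (r' 5))) a"
      using inv lt idle that(2) r0 by (simp add: sat_inv_def)
    moreover have "sat_measure as M (r'(5 := Suc (r' 5))) a < sat_measure as M r a"
      using lt idle that(2) by (simp add: sat_measure_def, linarith)
    ultimately show ?thesis by simp
  qed
  let ?C2 = "Cond (NotEqual (Reg 10) (Const 0)) (Add 5 (Reg 5) (Const 1)) start_com"
  let ?C1 = "Cond (NotEqual (Reg 10) (Const 0)) (Add 5 (Reg 5) (Const 1))
          (seqs [Add 24 (Reg 5) (Reg 20), assigned_com 20 24 22 25 24, ?C2])"
  have second: "wp W (assigned_com 20 24 22 25 24) (wp W ?C2 ?Q) (r2, a)"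
    if r2: "\<And>z. z \<notin> {8, 9, 10, 24} \<Longrightarrow> r2 z = r z" "r2 24 = r 5 + M" and new: "r 5 \<notin> assigned a" for r2
  proof (rule wp_assigned_com[OF win])
    fix r3 assume r3: "\<And>z. z \<notin> {8, 9, 10} \<Longrightarrow> r3 z = r2 z" "(r3 10 \<noteq> 0) = (r2 24 \<in> assigned a)"
    have agree: "\<And>z. z \<notin> {8, 9, 10, 24} \<Longrightarrow> r3 z = r z" "r3 24 = r 5 + M" using r2 r3 by auto
    show "wp W ?C2 ?Q (r3, a)"
    proof (cases "r 5 + M \<in> assigned a")
      case True
      then show ?thesis using skip[of r3] agree r3(2) r2(2) W lt by simp
    next
      case False
      have "r 5 < M + M" using lt by simp
      then show ?thesis
        using False agree r3(2) r2(2) W lt r20 unfolding start_com_def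
        by simp (rule sat_start[OF inv lt idle new False]; simp)
    qed
  qed (use W in auto)
  have "wp W (assigned_com 20 24 22 25 5) (wp W ?C1 ?Q) (r, a)"
  proof (rule wp_assigned_com[OF win])
    fix r1 assume r1: "\<And>z. z \<notin> {8, 9, 10} \<Longrightarrow> r1 z = r z" "(r1 10 \<noteq> 0) = (r 5 \<in> assigned a)"
    show "wp W ?C1 ?Q (r1, a)"
    proof (cases "r 5 \<in> assigned a")
      case True
      then show ?thesis using skip[of r1] r1 W lt by simp
    next
      case False
      have "wp W (assigned_com 20 24 22 25 24) (wp W ?C2 ?Q) (r1(24 := r1 5 + r1 20), a)"
        by (rule second) (use r1 False r20 in auto)
      then show ?thesis using False r1 r20 W lt by simp
    qed
  qed (use W in auto)
  then show ?thesis using idle by (simp add: sat_body_def)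
qed

lemma sat_inv_running:
  assumes "sat_inv as M r a" "r 5 < M" "r 6 \<noteq> 0"
  shows "r 6 = 1" "r 7 = Suc (r 5)" "r 14 = 0 \<or> r 19 = 0" "r 0 = 1"
    "search_state as M (assigned a) (Suc (r 5)) (r 5) (a 21) (r 11) (r 12) (r 13) (a 20) (r 14) (r 22)"
    "search_state as M (assigned a) (Suc (r 5)) (r 5 + M) (a 23) (r 16) (r 17) (r 18) (a 22) (r 19) (r 22)"
    "a 20 y \<le> Suc (r 5)" "a 22 y \<le> Suc (r 5)" "r 5 < z \<Longrightarrow> a 24 z = 0 \<and> a 25 z = 0"
    "a 24 z \<le> 1" "a 25 z \<le> 1" "closed_lits as M (assigned a)" "linked as (a 17) (a 18) (a 19)" "r 20 = M"
    "l < r 5 \<Longrightarrow> l \<in> assigned a \<or> l + M \<in> assigned a"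
  using assms by (cases "r 6 = 1"; auto simp: sat_inv_def)+

text \<open>Stated for an arbitrary mark array \<open>mk\<close> and root, so that it serves
  whichever search wins.\<close>

lemma sat_finish:
  assumes inv: "sat_inv as M r a" and lt: "r 5 < M" and running: "r 6 \<noteq> 0"
    and r': "r' 5 = Suc (r 5)" "r' 6 = 0" "r' 20 = M" "r' 0 = 1"
    and a': "a' 17 = a 17" "a' 18 = a 18" "a' 19 = a 19" "\<And>z. a' 24 z \<le> 1" "\<And>z. a' 25 z \<le> 1"
      "\<And>z. Suc (r 5) < z \<Longrightarrow> a' 24 z = 0 \<and> a' 25 z = 0" "\<And>y. a' 20 y \<le> Suc (r 5)" "\<And>y. a' 22 y \<le> Suc (r 5)"
    and C': "assigned a' = assigned a \<union> {y. mk y = Suc (r 5)}"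
    and s: "search_inv as M (assigned a) (Suc (r 5)) l0 q h t 0 mk (r 22)" "\<not> h < t" "l0 = r 5 \<or> l0 = r 5 + M"
  shows "sat_inv as M r' a' \<and> sat_measure as M r' a' < sat_measure as M r a"
proof -
  note R = sat_inv_running[OF inv lt running]
  note F = search_finish[OF s(1,2) R(12)]
  have "l \<in> assigned a' \<or> l + M \<in> assigned a'" if "l < Suc (r 5)" for l
    using R(15)[of l] F(2) s(3) that unfolding C' by (auto simp: less_Suc_eq)
  then have "sat_inv as M r' a'"
    using r' a' lt R(13) F(1) C' by (simp add: sat_inv_def)
  moreover have "potential as M (assigned a') + r 22 = potential as M (assigned a)" using F(3) C' by simp
  then have "sat_measure as M r' a' < sat_measure as M r a"
    using lt running r' by (auto simp: sat_measure_def)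
  ultimately show ?thesis by simp
qed

text \<open>A search overwrites marks of unassigned literals only, and its own stamp belongs to a
  stage not yet won; old marks therefore never have to be erased.\<close>

lemma assigned_keep:
  assumes "\<And>y. a' 20 y \<noteq> a 20 y \<Longrightarrow> y \<notin> assigned a \<and> a' 20 y = st"
    and "\<And>y. a' 22 y \<noteq> a 22 y \<Longrightarrow> y \<notin> assigned a \<and> a' 22 y = st"
    and "a' 24 = a 24" "a' 25 = a 25" "a 24 st = 0" "a 25 st = 0"
  shows "assigned a' = assigned a"
proof -
  have "a 24 (a' 20 y) + a 25 (a' 22 y) \<noteq> 0 \<longleftrightarrow> a 24 (a 20 y) + a 25 (a 22 y) \<noteq> 0" for y
    using assms(1,2)[of y] assms(5,6)
    by (cases "a' 20 y = a 20 y"; cases "a' 22 y = a 22 y") (auto simp: assigned_def)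
  then show ?thesis using assms(3,4) by (auto simp: assigned_def)
qed

lemma sat_body_running:
  assumes inv: "sat_inv as M r a" and lt: "r 5 < M" and running: "r 6 \<noteq> 0"
    and W: "4 * M + length as + 16 < W" and sk: "skew as M"
  shows "wp W sat_body (\<lambda>(r', a'). sat_inv as M r' a' \<and> sat_measure as M r' a' < sat_measure as M r a) (r, a)"
proof -
  let ?Q = "\<lambda>(r', a'). sat_inv as M r' a' \<and> sat_measure as M r' a' < sat_measure as M r a"
  let ?C = "assigned a" and ?st = "Suc (r 5)"
  note R = sat_inv_running[OF inv lt running]
  let ?c3 = "seqs [Add 22 (Reg 22) (Const 1),
                    Cond (Equal (Reg 14) (Const 0)) Skip
                      (Cond (Equal (Reg 19) (Const 0)) Skip
                         (seqs [Assign 0 (Const 0), Assign 5 (Reg 20)]))]"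
  let ?c2 = "Cond (Equal (Reg 6) (Const 0)) Skip ?c3"
  let ?c1 = "Cond (Equal (Reg 6) (Const 0)) Skip (Seq (step_com 22 23 25 20 24 16 17 18 19) ?c2)"
  have W': "4 * M + 16 < W" using W by simp
  have win_st: "a 24 ?st = 0" "a 25 ?st = 0" using R(9)[of ?st] by auto
  \<comment> \<open>The body is treated from its end: what remains after both searches have moved,
    then what remains after the first, then the whole.\<close>
  have third: "wp W ?c2 ?Q (r2, a2)"
    if r2: "\<And>z. z \<in> {0, 5, 6, 7, 20, 22} \<Longrightarrow> r2 z = r z"
      and a2: "\<And>A. A \<notin> {20, 21, 22, 23} \<Longrightarrow> a2 A = a A"
      "\<And>y. a2 20 y \<noteq> a 20 y \<Longrightarrow> y \<notin> ?C \<and> a2 20 y = ?st" "\<And>y. a2 22 y \<noteq> a 22 y \<Longrightarrow> y \<notin> ?C \<and> a2 22 y = ?st"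
      and s0: "search_state as M ?C ?st (r 5) (a2 21) (r2 11) (r2 12) (r2 13) (a2 20) (r2 14) (Suc (r 22))"
      and s1: "search_state as M ?C ?st (r 5 + M) (a2 23) (r2 16) (r2 17) (r2 18) (a2 22) (r2 19) (Suc (r 22))"
    for r2 a2
  proof -
    have same: "assigned a2 = ?C"
      by (rule assigned_keep[where st = ?st, OF a2(2,3)]) (use a2(1) win_st in auto)
    have st: "a2 20 y \<le> ?st" "a2 22 y \<le> ?st" for y
      using a2(2,3)[of y] R(7,8)[of y] by (cases "a2 20 y = a 20 y"; cases "a2 22 y = a 22 y"; simp)+
    have base: "sat_inv as M (r2(22 := Suc (r 22))) a2 \<and>
        sat_measure as M (r2(22 := Suc (r 22))) a2 < sat_measure as M r a"
      if act: "r2 14 = 0 \<or> r2 19 = 0"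
    proof -
      \<comment> \<open>A search without conflict has performed all steps counted so far on
        uncommitted literals. So the counter stays within the potential, and the truncated
        difference in the measure really drops.\<close>
      have "Suc (r 22) \<le> potential as M ?C"
        using act s0 s1 search_bounds(2) by (auto simp: search_state_def)
      then have "sat_measure as M (r2(22 := Suc (r 22))) a2 < sat_measure as M r a"
        using lt running r2 same by (simp add: sat_measure_def)
      moreover have "sat_inv as M (r2(22 := Suc (r 22))) a2"
        using lt r2 same s0 s1 st act R a2(1) by (simp add: sat_inv_def)
      ultimately show ?thesis by simp
    qed
    have "r 22 \<le> potential as M ?C"
      using R(3,5,6) search_bounds(2) by (auto simp: search_state_def)
    then have bd: "Suc (r 22) < W" using potential_le[of as M ?C] W by linarith
    show ?thesis
    proof (cases "r2 14 = 0 \<or> r2 19 = 0")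
      case True
      then show ?thesis using base[OF True] r2[of 22] r2[of 6] bd running
        by (cases "r2 14 = 0") simp_all
    next
      case False
      \<comment> \<open>Both values of the current variable are contradictory, and neither
        refutation depends on earlier commitments.\<close>
      then have "refuted as M (r 5)" "refuted as M (r 5 + M)" using s0 s1 by (auto simp: search_state_def)
      then have unsat: "\<not> sat as M" using refuted_unsat lt by blast
      have "sat_inv as M (r2(22 := Suc (r 22), 0 := 0, 5 := M)) a2"
        using unsat same R a2(1) r2 by (simp add: sat_inv_def)
      moreover have "sat_measure as M (r2(22 := Suc (r 22), 0 := 0, 5 := M)) a2 < sat_measure as M r a"
        using lt running by (simp add: sat_measure_def)
      ultimately show ?thesis using False r2[of 22] r2[of 6] r2[of 20] bd running R(14) W by simp
    qed
  qed
  have second: "wp W ?c1 ?Q (r1, a1)"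
    if r1: "\<And>z. z \<in> {0, 5, 6, 7, 20, 22, 16, 17, 18, 19} \<Longrightarrow> r1 z = r z"
      and a1: "\<And>A. A \<notin> {20, 21} \<Longrightarrow> a1 A = a A"
      "\<And>y. a1 20 y \<noteq> a 20 y \<Longrightarrow> y \<notin> ?C \<and> a1 20 y = ?st"
      and s0: "search_state as M ?C ?st (r 5) (a1 21) (r1 11) (r1 12) (r1 13) (a1 20) (r1 14) (Suc (r 22))"
    for r1 a1
  proof -
    have same: "assigned a1 = ?C"
      by (rule assigned_keep[where st = ?st and a = a and a' = a1, OF a1(2)]) (use a1(1) win_st in auto)
    have "wp W (step_com 22 23 25 20 24 16 17 18 19) (wp W ?c2 ?Q) (r1, a1)"
    proof (rule wp_step_com[OF _ _ W' _ _ _ _ sk R(12), where st = ?st and root = "r 5 + M" and j = "r 22"])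
      show "y \<in> ?C \<longleftrightarrow> a1 25 (a1 22 y) + a1 24 (a1 20 y) \<noteq> 0" for y
        unfolding same[symmetric] by (auto simp: assigned_def)
      show "search_state as M ?C ?st (r 5 + M) (a1 23) (r1 16) (r1 17) (r1 18) (a1 22) (r1 19) (r 22)"
        using R(6) r1 a1(1) by simp
    next
      fix r2 a2
      assume r2: "\<And>z. z \<notin> {8, 9, 10, 23, 24, 16, 17, 18, 19} \<Longrightarrow> r2 z = r1 z"
        and a2: "\<And>A. A \<notin> {22, 23} \<Longrightarrow> a2 A = a1 A" "\<And>y. a2 22 y \<noteq> a1 22 y \<Longrightarrow> y \<notin> ?C \<and> a2 22 y = ?st"
        and s1: "search_state as M ?C ?st (r 5 + M) (a2 23) (r2 16) (r2 17) (r2 18) (a2 22) (r2 19) (Suc (r 22))"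
      show "wp W ?c2 ?Q (r2, a2)"
        by (rule third) (use r1 r2 a1 a2 s0 s1 in auto)
    next
      assume c: "r1 19 = 0" "r1 18 = 0" "\<not> r1 16 < r1 17"
      have s: "search_inv as M ?C ?st (r 5 + M) (a 23) (r 16) (r 17) 0 (a 22) (r 22)"
        using R(6) c r1 by (simp add: search_state_def)
      have C': "assigned (a1(25 := (a1 25)(?st := 1))) = ?C \<union> {y. a 22 y = ?st}"
        unfolding same[symmetric] using a1(1) by (auto simp: assigned_def)
      have st: "a1 20 y \<le> ?st" for y
        using a1(2)[of y] R(7)[of y] by (cases "a1 20 y = a 20 y") simp_all
      have "sat_inv as M (r1(5 := Suc (r1 5), 6 := 0)) (a1(25 := (a1 25)(?st := 1))) \<and>
          sat_measure as M (r1(5 := Suc (r1 5), 6 := 0)) (a1(25 := (a1 25)(?st := 1))) < sat_measure as M r a"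
        by (rule sat_finish[where mk = "a 22", OF inv lt running _ _ _ _ _ _ _ _ _ _ _ _ C' s])
          (use c r1 a1(1) R(4,8-11,14) st in auto)
      then show "wp W ?c2 ?Q (r1(5 := Suc (r1 5), 6 := 0), a1(25 := (a1 25)(?st := 1)))" by simp
    qed (use r1 a1 R lt in auto)
    then show ?thesis using r1 running by simp
  qed
  have "wp W (step_com 20 21 24 22 25 11 12 13 14) (wp W ?c1 ?Q) (r, a)"
  proof (rule wp_step_com[OF _ _ W' _ _ _ _ sk R(12), where st = ?st and root = "r 5" and j = "r 22"])
    show "y \<in> ?C \<longleftrightarrow> a 24 (a 20 y) + a 25 (a 22 y) \<noteq> 0" for y
      by (auto simp: assigned_def)
    show "search_state as M ?C ?st (r 5) (a 21) (r 11) (r 12) (r 13) (a 20) (r 14) (r 22)"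
      using R(5) .
  next
    fix r1 a1
    assume r1: "\<And>z. z \<notin> {8, 9, 10, 23, 24, 11, 12, 13, 14} \<Longrightarrow> r1 z = r z"
      and a1: "\<And>A. A \<notin> {20, 21} \<Longrightarrow> a1 A = a A" "\<And>y. a1 20 y \<noteq> a 20 y \<Longrightarrow> y \<notin> ?C \<and> a1 20 y = ?st"
      and s0: "search_state as M ?C ?st (r 5) (a1 21) (r1 11) (r1 12) (r1 13) (a1 20) (r1 14) (Suc (r 22))"
    show "wp W ?c1 ?Q (r1, a1)"
      by (rule second) (use r1 a1 s0 in auto)
  next
    assume c: "r 14 = 0" "r 13 = 0" "\<not> r 11 < r 12"
    have s: "search_inv as M ?C ?st (r 5) (a 21) (r 11) (r 12) 0 (a 20) (r 22)"
      using R(5) c by (simp add: search_state_def)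
    have C': "assigned (a(24 := (a 24)(?st := 1))) = ?C \<union> {y. a 20 y = ?st}"
      by (auto simp: assigned_def)
    have "sat_inv as M (r(5 := Suc (r 5), 6 := 0)) (a(24 := (a 24)(?st := 1))) \<and>
        sat_measure as M (r(5 := Suc (r 5), 6 := 0)) (a(24 := (a 24)(?st := 1))) < sat_measure as M r a"
      by (rule sat_finish[where mk = "a 20", OF inv lt running _ _ _ _ _ _ _ _ _ _ _ _ C' s])
        (use c R(4,7-11,14) in auto)
    then show "wp W ?c1 ?Q (r(5 := Suc (r 5), 6 := 0), a(24 := (a 24)(?st := 1)))" by simp
  qed (use R lt in auto)
  then show ?thesis using running by (simp add: sat_body_def)
qed

lemma sat_runs:
  assumes b: "bounded W (r, a)" and W: "4 * M + length as + 16 < W" and sk: "skew as M"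
    and l: "linked as (a 17) (a 18) (a 19)" and r20: "r 20 = M"
    and zero: "a 20 = (\<lambda>_. 0)" "a 22 = (\<lambda>_. 0)" "a 24 = (\<lambda>_. 0)" "a 25 = (\<lambda>_. 0)"
  shows "runs W sat_com (100 * (4 * M + length as) + 10) (\<lambda>(r, a). r 0 = (if sat as M then 1 else 0)) (r, a)"
  unfolding sat_com_def
proof (rule runs_loop[OF b, where I = "sat_inv as M" and \<mu> = "sat_measure as M" and K = "4 * M + length as"], goal_cases)
  case 1
  have "assigned a = {}" using zero by (simp add: assigned_def)
  then have "sat_inv as M (r(5 := 0, 6 := 0, 0 := 1)) a"
    using l r20 zero by (simp add: sat_inv_def closed_lits_def)
  moreover have "sat_measure as M (r(5 := 0, 6 := 0, 0 := 1)) a \<le> 4 * M + length as"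
    using potential_le[of as M "assigned a"] by (simp add: sat_measure_def)
  ultimately show ?case using W by simp
next
  case (2 r a)
  then have "r 5 < M" by (simp add: sat_inv_def)
  then show ?case using sat_body_idle sat_body_running 2 W sk by blast
next
  case (3 r a)
  then have "r 5 = M" by (simp add: sat_inv_def)
  then show ?case using 3 total_closed_sat[of as M "assigned a"] by (auto simp: sat_inv_def)
next
  case 4
  show ?case by (simp add: sat_body_def step_com_def assigned_com_def neg_com_def start_com_def)
qed

section \<open>Transfer between a graph and its index graph\<close>

lemma image_edge_mem:
  assumes "inj_on \<phi> V" "e \<subseteq> V" "E \<subseteq> Pow V"
  shows "\<phi> ` e \<in> (`) \<phi> ` E \<longleftrightarrow> e \<in> E"
  using inj_on_image_mem_iff[OF inj_on_image_Pow[OF assms(1)], of e E] assms(2,3) by simp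

lemma path_edge_map: "Suc i < length Q \<Longrightarrow> path_edge (map \<phi> Q) i = \<phi> ` path_edge Q i"
  by (simp add: path_edge_def)

lemma path_edge_subset: "Suc i < length Q \<Longrightarrow> set Q \<subseteq> V \<Longrightarrow> path_edge Q i \<subseteq> V"
  using nth_mem[of i Q] nth_mem[of "Suc i" Q] by (auto simp: path_edge_def)

lemma is_path_map:
  assumes "inj_on \<phi> V" "E \<subseteq> Pow V" "a \<in> V" "b \<in> V" "set Q \<subseteq> V"
  shows "is_path (\<phi> ` V, (`) \<phi> ` E) (\<phi> a) (map \<phi> Q) (\<phi> b) \<longleftrightarrow> is_path (V, E) a Q b"
proof (cases "Q = []")
  case False
  have "hd Q \<in> V" "last Q \<in> V" using False assms(5) by auto
  then have "\<phi> (hd Q) = \<phi> a \<longleftrightarrow> hd Q = a" "\<phi> (last Q) = \<phi> b \<longleftrightarrow> last Q = b"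
    using inj_on_eq_iff[OF assms(1)] assms(3,4) by auto
  moreover have "distinct (map \<phi> Q) \<longleftrightarrow> distinct Q"
    using inj_on_subset[OF assms(1,5)] by (simp add: distinct_map)
  moreover have "path_edge (map \<phi> Q) i \<in> (`) \<phi> ` E \<longleftrightarrow> path_edge Q i \<in> E" if "Suc i < length Q" for i
    unfolding path_edge_map[OF that]
    by (rule image_edge_mem[OF assms(1) path_edge_subset[OF that assms(5)] assms(2)])
  moreover have "set (map \<phi> Q) \<subseteq> \<phi> ` V" using assms(5) by auto
  ultimately show ?thesis using False assms(5) by (auto simp: is_path_def hd_map last_map)
qed (simp add: is_path_def)

lemma conforming_map:
  assumes "inj_on \<phi> V" "\<And>v. v \<in> V \<Longrightarrow> f (\<phi> v) = (`) \<phi> ` g v" "\<And>v. v \<in> V \<Longrightarrow> g v \<subseteq> Pow V" "set Q \<subseteq> V"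
  shows "conforming f (map \<phi> Q) \<longleftrightarrow> conforming g Q"
proof -
  have "path_edge (map \<phi> Q) i \<in> f (map \<phi> Q ! j) \<longleftrightarrow> path_edge Q i \<in> g (Q ! j)"
    if i: "Suc i < length Q" and j: "j \<le> i" for i j
  proof -
    have "Q ! j \<in> V" using i j assms(4) nth_mem[of j Q] by auto
    then have "f (map \<phi> Q ! j) = (`) \<phi> ` g (Q ! j)" using assms(2) i j by simp
    then show ?thesis
      unfolding path_edge_map[OF i]
      using image_edge_mem[OF assms(1) path_edge_subset[OF i assms(4)] assms(3)[OF \<open>Q ! j \<in> V\<close>]] by simp
  qed
  then show ?thesis by (auto simp: conforming_def)
qed

lemma image_lessThan: "g ` {..<L :: nat} = {g i | i. i < L}"
  by auto

lemma is_cycle_map: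
  assumes "inj_on \<phi> V" "is_cycle (V, E) C"
  shows "is_cycle (\<phi> ` V, (`) \<phi> ` E) ((`) \<phi> ` C)"
proof -
  obtain p where p: "3 \<le> length p" "distinct p" "set p \<subseteq> V" "C \<subseteq> E"
    "C = {{p ! i, p ! (Suc i mod length p)} | i. i < length p}"
    using assms(2) by (auto simp: is_cycle_def)
  have "C = (\<lambda>i. {p ! i, p ! (Suc i mod length p)}) ` {..<length p}" unfolding p(5) by auto
  then have "(`) \<phi> ` C = (\<lambda>i. {\<phi> (p ! i), \<phi> (p ! (Suc i mod length p))}) ` {..<length p}"
    by (simp add: image_image)
  also have "\<dots> = (\<lambda>i. {map \<phi> p ! i, map \<phi> p ! (Suc i mod length p)}) ` {..<length p}"
  proof (rule image_cong)
    fix i assume "i \<in> {..<length p}"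
    then have "i < length p" "Suc i mod length p < length p" by (auto intro: mod_less_divisor)
    then show "{\<phi> (p ! i), \<phi> (p ! (Suc i mod length p))} = {map \<phi> p ! i, map \<phi> p ! (Suc i mod length p)}"
      by simp
  qed simp
  also have "\<dots> = {{map \<phi> p ! i, map \<phi> p ! (Suc i mod length p)} | i. i < length p}"
    by (rule image_lessThan)
  finally have "(`) \<phi> ` C = {{map \<phi> p ! i, map \<phi> p ! (Suc i mod length p)} | i. i < length p}" .
  then have "(`) \<phi> ` C = {{map \<phi> p ! i, map \<phi> p ! (Suc i mod length (map \<phi> p))} | i. i < length (map \<phi> p)}"
    by (simp only: length_map)
  moreover have "(`) \<phi> ` C \<subseteq> (`) \<phi> ` E" using p(4) by (rule image_mono)
  moreover have "distinct (map \<phi> p)" "3 \<le> length (map \<phi> p)" "set (map \<phi> p) \<subseteq> \<phi> ` V"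
    using p(1-3) inj_on_subset[OF assms(1) p(3)] by (auto simp: distinct_map)
  ultimately show ?thesis unfolding is_cycle_def fst_conv snd_conv by blast
qed

text \<open>Two cycles through a common edge have images through a common edge, which are equal;
  taking images is injective on sets of edges within \<open>V\<close>. With \<open>\<phi>\<close>
  looking up a vertex by its index, the promise passes from the input graph to the index
  graph.\<close>

lemma cactus_map:
  assumes inj: "inj_on \<phi> V" and simple: "finite_simple_graph (V, E)" and c: "cactus (\<phi> ` V, (`) \<phi> ` E)"
  shows "cactus (V, E)"
  unfolding cactus_def
proof (intro conjI ballI allI impI simple)
  fix e C D assume *: "is_cycle (V, E) C \<and> is_cycle (V, E) D \<and> e \<in> C \<and> e \<in> D" and e: "e \<in> snd (V, E)"
  have E: "E \<subseteq> Pow V" using simple by (auto simp: finite_simple_graph_def)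
  have "is_cycle (\<phi> ` V, (`) \<phi> ` E) ((`) \<phi> ` C)" "is_cycle (\<phi> ` V, (`) \<phi> ` E) ((`) \<phi> ` D)"
    using is_cycle_map[OF inj] * by auto
  moreover have "\<phi> ` e \<in> (`) \<phi> ` C" "\<phi> ` e \<in> (`) \<phi> ` D" "\<phi> ` e \<in> (`) \<phi> ` E" using * e by auto
  ultimately have "(`) \<phi> ` C = (`) \<phi> ` D" using c unfolding cactus_def snd_conv by blast
  moreover have "B \<subseteq> Pow V" if "is_cycle (V, E) B" for B
    using that E unfolding is_cycle_def snd_conv by blast
  then have "C \<subseteq> Pow V" "D \<subseteq> Pow V" using * by auto
  ultimately show "C = D" using inj_on_image_eq_iff[OF inj_on_image_Pow[OF inj], of C D] by metis
qed

lemma ex_conforming_map: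
  assumes "inj_on \<phi> V" "E \<subseteq> Pow V" "a \<in> V" "b \<in> V"
    and "\<And>v. v \<in> V \<Longrightarrow> f (\<phi> v) = (`) \<phi> ` g v" "\<And>v. v \<in> V \<Longrightarrow> g v \<subseteq> Pow V"
  shows "(\<exists>Q. is_path (\<phi> ` V, (`) \<phi> ` E) (\<phi> a) Q (\<phi> b) \<and> conforming f Q) \<longleftrightarrow>
    (\<exists>Q. is_path (V, E) a Q b \<and> conforming g Q)"
proof
  assume "\<exists>Q. is_path (\<phi> ` V, (`) \<phi> ` E) (\<phi> a) Q (\<phi> b) \<and> conforming f Q"
  then obtain Q where Q: "is_path (\<phi> ` V, (`) \<phi> ` E) (\<phi> a) Q (\<phi> b)" "conforming f Q" by blast
  define P where "P = map (inv_into V \<phi>) Q"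
  have sub: "set Q \<subseteq> \<phi> ` V" using Q(1) by (simp add: is_path_def)
  then have "map \<phi> P = Q" unfolding P_def by (auto simp: map_idI f_inv_into_f subset_iff)
  moreover have "set P \<subseteq> V" using sub by (auto simp: P_def inv_into_into subset_iff)
  ultimately show "\<exists>Q. is_path (V, E) a Q b \<and> conforming g Q"
    using Q is_path_map[OF assms(1-4), of P] conforming_map[of \<phi> V f g P, OF assms(1,5,6)] by auto
next
  assume "\<exists>Q. is_path (V, E) a Q b \<and> conforming g Q"
  then obtain Q where Q: "is_path (V, E) a Q b" "conforming g Q" by blast
  then have "set Q \<subseteq> V" by (simp add: is_path_def)
  then show "\<exists>Q. is_path (\<phi> ` V, (`) \<phi> ` E) (\<phi> a) Q (\<phi> b) \<and> conforming f Q"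
    using Q is_path_map[OF assms(1-4), of Q] conforming_map[of \<phi> V f g Q, OF assms(1,5,6)] by blast
qed

section \<open>The decision procedure\<close>

lemma (in indexed_cactus) search_tree_queued:
  assumes tree: "search_tree (arc_list eu ew m) n s q N par dep"
  shows "queued_cactus n m eu ew s (q ` {..<N}) par dep q N"
proof -
  have N: "1 \<le> N" "N \<le> n" and inj: "inj_on q {..<N}" and range: "q ` {..<N} \<subseteq> {..<n}" and q0: "q 0 = s"
    and ps: "par s = s" and ds: "dep s = 0" and dep: "\<forall>i<N. dep (q i) \<le> i"
    using tree by (auto simp: search_tree_def)
  have step: "\<exists>j<i. par (q i) = q j \<and> dep (q i) = Suc (dep (q j)) \<and> (q j, q i) \<in> set (arc_list eu ew m)"
    if "0 < i" "i < N" for i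
    using tree that unfolding search_tree_def by blast
  have closed: "y \<in> q ` {..<N}" if "x \<in> q ` {..<N}" "(x, y) \<in> set (arc_list eu ew m)" for x y
  proof -
    have "\<forall>i<N. \<forall>y. (q i, y) \<in> set (arc_list eu ew m) \<longrightarrow> y \<in> q ` {..<N}"
      using tree unfolding search_tree_def by (elim conjE) assumption
    then show ?thesis using that by blast
  qed
  have tree_vertex: "\<exists>i j. v = q i \<and> 0 < i \<and> i < N \<and> j < i \<and> par v = q j \<and> dep v = Suc (dep (par v)) \<and>
      (par v, v) \<in> set (arc_list eu ew m)" if v: "v \<in> q ` {..<N}" "v \<noteq> s" for v
  proof -
    obtain i where i: "i < N" "v = q i" using v by auto
    then have "0 < i" using v q0 by (cases i) auto
    then show ?thesis using step[of i] i by metis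
  qed
  show ?thesis
  proof unfold_locales
    fix k assume k: "k < m"
    have "(eu k, ew k) \<in> set (arc_list eu ew m)" "(ew k, eu k) \<in> set (arc_list eu ew m)"
      using k by (auto simp: set_arc_list)
    then show "(eu k \<in> q ` {..<N}) = (ew k \<in> q ` {..<N})" using closed by blast
  next
    fix v assume v: "v \<in> q ` {..<N}" "v \<noteq> s"
    obtain i j where ij: "v = q i" "0 < i" "i < N" "j < i" "par v = q j" "dep v = Suc (dep (par v))"
      "(par v, v) \<in> set (arc_list eu ew m)" using tree_vertex[OF v] by blast
    then show "par v \<in> q ` {..<N}" "dep v = Suc (dep (par v))" by auto
    show "\<exists>k<m. {eu k, ew k} = {v, par v}" using ij(7) by (auto simp: set_arc_list)
  next
    fix v assume "v \<in> q ` {..<N}"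
    then obtain i where "i < N" "v = q i" by auto
    then show "dep v < n" using dep N by fastforce
  next
    fix i assume "0 < i" "i < N"
    then show "par (q i) \<in> q ` {..<i}" using step[of i] by auto
  qed (use N inj range q0 ps ds in auto)
qed

text \<open>Justifies the negative answer when the search has not reached \<open>t\<close>:
  \<open>R\<close> cannot be left along an edge.\<close>

lemma (in rooted_cactus) path_reached:
  assumes "is_path G s Q t"
  shows "t \<in> R"
proof -
  have "i < length Q \<Longrightarrow> Q ! i \<in> R" for i
  proof (induction i)
    case 0
    then show ?case using assms s_R by (auto simp: is_path_def hd_conv_nth)
  next
    case (Suc i)
    then have "path_edge Q i \<in> snd G" "Q ! i \<in> R" using assms by (auto simp: is_path_def)
    then obtain k where "k < m" "{Q ! i, Q ! Suc i} = {eu k, ew k}" by (auto simp: path_edge_def)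
    then show ?case using R_closed[of k] \<open>Q ! i \<in> R\<close> by (auto simp: doubleton_eq_iff)
  qed
  then have "Q ! (length Q - 1) \<in> R" using assms by (simp add: is_path_def)
  then show ?thesis using assms last_conv_nth[of Q] by (auto simp: is_path_def)
qed

lemma (in queued_cactus) base_spec_search:
  assumes "t \<in> R" "base_spec t base"
  shows "search_cactus n m eu ew s R par dep q N t base"
  by unfold_locales (use assms in \<open>auto simp: base_spec_def\<close>)

context search_cactus
begin

lemma weights_bound: "v \<in> R \<Longrightarrow> MW v \<noteq> PW v \<Longrightarrow> MW v - PW v - 1 < m \<and> PW v - MW v - 1 < m"
proof -
  assume "v \<in> R" and ne: "MW v \<noteq> PW v"
  from \<open>v \<in> R\<close> show ?thesis
  proof (cases rule: weight_cases)
    case (out k)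
    then show ?thesis using rel_less[of k] by simp
  next
    case (into k)
    then show ?thesis using rel_less[of k] by simp
  qed (use ne in simp)
qed

lemma vlit_less: "vlit v < 2 * Suc m"
  using weights_bound[of v] lits_unreached[of v] by (cases "v \<in> R") (auto simp: vlit_def)

lemma tlit_less: "tlit v < 2 * Suc m"
  using weights_bound[of v] lits_unreached[of v] vlit_less[of v] by (cases "v \<in> R") (auto simp: tlit_def)

lemma elit_less: "k < m \<Longrightarrow> elit k < 2 * Suc m"
  using tlit_less by (auto simp: elit_def)

end

lemma lval_neg: "l < 2 * Suc m \<Longrightarrow> lval m x (neg_lit (Suc m) l) \<longleftrightarrow> \<not> lval m x l"
  by (auto simp: lval_def neg_lit_def)

text \<open>The extra arc makes variable \<open>m\<close> true in every model, so on literals below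
  \<open>2 * Suc m\<close> a model \<open>V\<close> agrees with \<open>lval m V\<close>, and
  conversely every \<open>lval m x\<close> is a model of that arc.\<close>

lemma sat_clauses_iff:
  assumes lits: "\<And>v k. (v, k) \<in> S \<Longrightarrow> vl v < 2 * Suc m \<and> el k < 2 * Suc m"
    and as: "set as = insert (Suc m + m, m) (clause_arcs (Suc m) vl vp el ep S)"
  shows "skew as (Suc m)"
    and "sat as (Suc m) \<longleftrightarrow> (\<exists>x. \<forall>(v, k)\<in>S. vp v \<le> ep k \<longrightarrow> \<not> (lval m x (vl v) \<and> lval m x (el k)))"
proof -
  show "skew as (Suc m)"
    unfolding skew_def as using lits neg_lit_simps[where M = "Suc m"]
    by (fastforce simp: clause_arcs_def neg_lit_def)
  show "sat as (Suc m) \<longleftrightarrow> (\<exists>x. \<forall>(v, k)\<in>S. vp v \<le> ep k \<longrightarrow> \<not> (lval m x (vl v) \<and> lval m x (el k)))"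
  proof
    assume "sat as (Suc m)"
    then obtain V where V: "\<forall>l<Suc m. V (l + Suc m) \<longleftrightarrow> \<not> V l" "\<forall>(x, y)\<in>set as. V x \<longrightarrow> V y"
      by (auto simp: sat_def)
    have "V m" using V(1)[rule_format, of m] V(2) as by (auto simp: add.commute)
    have lv: "lval m V l \<longleftrightarrow> V l" if "l < 2 * Suc m" for l
    proof (cases "l \<le> m")
      case True
      then show ?thesis using \<open>V m\<close> by (auto simp: lval_def)
    next
      case False
      then obtain i where "l = i + Suc m" by (metis add.commute le_add_diff_inverse not_less_eq_eq)
      then show ?thesis using V(1) \<open>V m\<close> that by (auto simp: lval_def)
    qed
    have "\<not> (lval m V (vl v) \<and> lval m V (el k))" if "(v, k) \<in> S" "vp v \<le> ep k" for v k
    proof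
      assume a: "lval m V (vl v) \<and> lval m V (el k)"
      note l = lits[OF that(1)]
      have "(vl v, neg_lit (Suc m) (el k)) \<in> set as" using that as by (auto simp: clause_arcs_def)
      then have "V (neg_lit (Suc m) (el k))" using V(2) a lv l by auto
      then have "lval m V (neg_lit (Suc m) (el k))" using lv neg_lit_simps(1)[of "el k" "Suc m"] l by blast
      then show False using lval_neg l a by blast
    qed
    then show "\<exists>x. \<forall>(v, k)\<in>S. vp v \<le> ep k \<longrightarrow> \<not> (lval m x (vl v) \<and> lval m x (el k))" by blast
  next
    assume "\<exists>x. \<forall>(v, k)\<in>S. vp v \<le> ep k \<longrightarrow> \<not> (lval m x (vl v) \<and> lval m x (el k))"
    then obtain x where x: "\<And>v k. (v, k) \<in> S \<Longrightarrow> vp v \<le> ep k \<Longrightarrow> \<not> (lval m x (vl v) \<and> lval m x (el k))"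
      by blast
    show "sat as (Suc m)"
      unfolding sat_def
    proof (intro exI[of _ "lval m x"] conjI allI impI ballI)
      fix l assume "l < Suc m"
      then show "lval m x (l + Suc m) = (\<not> lval m x l)"
        using lval_neg[of l m x] by (simp add: neg_lit_def)
    next
      fix e assume "e \<in> set as"
      then consider "e = (Suc m + m, m)"
        | v k where "(v, k) \<in> S" "vp v \<le> ep k" "e = (vl v, neg_lit (Suc m) (el k))"
        | v k where "(v, k) \<in> S" "vp v \<le> ep k" "e = (el k, neg_lit (Suc m) (vl v))"
        by (auto simp: as clause_arcs_def)
      then show "case e of (y, z) \<Rightarrow> lval m x y \<longrightarrow> lval m x z"
      proof cases
        case (2 v k)
        then show ?thesis using x[of v k] lits[of v k] lval_neg by auto
      next
        case (3 v k)
        then show ?thesis using x[of v k] lits[of v k] lval_neg by auto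
      qed simp
    qed
  qed
qed

lemmas com_defs = load_edge_def addarc_def build_adjacency_def bfs_init_def bfs_body_def accumulate_def
  mark_com_def base_com_def put_weight_def weight_com_def vlit_com_def tlit_com_def elit_com_def neg_com_def
  clause_init_def clause_body_def clause_com_def

lemma runs_Seq_pair:
  assumes "runs W c T (\<lambda>(r, a). P r a) (r, a)" "bounded W (r, a)"
    and "\<And>r' a'. bounded W (r', a') \<Longrightarrow> (\<And>x. x \<notin> wregs c \<Longrightarrow> r' x = r x) \<Longrightarrow>
      (\<And>A. A \<notin> warrs c \<Longrightarrow> a' A = a A) \<Longrightarrow> P r' a' \<Longrightarrow> runs W d T' Q (r', a')"
  shows "runs W (Seq c d) (T + T') Q (r, a)"
proof (rule runs_Seq[OF assms(1,2)])
  fix \<tau> assume \<tau>: "bounded W \<tau>" "frame c (r, a) \<tau>" "case \<tau> of (r, a) \<Rightarrow> P r a"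
  obtain r' a' where ra: "\<tau> = (r', a')" by (cases \<tau>)
  show "runs W d T' Q \<tau>"
    unfolding ra using \<tau> ra by (intro assms(3)) (auto simp: frame_def)
qed

lemma runs_Cond:
  assumes "holds \<sigma> b \<Longrightarrow> runs W c T Q \<sigma>" "\<not> holds \<sigma> b \<Longrightarrow> runs W d T Q \<sigma>"
  shows "runs W (Cond b c d) (Suc T) Q \<sigma>"
proof (cases "holds \<sigma> b")
  case True
  then obtain k \<tau> where k: "exec W c \<sigma> k \<tau>" "k \<le> T" "bounded W \<tau>" "Q \<tau>"
    using assms(1) by (auto simp: runs_def)
  then have "exec W (Cond b c d) \<sigma> (Suc k) \<tau>" using exec_CondTrue True by blast
  then show ?thesis
    unfolding runs_def using k exec_frame by (intro exI[of _ "Suc k"] exI[of _ \<tau>]) auto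
next
  case False
  then obtain k \<tau> where k: "exec W d \<sigma> k \<tau>" "k \<le> T" "bounded W \<tau>" "Q \<tau>"
    using assms(2) by (auto simp: runs_def)
  then have "exec W (Cond b c d) \<sigma> (Suc k) \<tau>" using exec_CondFalse False by blast
  then show ?thesis
    unfolding runs_def using k exec_frame by (intro exI[of _ "Suc k"] exI[of _ \<tau>]) auto
qed

definition two_sat_com :: com where
  "two_sat_com = Seq weight_com (Seq (accumulate 10) (Seq (accumulate 11) (Seq vlit_com (Seq elit_com
     (Seq clause_com sat_com)))))"

definition decide_com :: com where
  "decide_com = Seq (seqs [Load 1 0 (Const 0), Load 2 0 (Const 1), Load 3 0 (Const 2), Load 4 0 (Const 3)])
     (Seq build_adjacency (Seq (Seq bfs_init (While (Less (Reg 11) (Reg 12)) bfs_body)) (Seq mark_com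
       (Seq (Load 6 8 (Reg 3)) (Cond (Equal (Reg 6) (Const 0)) (Assign 0 (Const 0)) (Seq base_com two_sat_com))))))"

lemma (in search_cactus) two_sat_runs:
  fixes fs :: "nat list list"
  defines "L \<equiv> length (encode_lists fs)"
  assumes b: "bounded W (r, a)" and W: "2 * n * n + m * m + 20 * (n + m + L) + 100 < W"
    and pre: "r 1 = n" "r 2 = m" "r 12 = N" "a 0 = inp" "a 4 = q" "a 5 = par" "a 6 = dep"
      "a 8 = (\<lambda>v. if t \<in> sub v then 1 else 0)" "a 9 = base"
    and zero: "\<And>A. A \<in> {10, 11, 17, 20, 22, 24, 25} \<Longrightarrow> a A = (\<lambda>_. 0)"
    and eu: "eu = (\<lambda>k. inp (k + k + 4))" and ew: "ew = (\<lambda>k. inp (k + k + 5))"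
    and base_le: "\<And>v. base v \<le> 2 * n * n" and dep_le: "\<And>v. dep v \<le> n"
    and fs: "length fs = n" "\<forall>l\<in>set fs. set l \<subseteq> {..<m}" and reads: "reads inp (2 * m + 4) (encode_lists fs)"
  shows "runs W two_sat_com (1000 * (n + m + L + 1)) (\<lambda>(r, a). r 0 =
    (if \<exists>Q. is_path G s Q t \<and> conforming (\<lambda>v. (\<lambda>k. {eu k, ew k}) ` set (fs ! v)) Q then 1 else 0)) (r, a)"
proof -
  define S where "S = {(v, k). v < n \<and> k \<in> set (fs ! v)}"
  define Y where "Y \<longleftrightarrow> (\<exists>Q. is_path G s Q t \<and> conforming (\<lambda>v. (\<lambda>k. {eu k, ew k}) ` set (fs ! v)) Q)"
  have F: "set (fs ! v) \<subseteq> {..<m}" if "v < n" for v using fs that by auto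
  have Y: "Y \<longleftrightarrow> (\<exists>x. \<forall>(v, k)\<in>S. vpos v \<le> epos k \<longrightarrow> \<not> (lval m x (vlit v) \<and> lval m x (elit k)))"
    unfolding Y_def S_def using conforming_path_iff[of "\<lambda>v. set (fs ! v)", OF F] by fastforce
  have Slit: "vlit v < 2 * Suc m \<and> elit k < 2 * Suc m" if "(v, k) \<in> S" for v k
    using that F vlit_less elit_less by (auto simp: S_def)
  let ?P = "\<lambda>(r, a). r 0 = (if Y then 1 else 0)" and ?mark = "\<lambda>v. if t \<in> sub v then 1 else 0"
  \<comment> \<open>The remaining programs with their time bounds, innermost first, so that each
    sequential rule peels off one phase.\<close>
  let ?c5 = "Seq clause_com sat_com" and ?T5 = "(30 * L + 60) + (100 * (4 * Suc m + 2 * L) + 10)"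
  let ?c4 = "Seq elit_com ?c5" and ?T4 = "(30 * m + 5) + ?T5"
  let ?c3 = "Seq vlit_com ?c4" and ?T3 = "(30 * n + 5) + ?T4"
  let ?c2 = "Seq (accumulate 11) ?c3" and ?T2 = "(8 * N + 3) + ?T3"
  let ?c1 = "Seq (accumulate 10) ?c2" and ?T1 = "(8 * N + 3) + ?T2"
  have "runs W two_sat_com ((25 * m + 3) + ?T1) ?P (r, a)"
    unfolding two_sat_com_def
  proof (rule runs_Seq_pair[OF weight_runs[OF b] b])
    fix r1 a1
    assume b1: "bounded W (r1, a1)" and fr1: "\<And>x. x \<notin> wregs weight_com \<Longrightarrow> r1 x = r x"
      "\<And>A. A \<notin> warrs weight_com \<Longrightarrow> a1 A = a A"
      and p1: "a1 10 = tail_weight m \<and> a1 11 = head_weight m \<and> (\<forall>k. rel k \<longrightarrow> a1 12 k = base (head k))"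
    have e1: "r1 1 = n" "r1 2 = m" "r1 12 = N" "a1 0 = inp" "a1 4 = q" "a1 5 = par" "a1 6 = dep"
      "a1 8 = ?mark" "a1 9 = base"
      "\<And>A. A \<in> {17, 20, 22, 24, 25} \<Longrightarrow> a1 A = (\<lambda>_. 0)"
      using pre zero fr1 by (auto simp: com_defs)
    show "runs W ?c1 ?T1 ?P (r1, a1)"
    proof (rule runs_Seq_pair[OF accumulate_runs[where g = "tail_weight m", OF b1] b1])
      show "sum (tail_weight m) R + 16 < W" using sum_weight_R(1) W by linarith
    next
      fix r2 a2
      assume b2: "bounded W (r2, a2)" and fr2: "\<And>x. x \<notin> wregs (accumulate 10) \<Longrightarrow> r2 x = r1 x"
        "\<And>A. A \<notin> warrs (accumulate 10) \<Longrightarrow> a2 A = a1 A" and p2: "a2 10 = subtree_sum (tail_weight m)"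
      have e2: "r2 1 = n" "r2 2 = m" "r2 12 = N" "a2 0 = inp" "a2 4 = q" "a2 5 = par" "a2 6 = dep"
        "a2 8 = ?mark" "a2 9 = base" "a2 11 = head_weight m"
        "\<forall>k. rel k \<longrightarrow> a2 12 k = base (head k)"
        "\<And>A. A \<in> {17, 20, 22, 24, 25} \<Longrightarrow> a2 A = (\<lambda>_. 0)"
        using e1 p1 fr2 by (auto simp: com_defs)
      show "runs W ?c2 ?T2 ?P (r2, a2)"
      proof (rule runs_Seq_pair[OF accumulate_runs[where g = "head_weight m", OF b2] b2])
        show "sum (head_weight m) R + 16 < W" using sum_weight_R(2) W by linarith
      next
        fix r3 a3
        assume b3: "bounded W (r3, a3)" and fr3: "\<And>x. x \<notin> wregs (accumulate 11) \<Longrightarrow> r3 x = r2 x"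
          "\<And>A. A \<notin> warrs (accumulate 11) \<Longrightarrow> a3 A = a2 A" and p3: "a3 11 = subtree_sum (head_weight m)"
        have e3: "r3 1 = n" "r3 2 = m" "a3 0 = inp" "a3 5 = par" "a3 6 = dep"
          "a3 8 = ?mark" "a3 9 = base" "a3 10 = PW" "a3 11 = MW"
          "\<forall>k. rel k \<longrightarrow> a3 12 k = base (head k)"
          "\<And>A. A \<in> {17, 20, 22, 24, 25} \<Longrightarrow> a3 A = (\<lambda>_. 0)"
          using e2 p2 p3 fr3 subtree_weights by (auto simp: com_defs)
        show "runs W ?c3 ?T3 ?P (r3, a3)"
        proof (rule runs_Seq_pair[OF vlit_runs[OF b3] b3])
          fix r4 a4
          assume b4: "bounded W (r4, a4)" and fr4: "\<And>x. x \<notin> wregs vlit_com \<Longrightarrow> r4 x = r3 x"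
            "\<And>A. A \<notin> warrs vlit_com \<Longrightarrow> a4 A = a3 A"
            and p4: "r4 20 = Suc m \<and> r4 21 = Suc m + m \<and> (\<forall>v<n. a4 13 v = vlit v \<and> a4 14 v = vpos v)"
          have e4: "r4 1 = n" "r4 2 = m" "a4 0 = inp" "a4 5 = par"
            "a4 8 = ?mark" "a4 9 = base" "a4 10 = PW" "a4 11 = MW"
            "\<And>A. A \<in> {17, 20, 22, 24, 25} \<Longrightarrow> a4 A = (\<lambda>_. 0)"
            using e3 fr4 by (auto simp: com_defs)
          show "runs W ?c4 ?T4 ?P (r4, a4)"
          proof (rule runs_Seq_pair[OF elit_runs[OF b4] b4])
            fix r5 a5
            assume b5: "bounded W (r5, a5)" and fr5: "\<And>x. x \<notin> wregs elit_com \<Longrightarrow> r5 x = r4 x"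
              "\<And>A. A \<notin> warrs elit_com \<Longrightarrow> a5 A = a4 A"
              and p5: "\<forall>k<m. a5 15 k = elit k \<and> a5 16 k = epos k"
            have e5: "r5 1 = n" "r5 2 = m" "a5 0 = inp" "r5 20 = Suc m" "r5 21 = Suc m + m"
              "\<forall>v<n. a5 13 v = vlit v \<and> a5 14 v = vpos v"
              "\<And>A. A \<in> {17, 20, 22, 24, 25} \<Longrightarrow> a5 A = (\<lambda>_. 0)"
              using e4 p4 fr5 by (auto simp: com_defs)
            show "runs W ?c5 ?T5 ?P (r5, a5)"
            proof (rule runs_Seq_pair[OF clause_runs[where fs = fs, folded L_def, OF b5] b5])
              fix r6 a6
              assume b6: "bounded W (r6, a6)" and fr6: "\<And>x. x \<notin> wregs clause_com \<Longrightarrow> r6 x = r5 x"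
                "\<And>A. A \<notin> warrs clause_com \<Longrightarrow> a6 A = a5 A"
                and p6: "\<exists>as. linked as (a6 17) (a6 18) (a6 19) \<and> length as \<le> 2 * L \<and>
                  set as = insert (Suc m + m, m) (clause_arcs (Suc m) vlit vpos elit epos {(v, k). v < n \<and> k \<in> set (fs ! v)})"
              obtain as where as: "linked as (a6 17) (a6 18) (a6 19)" "length as \<le> 2 * L"
                "set as = insert (Suc m + m, m) (clause_arcs (Suc m) vlit vpos elit epos S)"
                using p6 by (auto simp: S_def)
              have e6: "r6 20 = Suc m" "\<And>A. A \<in> {20, 22, 24, 25} \<Longrightarrow> a6 A = (\<lambda>_. 0)"
                using e5 fr6 by (auto simp: com_defs)
              note sat = sat_clauses_iff[OF Slit as(3)]
              have "runs W sat_com (100 * (4 * Suc m + length as) + 10)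
                  (\<lambda>(r, a). r 0 = (if sat as (Suc m) then 1 else 0)) (r6, a6)"
                by (rule sat_runs[OF b6 _ sat(1) as(1)]) (use e6 as(2) W in auto)
              then show "runs W sat_com (100 * (4 * Suc m + 2 * L) + 10) ?P (r6, a6)"
                by (rule runs_mono) (use as(2) sat(2) Y in auto)
            qed (use e5 p5 fs reads W vlit_less elit_less n_pos in auto)
          qed (use e4 p4 W eu ew in auto)
        qed (use e3 W base_le dep_le in auto)
      qed (use e2 in auto)
    qed (use e1 p1 in auto)
  qed (use pre zero W eu ew in auto)
  then show ?thesis
    unfolding Y_def by (rule runs_mono) (use N_le in auto)
qed

text \<open>The demand on \<open>W\<close> collects the bases, up to \<open>2 * n * n\<close>, the
  weight sums, up to \<open>m * m\<close>, and counters, literals and addresses, which are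
  linear.\<close>

lemma (in indexed_cactus) decide_runs:
  fixes fs :: "nat list list"
  defines "L \<equiv> length (encode_lists fs)"
  assumes b: "bounded W (r, a)" and W: "2 * n * n + m * m + 20 * (n + m + L) + 100 < W"
    and inp: "a 0 = inp" "inp 0 = n" "inp 1 = m" "inp 2 = s" "inp 3 = t" and st: "s < n" "t < n"
    and zero: "\<And>A. A \<noteq> 0 \<Longrightarrow> a A = (\<lambda>_. 0)"
    and eu: "eu = (\<lambda>k. inp (k + k + 4))" and ew: "ew = (\<lambda>k. inp (k + k + 5))"
    and fs: "length fs = n" "\<forall>l\<in>set fs. set l \<subseteq> {..<m}" and reads: "reads inp (2 * m + 4) (encode_lists fs)"
  shows "runs W decide_com (2000 * (n + m + L + 1)) (\<lambda>(r, a). r 0 =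
    (if \<exists>Q. is_path G s Q t \<and> conforming (\<lambda>v. (\<lambda>k. {eu k, ew k}) ` set (fs ! v)) Q then 1 else 0)) (r, a)"
proof -
  define Y where "Y \<longleftrightarrow> (\<exists>Q. is_path G s Q t \<and> conforming (\<lambda>v. (\<lambda>k. {eu k, ew k}) ` set (fs ! v)) Q)"
  let ?as = "arc_list eu ew m"
  let ?P = "\<lambda>(r, a). r 0 = (if Y then 1 else 0)"
  let ?bfs = "Seq bfs_init (While (Less (Reg 11) (Reg 12)) bfs_body)"
  let ?read = "seqs [Load 1 0 (Const 0), Load 2 0 (Const 1), Load 3 0 (Const 2), Load 4 0 (Const 3)]"
  let ?c6 = "Seq base_com two_sat_com" and ?T6 = "(10 * n + 4) + 1000 * (n + m + L + 1)"
  let ?c5 = "Cond (Equal (Reg 6) (Const 0)) (Assign 0 (Const 0)) ?c6"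
  let ?c4 = "Seq (Load 6 8 (Reg 3)) ?c5" and ?T4 = "1 + Suc ?T6"
  let ?c3 = "Seq mark_com ?c4" and ?T3 = "(8 * n + 4) + ?T4"
  let ?c2 = "Seq ?bfs ?c3" and ?T2 = "(20 * (n + length ?as) + 20) + ?T3"
  let ?c1 = "Seq build_adjacency ?c2" and ?T1 = "(20 * m + 3) + ?T2"
  have "runs W decide_com (4 + ?T1) ?P (r, a)"
    unfolding decide_com_def
  proof (rule runs_Seq_pair[OF runs_wp[OF b] b, where P = "\<lambda>r a. r 1 = n \<and> r 2 = m \<and> r 3 = s \<and> r 4 = t"])
    fix r1 a1
    assume b1: "bounded W (r1, a1)"
      and fr1: "\<And>A. A \<notin> warrs ?read \<Longrightarrow> a1 A = a A"
      and p1: "r1 1 = n \<and> r1 2 = m \<and> r1 3 = s \<and> r1 4 = t"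
    have e1: "a1 0 = inp" "\<And>A. A \<noteq> 0 \<Longrightarrow> a1 A = (\<lambda>_. 0)" using fr1 inp zero by auto
    show "runs W ?c1 ?T1 ?P (r1, a1)"
    proof (rule runs_Seq_pair[OF build_adjacency_runs[where eu = eu and ew = ew, OF b1 _ _ _ _ eu ew] b1])
      fix r2 a2
      assume b2: "bounded W (r2, a2)" and fr2: "\<And>x. x \<notin> wregs build_adjacency \<Longrightarrow> r2 x = r1 x"
        "\<And>A. A \<notin> warrs build_adjacency \<Longrightarrow> a2 A = a1 A" and p2: "linked ?as (a2 1) (a2 2) (a2 3)"
      have e2: "r2 1 = n" "r2 2 = m" "r2 3 = s" "r2 4 = t" "a2 0 = inp" "\<And>A. A \<notin> {0, 1, 2, 3} \<Longrightarrow> a2 A = (\<lambda>_. 0)"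
        using fr2 p1 e1 by (auto simp: com_defs)
      have as: "set ?as \<subseteq> {..<n} \<times> {..<n}" using ends_less by (auto simp: set_arc_list)
      show "runs W ?c2 ?T2 ?P (r2, a2)"
      proof (rule runs_Seq_pair[OF bfs_runs[where as = ?as and n = n and s = s, OF b2 _ st(1) e2(3) p2 as] b2])
        fix r3 a3
        assume b3: "bounded W (r3, a3)"
          and fr3: "\<And>x. x \<notin> wregs ?bfs \<Longrightarrow> r3 x = r2 x"
            "\<And>A. A \<notin> warrs ?bfs \<Longrightarrow> a3 A = a2 A"
          and tree: "search_tree ?as n s (a3 4) (r3 12) (a3 5) (a3 6)"
        have e3: "r3 1 = n" "r3 2 = m" "r3 3 = s" "r3 4 = t" "a3 0 = inp" "\<And>A. 8 \<le> A \<Longrightarrow> a3 A = (\<lambda>_. 0)"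
          using fr3 e2 by (auto simp: com_defs)
        define q N par dep R where "q = a3 4" and "N = r3 12" and "par = a3 5" and "dep = a3 6" and "R = q ` {..<N}"
        interpret queued_cactus n m eu ew s R par dep q N
          unfolding R_def by (rule search_tree_queued) (use tree in \<open>simp add: q_def N_def par_def dep_def\<close>)
        have dep_le: "dep v \<le> n" for v using tree by (simp add: search_tree_def dep_def)
        have "runs W ?c3 ((8 * N + 4) + ?T4) ?P (r3, a3)"
        proof (rule runs_Seq_pair[OF mark_runs[where t = t, OF b3] b3])
          fix r4 a4
          assume b4: "bounded W (r4, a4)" and fr4: "\<And>x. x \<notin> wregs mark_com \<Longrightarrow> r4 x = r3 x"
            "\<And>A. A \<notin> warrs mark_com \<Longrightarrow> a4 A = a3 A" and p4: "a4 8 = (\<lambda>v. if t \<in> sub v then 1 else 0)"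
          have e4: "r4 1 = n" "r4 2 = m" "r4 3 = s" "r4 12 = N" "a4 0 = inp" "a4 4 = q" "a4 5 = par" "a4 6 = dep"
            "\<And>A. 9 \<le> A \<Longrightarrow> a4 A = (\<lambda>_. 0)"
            using fr4 e3 by (auto simp: com_defs q_def N_def par_def dep_def)
          show "runs W ?c4 ?T4 ?P (r4, a4)"
          proof (rule runs_Seq_pair[OF runs_wp[OF b4] b4, where P = "\<lambda>r a. r 6 = a4 8 s"])
            fix r5 a5
            assume b5: "bounded W (r5, a5)" and fr5: "\<And>x. x \<notin> wregs (Load 6 8 (Reg 3)) \<Longrightarrow> r5 x = r4 x"
              "\<And>A. A \<notin> warrs (Load 6 8 (Reg 3)) \<Longrightarrow> a5 A = a4 A" and p5: "r5 6 = a4 8 s"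
            have e5: "r5 1 = n" "r5 2 = m" "r5 12 = N" "a5 0 = inp" "a5 4 = q" "a5 5 = par" "a5 6 = dep"
              "\<And>A. 9 \<le> A \<Longrightarrow> a5 A = (\<lambda>_. 0)" "a5 8 = (\<lambda>v. if t \<in> sub v then 1 else 0)"
              using fr5 e4 p4 by auto
            \<comment> \<open>The subtree of the root is all of \<open>R\<close>, so the mark of
              \<open>s\<close> tells whether \<open>t\<close> was reached.\<close>
            have reached: "r5 6 = 0 \<longleftrightarrow> t \<notin> R" using p5 p4 sub_s sub_R s_R by auto
            show "runs W ?c5 (Suc ?T6) ?P (r5, a5)"
            proof (rule runs_Cond)
              assume "holds (r5, a5) (Equal (Reg 6) (Const 0))"
              then have "\<not> Y" using reached path_reached by (auto simp: Y_def)
              then show "runs W (Assign 0 (Const 0)) ?T6 ?P (r5, a5)"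
                by (intro runs_wp[OF b5]) (use W in auto)
            next
              assume "\<not> holds (r5, a5) (Equal (Reg 6) (Const 0))"
              then have tR: "t \<in> R" using reached by simp
              have "runs W ?c6 ((10 * N + 4) + 1000 * (n + m + L + 1)) ?P (r5, a5)"
              proof (rule runs_Seq_pair[OF base_runs[where t = t, OF b5] b5])
                fix r6 a6
                assume b6: "bounded W (r6, a6)" and fr6: "\<And>x. x \<notin> wregs base_com \<Longrightarrow> r6 x = r5 x"
                  "\<And>A. A \<notin> warrs base_com \<Longrightarrow> a6 A = a5 A" and p6: "base_spec t (a6 9)"
                interpret search_cactus n m eu ew s R par dep q N t "a6 9"
                  by (rule base_spec_search[OF tR p6])
                have "r6 1 = n" "r6 2 = m" "r6 12 = N" "a6 0 = inp" "a6 4 = q" "a6 5 = par" "a6 6 = dep"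
                  "\<And>A. A \<in> {10, 11, 17, 20, 22, 24, 25} \<Longrightarrow> a6 A = (\<lambda>_. 0)"
                  "a6 8 = (\<lambda>v. if t \<in> sub v then 1 else 0)"
                  using fr6 e5 by (auto simp: com_defs)
                then show "runs W two_sat_com (1000 * (n + m + L + 1)) ?P (r6, a6)"
                  unfolding Y_def L_def using p6
                  by (intro two_sat_runs[OF b6]) (use W L_def eu ew dep_le fs reads in \<open>auto simp: base_spec_def\<close>)
              qed (use e5 W in auto)
              then show "runs W ?c6 ?T6 ?P (r5, a5)"
                by (rule runs_mono) (use N_le in auto)
            qed
          qed (use e4 in auto)
        qed (use e3 W in \<open>auto simp: q_def N_def par_def\<close>)
        then show "runs W ?c3 ?T3 ?P (r3, a3)"
          by (rule runs_mono) (use N_le in auto)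
      qed (use e2 W in auto)
    qed (use p1 e1 W in auto)
  qed (use inp W in auto)
  then show ?thesis
    unfolding Y_def by (rule runs_mono) (use st in \<open>auto simp: length_arc_list\<close>)
qed

section \<open>From the input word to the index graph\<close>

lemma length_concat_pairs: "length (concat (map (\<lambda>(i, j). [i, j]) es)) = 2 * length es"
  by (induction es) auto

lemma nth_concat_pairs:
  "k < length es \<Longrightarrow> (concat (map (\<lambda>(i, j). [i, j]) es) @ ys) ! (k + k) = fst (es ! k)"
  "k < length es \<Longrightarrow> (concat (map (\<lambda>(i, j). [i, j]) es) @ ys) ! Suc (k + k) = snd (es ! k)"
proof (induction es arbitrary: k)
  case (Cons e es)
  case 1
  then show ?case using Cons.IH(1)[of "k - 1"] by (cases k; cases e) auto
next
  case (Cons e es)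
  case 2
  then show ?case using Cons.IH(2)[of "k - 1"] by (cases k; cases e) auto
qed auto

lemma length_encode_lists: "length (encode_lists fs) = length fs + sum_list (map length fs)"
  by (induction fs) auto

theorem theorem9:
  shows "decidable_in_linear_time
     (\<lambda>I :: nat sd_instance. sd_path_instance I \<and> cactus (fst I))
     sd_path_encodes sd_path_size sd_path_yes"
proof -
  \<comment> \<open>The running time is \<open>2000 * (n + m + L + 1)\<close>; since
    \<open>n \<le> L\<close> and \<open>1 \<le> L\<close>, this is at most
    \<open>6000 * (m + L)\<close>, and \<open>m + L\<close> is the size. The same constant is far
    more than the exponent 10 that the words require.\<close>
  obtain c :: nat where c: "c = 6000" by simp
  show ?thesis
    unfolding decidable_in_linear_time_def
  proof (rule exI[of _ decide_com], rule exI[of _ c], intro allI impI)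
    fix I :: "nat sd_instance" and xs
    assume A: "(sd_path_instance I \<and> cactus (fst I)) \<and> sd_path_encodes I xs"
    obtain V E f s t where I: "I = ((V, E), f, s, t)" by (metis prod.exhaust)
    have inst: "sd_path_instance ((V, E), f, s, t)" and cact: "cactus (V, E)" using A I by auto
    obtain vs :: "nat list" and es fs a b where
      vs: "distinct vs" "set vs = V" and es: "\<forall>k<length es. fst (es ! k) < length vs \<and> snd (es ! k) < length vs"
      and inj: "inj_on (\<lambda>k. {vs ! fst (es ! k), vs ! snd (es ! k)}) {..<length es}"
      and E: "(\<lambda>k. {vs ! fst (es ! k), vs ! snd (es ! k)}) ` {..<length es} = E"
      and fs: "length fs = length vs"
        "\<forall>i<length vs. distinct (fs ! i) \<and> set (fs ! i) \<subseteq> {..<length es} \<and>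
           (\<lambda>k. {vs ! fst (es ! k), vs ! snd (es ! k)}) ` set (fs ! i) = f (vs ! i)"
      and a: "a < length vs" "vs ! a = s" and b: "b < length vs" "vs ! b = t"
      and xs: "xs = [length vs, length es, a, b] @ concat (map (\<lambda>(i, j). [i, j]) es) @ encode_lists fs"
      using A unfolding I sd_path_encodes.simps Let_def by auto
    define n m where "n = length vs" and "m = length es"
    define inp where "inp i = (if i < length xs then xs ! i else 0)" for i
    define eu ew where "eu = (\<lambda>k. inp (k + k + 4))" and "ew = (\<lambda>k. inp (k + k + 5))"
    define L where "L = length (encode_lists fs)"
    define \<phi> where "\<phi> = (!) vs"
    have len: "length xs = 2 * m + 4 + L" unfolding xs m_def L_def by (simp add: length_concat_pairs)
    have ends: "eu k = fst (es ! k)" "ew k = snd (es ! k)" if "k < m" for k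
      using that len nth_concat_pairs[of k es "encode_lists fs"]
      by (simp_all add: eu_def ew_def inp_def xs m_def numeral_eq_Suc)
    have inp0: "inp 0 = n" "inp 1 = m" "inp 2 = a" "inp 3 = b"
      using len by (simp_all add: inp_def xs n_def m_def numeral_eq_Suc)
    have reads: "reads inp (2 * m + 4) (encode_lists fs)"
      unfolding reads_def using len
      by (auto simp: inp_def xs m_def L_def nth_append length_concat_pairs)
    have phi: "inj_on \<phi> {..<n}" unfolding \<phi>_def n_def using vs(1) by (simp add: inj_on_nth)
    have V: "V = \<phi> ` {..<n}" using vs(2) by (auto simp: \<phi>_def n_def in_set_conv_nth)
    let ?e = "\<lambda>k. {eu k, ew k}"
    have img: "{vs ! fst (es ! k), vs ! snd (es ! k)} = \<phi> ` ?e k" if "k < m" for k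
      using ends[OF that] by (simp add: \<phi>_def)
    have E': "E = (`) \<phi> ` (?e ` {..<m})"
      unfolding E[symmetric] image_image using img by (intro image_cong) (auto simp: m_def)
    have F: "set (fs ! i) \<subseteq> {..<m}" "f (\<phi> i) = (`) \<phi> ` (?e ` set (fs ! i))" if "i < n" for i
    proof -
      show *: "set (fs ! i) \<subseteq> {..<m}" using fs(2) that by (auto simp: n_def m_def)
      have "f (\<phi> i) = (\<lambda>k. {vs ! fst (es ! k), vs ! snd (es ! k)}) ` set (fs ! i)"
        using fs(2) that by (simp add: n_def \<phi>_def)
      also have "\<dots> = (\<lambda>k. \<phi> ` ?e k) ` set (fs ! i)" using img * by (intro image_cong) auto
      finally show "f (\<phi> i) = (`) \<phi> ` (?e ` set (fs ! i))" by (simp only: image_image)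
    qed
    have less: "eu k < n" "ew k < n" if "k < m" for k using ends[OF that] es that by (auto simp: n_def m_def)
    have inj': "inj_on ?e {..<m}"
    proof (rule inj_onI)
      fix k l assume kl: "k \<in> {..<m}" "l \<in> {..<m}" "?e k = ?e l"
      then have "\<phi> ` ?e k = \<phi> ` ?e l" by simp
      then show "k = l" using inj_onD[OF inj, of k l] img[of k] img[of l] kl by (simp add: m_def)
    qed
    \<comment> \<open>A loop in the index graph would map to a one-element edge of the given simple
      graph.\<close>
    have simple: "finite_simple_graph ({..<n}, ?e ` {..<m})"
    proof -
      have "eu k \<noteq> ew k" if "k < m" for k
      proof
        assume eq: "eu k = ew k"
        have "\<phi> ` ?e k \<in> E" unfolding E' using that by (intro imageI) simp
        then obtain u v where "\<phi> ` ?e k = {u, v}" "u \<noteq> v"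
          using cact unfolding cactus_def finite_simple_graph_def by auto
        then show False using eq by (auto simp: doubleton_eq_iff)
      qed
      then show ?thesis using less by (fastforce simp: finite_simple_graph_def)
    qed
    interpret indexed_cactus n m eu ew
    proof
      show "cactus ({..<n}, ?e ` {..<m})" using cactus_map[OF phi simple] cact V E' by simp
    qed (use less inj' in auto)
    have yes: "sd_path_yes I \<longleftrightarrow>
        (\<exists>Q. is_path ({..<n}, ?e ` {..<m}) a Q b \<and> conforming (\<lambda>v. ?e ` set (fs ! v)) Q)"
    proof -
      have "?e ` {..<m} \<subseteq> Pow {..<n}" using less by auto
      moreover have "?e ` set (fs ! v) \<subseteq> Pow {..<n}" if "v < n" for v using F(1)[OF that] less by auto
      ultimately have "(\<exists>Q. is_path (\<phi> ` {..<n}, (`) \<phi> ` (?e ` {..<m})) (\<phi> a) Q (\<phi> b) \<and> conforming f Q) \<longleftrightarrow>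
          (\<exists>Q. is_path ({..<n}, ?e ` {..<m}) a Q b \<and> conforming (\<lambda>v. ?e ` set (fs ! v)) Q)"
        using a b F(2) by (intro ex_conforming_map[OF phi]) (auto simp: n_def)
      then show ?thesis unfolding I sd_path_yes.simps V[symmetric] E'[symmetric] using a b by (simp add: \<phi>_def)
    qed
    \<comment> \<open>Each of the \<open>n\<close> lists is preceded by its length, so
      \<open>L\<close> already accounts for the vertices.\<close>
    have size: "sd_path_size I = m + L"
    proof -
      have "card (f (vs ! i)) = length (fs ! i)" if "i < n" for i
      proof -
        have "inj_on (\<lambda>k. {vs ! fst (es ! k), vs ! snd (es ! k)}) (set (fs ! i))"
          using inj_on_subset[OF inj] fs(2) that n_def by blast
        then have "card (f (vs ! i)) = card (set (fs ! i))"
          using card_image[of "\<lambda>k. {vs ! fst (es ! k), vs ! snd (es ! k)}" "set (fs ! i)"] fs(2) that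
          by (simp add: n_def)
        then show ?thesis using fs(2) that distinct_card[of "fs ! i"] by (simp add: n_def)
      qed
      then have "(\<Sum>v\<in>V. card (f v)) = (\<Sum>i<n. length (fs ! i))"
        unfolding V by (subst sum.reindex[OF phi]) (auto simp: \<phi>_def)
      also have "\<dots> = sum_list (map length fs)"
        using fs(1) by (simp add: sum_list_sum_nth n_def atLeast0LessThan)
      finally have "(\<Sum>v\<in>V. card (f v)) = sum_list (map length fs)" .
      moreover have "card V = length fs" using vs fs(1) distinct_card[of vs] by simp
      moreover have "card E = m" using card_image[OF inj] E by (simp add: m_def)
      ultimately show ?thesis by (simp add: I L_def length_encode_lists)
    qed
    define S where "S = sd_path_size I"
    have n: "0 < n" "n \<le> L" using a(1) fs(1) by (auto simp: n_def L_def length_encode_lists)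
    have S: "n \<le> S" "m \<le> S" "L \<le> S" "1 \<le> S" using n size by (auto simp: S_def)
    have W: "2 * n * n + m * m + 20 * (n + m + L) + 100 < (S + 1) ^ c"
    proof -
      have sq: "n * n \<le> S * S" "m * m \<le> S * S" "S \<le> S * S" "1 \<le> S * S" using S by (auto intro: mult_le_mono)
      \<comment> \<open>As \<open>1 \<le> S\<close>, every term is bounded by a multiple of
        \<open>S * S\<close>. The factor 223 stays below \<open>2 ^ 8\<close>, hence below
        \<open>(S + 1) ^ 8\<close>, and the square takes the remaining two powers.\<close>
      have "2 * n * n + m * m + 20 * (n + m + L) + 100 \<le> 223 * (S * S)"
      proof -
        have "2 * x + y + 20 * (n + m + L) + 100 \<le> 223 * z"
          if "x \<le> z" "y \<le> z" "S \<le> z" "1 \<le> z" for x y z :: nat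
          using that S unfolding distrib_left by linarith
        from this[OF sq] show ?thesis by (simp only: mult.assoc)
      qed
      also have "\<dots> < 256 * ((S + 1) * (S + 1))" by simp
      also have "\<dots> \<le> (S + 1) ^ 8 * (S + 1) ^ 2"
      proof -
        have "(2 :: nat) ^ 8 \<le> (S + 1) ^ 8" using S(4) by (intro power_mono) auto
        then show ?thesis by (intro mult_le_mono) (auto simp: power2_eq_square)
      qed
      also have "\<dots> = (S + 1) ^ 10" by (simp add: power_add[symmetric])
      also have "\<dots> \<le> (S + 1) ^ c" by (rule power_increasing) (use c in auto)
      finally show ?thesis .
    qed
    \<comment> \<open>The rules for programs start from a bounded state, so the input words
      themselves must fit into machine words.\<close>
    have entries: "x \<le> S" if "x \<in> set xs" for x
    proof -
      have xs_x: "x \<in> set xs" by (fact that)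
      consider "x \<in> {n, m, a, b}" | k where "k < m" "x = fst (es ! k) \<or> x = snd (es ! k)"
        | l where "l \<in> set fs" "x = length l" | l where "l \<in> set fs" "x \<in> set l"
      proof -
        have "x \<in> {n, m, a, b} \<or> x \<in> set (concat (map (\<lambda>(i, j). [i, j]) es)) \<or> x \<in> set (encode_lists fs)"
          using xs_x unfolding xs n_def m_def by (simp only: set_append list.set) blast
        moreover have "\<exists>k<m. x = fst (es ! k) \<or> x = snd (es ! k)"
          if "x \<in> set (concat (map (\<lambda>(i, j). [i, j]) es))"
        proof -
          obtain e where "e \<in> set es" "x = fst e \<or> x = snd e" using \<open>x \<in> set (concat _)\<close> by auto
          then show ?thesis by (metis in_set_conv_nth m_def)
        qed
        moreover have "\<exists>l\<in>set fs. x = length l \<or> x \<in> set l" if "x \<in> set (encode_lists fs)"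
          using that by auto
        ultimately show thesis using that by blast
      qed
      then show ?thesis
      proof cases
        case 1
        then show ?thesis using S a b by (auto simp: n_def)
      next
        case 2
        then show ?thesis using S es by (auto simp: n_def m_def)
      next
        case 3
        then have "length l \<le> sum_list (map length fs)" by (intro member_le_sum_list) auto
        then show ?thesis using 3 S by (simp add: L_def length_encode_lists)
      next
        case 4
        then obtain i where "i < n" "l = fs ! i" using fs(1) by (auto simp: in_set_conv_nth n_def)
        then have "x < m" using F(1) 4 by auto
        then show ?thesis using S by simp
      qed
    qed
    have "S < (S + 1) ^ c" using W size unfolding S_def[symmetric] distrib_left by linarith
    then have bd: "bounded ((S + 1) ^ c) (input_state xs)"
      using le_less_trans[OF entries] nth_mem by (auto simp: bounded_def input_state_def)
    have init: "input_state xs = (\<lambda>_. 0, \<lambda>A. if A = 0 then inp else (\<lambda>_. 0))"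
      by (auto simp: input_state_def inp_def fun_eq_iff)
    have "runs ((S + 1) ^ c) decide_com (2000 * (n + m + L + 1)) (\<lambda>(r, a). r 0 =
        (if sd_path_yes I then 1 else 0)) (input_state xs)"
      unfolding yes L_def init
    proof (rule decide_runs[where fs = fs and inp = inp, OF bd[unfolded init]])
      show "\<forall>l\<in>set fs. set l \<subseteq> {..<m}" using F(1) fs(1) by (metis in_set_conv_nth n_def)
    qed (use W inp0 a(1) b(1) fs(1) reads eu_def ew_def in \<open>simp_all add: n_def L_def\<close>)
    moreover have "2000 * (n + m + L + 1) \<le> c * sd_path_size I" using size n c by simp
    ultimately show "\<exists>k \<tau>. exec ((sd_path_size I + 1) ^ c) decide_com (input_state xs) k \<tau> \<and>
        k \<le> c * sd_path_size I \<and> fst \<tau> 0 = (if sd_path_yes I then 1 else 0)"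
      unfolding runs_def S_def case_prod_beta using le_trans by blast
  qed
qed

end
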